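(* For any $x,y,z\in W_{\mathrm{af}}^-$, the structure constant $c_{x,y}^z$ of the Pontryagin product on $K_0^T(\mathrm{Gr})$, defined by $\mathcal{O}_x\cdot\mathcal{O}_y=\sum_{z\in W_{\mathrm{af}}^-}c_{x,y}^z\,\mathcal{O}_z$, is given by $$c_{x,y}^z=\sum_{t_1,t_2\in Q^\vee}b_{x,[t_1]}\;b_{y,[t_2]}\;e_{t_1t_2,[z]},$$ where $t_1,t_2$ run over the translation elements of $W_{\mathrm{af}}$.
   Context: $G$ is a simple, simply-connected complex Lie group with Borel subgroup $B$, maximal torus $T$, finite Weyl group $W$, coroot lattice $Q^\vee$, weight lattice $\Lambda$, highest root $\theta$. $W_{\mathrm{af}}=W\ltimes Q^\vee$ is the affine Weyl group (elements of $Q^\vee$ are viewed as translations $t_\lambda\in W_{\mathrm{af}}$), with simple reflections $s_i$, $i\in I_{\mathrm{af}}$ (the affine Dynkin vertex set), and Bruhat order $\le$. $W_{\mathrm{af}}^-$ is the set of minimal length representatives of the cosets in $W_{\mathrm{af}}/W$. $R(T)\cong\mathbb{Z}[\Lambda]$, $Q(T)=\mathrm{Frac}(R(T))$. $W_{\mathrm{af}}$ acts on $\Lambda$ by the level-zero action $wt_\mu\cdot\lambda=w\cdot\lambda$ ($w\in W$, $\mu\in Q^\vee$), and $\alpha_i\in\Lambda$ are the images of the simple affine roots, so $\alpha_0=-\theta$. $\mathbb{K}_Q$ is the left $Q(T)$-vector space with basis $W_{\mathrm{af}}$ and product $(p\,v)(q\,w)=p\,(v\cdot q)\,vw$ for $p,q\in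 Q(T)$, $v,w\in W_{\mathrm{af}}$. Put $T_i=(1-e^{\alpha_i})^{-1}(s_i-1)$ and $y_i=1+T_i$. Both families satisfy the braid relations, with $T_i^2=-T_i$, $y_i^2=y_i$, so $T_w$, $y_w$ are defined for $w\in W_{\mathrm{af}}$ as products along a reduced expression. $\mathbb{K}\subset\mathbb{K}_Q$ is the subring generated by $R(T)$ and the $T_i$, and $\mathbb{L}$ is the centralizer of $R(T)$ in $\mathbb{K}$. Define $b_{w,u},e_{w,u}\in Q(T)$ by $y_w=\sum_{u\in W_{\mathrm{af}}}b_{w,u}\,u$ and $w=\sum_{u\in W_{\mathrm{af}}}e_{w,u}\,y_u$ in $\mathbb{K}_Q$, and set $$b_{x,[y]}=\sum_{z\in yW}b_{x,z},\qquad e_{x,[y]}=\sum_{z\in yW}e_{x,z}.$$ $K_0^T(\mathrm{Gr})$ is the $T$-equivariant $K$-homology of the affine Grassmannian $\mathrm{Gr}$ of $G$: the Grothendieck group of $T$-equivariant coherent sheaves on $\mathrm{Gr}$ supported on some finite-dimensional Schubert variety. It is a free $R(T)$-module with basis the Schubert structure sheaf classes $\mathcal{O}_w=[\mathcal{O}_{X_w}]_T$, $w\in W_{\mathrm{af}}^-$ ($\dim X_w=\ell(w)$). Its (Pontryagin) product is the one given by the $R(T)$-algebra isomorphism $k:K_0^T(\mathrm{Gr})\to\mathbb{L}$ with $k(\mathcal{O}_w)=l_w:=\sum_{v\in W_{\mathrm{af}}^-,\,v\le w}k_v$, where for $v\in W_{\mathrm{af}}^-$, $k_v$ is the unique element of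 $\mathbb{L}$ of the form $T_v+\sum_{x\in W_{\mathrm{af}}\setminus W_{\mathrm{af}}^-}k_v^xT_x$ with $k_v^x\in R(T)$; equivalently $l_xl_y=\sum_{z\in W_{\mathrm{af}}^-}c_{x,y}^zl_z$ in $\mathbb{L}$. *)

theory Defs
  imports
    "HOL-Algebra.Generated_Rings"
    "HOL-Algebra.Coset"
    "HOL-Library.Poly_Mapping"
    "HOL-Computational_Algebra.Fraction_Field"
begin

section \<open>The root datum of a simple, simply connected group\<close>

text \<open>
  A simple, simply connected complex group with \<open>T \<subseteq> B\<close> enters through its based root datum.
  Because the group is simply connected, its cocharacter lattice is the coroot lattice, which is
  free on the simple coroots; these are indexed by \<open>'i\<close>, the vertices of the finite Dynkin
  diagram. The weight lattice is the dual lattice, free on the fundamental weights. An element of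
  \<open>'i weight\<close> (resp. \<open>'i coweight\<close>) is thus given by its coefficients with respect to the
  fundamental weights (resp. the simple coroots).
\<close>

type_synonym 'i weight = "'i \<Rightarrow>\<^sub>0 int"
type_synonym 'i coweight = "'i \<Rightarrow>\<^sub>0 int"

record 'i root_datum =
  roots :: "'i weight set"
  coroot :: "'i weight \<Rightarrow> 'i coweight"
  simple_root :: "'i \<Rightarrow> 'i weight"

definition pairing :: "'i::finite weight \<Rightarrow> 'i coweight \<Rightarrow> int" where
  "pairing l m = (\<Sum>i\<in>UNIV. Poly_Mapping.lookup l i * Poly_Mapping.lookup m i)"

definition reflection :: "'i::finite root_datum \<Rightarrow> 'i weight \<Rightarrow> 'i weight \<Rightarrow> 'i weight" where
  "reflection D a l = l - frag_cmul (pairing l (coroot D a)) a"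

definition coreflection :: "'i::finite root_datum \<Rightarrow> 'i weight \<Rightarrow> 'i coweight \<Rightarrow> 'i coweight" where
  "coreflection D a m = m - frag_cmul (pairing a m) (coroot D a)"

definition nonneg_comb :: "'i::finite root_datum \<Rightarrow> 'i weight \<Rightarrow> bool" where
  "nonneg_comb D l \<longleftrightarrow> (\<exists>n :: 'i \<Rightarrow> nat. l = (\<Sum>i\<in>UNIV. frag_cmul (int (n i)) (simple_root D i)))"

locale simple_sc_root_datum =
  fixes D :: "'i::finite root_datum"
  assumes finite_roots: "finite (roots D)"
    and inj_coroot: "inj_on (coroot D) (roots D)"
    and pairing_coroot: "a \<in> roots D \<Longrightarrow> pairing a (coroot D a) = 2"
    and reflection_roots: "a \<in> roots D \<Longrightarrow> reflection D a ` roots D \<subseteq> roots D"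
    and coreflection_coroots:
      "a \<in> roots D \<Longrightarrow> coreflection D a ` coroot D ` roots D \<subseteq> coroot D ` roots D"
    and reduced: "a \<in> roots D \<Longrightarrow> a + a \<notin> roots D"
    and irreducible:
      "\<not> (\<exists>R S. R \<noteq> {} \<and> S \<noteq> {} \<and> R \<inter> S = {} \<and> R \<union> S = roots D \<and>
              (\<forall>a\<in>R. \<forall>b\<in>S. pairing a (coroot D b) = 0))"
    and simple_root_root: "simple_root D i \<in> roots D"
    and simple_roots_independent:
      "(\<Sum>i\<in>UNIV. frag_cmul (n i) (simple_root D i)) = 0 \<Longrightarrow> n i = 0"
    and roots_sign_coherent: "a \<in> roots D \<Longrightarrow> nonneg_comb D a \<or> nonneg_comb D (- a)"
    and coroot_simple: "coroot D (simple_root D i) = frag_of i"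

definition highest_root :: "'i::finite root_datum \<Rightarrow> 'i weight" where
  "highest_root D = (THE a. a \<in> roots D \<and> (\<forall>b\<in>roots D. nonneg_comb D (a - b)))"


section \<open>The affine Weyl group\<close>

inductive_set weyl :: "'i::finite root_datum \<Rightarrow> ('i weight \<Rightarrow> 'i weight) set"
  for D where
    id: "id \<in> weyl D"
  | reflection: "w \<in> weyl D \<Longrightarrow> a \<in> roots D \<Longrightarrow> reflection D a \<circ> w \<in> weyl D"

text \<open>The contragredient action, characterized by \<open>\<langle>w l, w m\<rangle> = \<langle>l, m\<rangle>\<close>.\<close>

definition coweight_act :: "('i::finite weight \<Rightarrow> 'i weight) \<Rightarrow> 'i coweight \<Rightarrow> 'i coweight" where
  "coweight_act w m = (\<Sum>i\<in>UNIV. frag_cmul (pairing (Hilbert_Choice.inv w (frag_of i)) m) (frag_of i))"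

text \<open>The pair \<open>(m, w)\<close> stands for \<open>t\<^sub>m w\<close>, which is \<open>w t\<^sub>\<mu>\<close> with \<open>\<mu> = w\<^sup>-\<^sup>1 m\<close>.\<close>

type_synonym 'i waf = "'i coweight \<times> ('i weight \<Rightarrow> 'i weight)"

definition Waf :: "'i::finite root_datum \<Rightarrow> 'i waf monoid" where
  "Waf D = \<lparr>carrier = UNIV \<times> weyl D,
            mult = (\<lambda>(m, v) (n, w). (m + coweight_act v n, v \<circ> w)),
            one = (0, id)\<rparr>"

definition Wfin :: "'i::finite root_datum \<Rightarrow> 'i waf set" where
  "Wfin D = {0} \<times> weyl D"

definition translation :: "'i coweight \<Rightarrow> 'i waf" where
  "translation m = (m, id)"

text \<open>
  The affine Dynkin vertex set is \<open>'i option\<close>, with \<open>None\<close> as the affine vertex \<open>0\<close>: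
  \<open>s\<^sub>0\<close> is the product of the translation by the coroot of \<open>\<theta>\<close> and the reflection in \<open>\<theta>\<close>.
\<close>

fun affine_simple_root :: "'i::finite root_datum \<Rightarrow> 'i option \<Rightarrow> 'i weight" where
  "affine_simple_root D None = - highest_root D"
| "affine_simple_root D (Some i) = simple_root D i"

fun simple_reflection :: "'i::finite root_datum \<Rightarrow> 'i option \<Rightarrow> 'i waf" where
  "simple_reflection D None = (coroot D (highest_root D), reflection D (highest_root D))"
| "simple_reflection D (Some i) = (0, reflection D (simple_root D i))"

definition word_product :: "'i::finite root_datum \<Rightarrow> 'i option list \<Rightarrow> 'i waf" where
  "word_product D js = foldr (\<lambda>j w. simple_reflection D j \<otimes>\<^bsub>Waf D\<^esub> w) js \<one>\<^bsub>Waf D\<^esub>"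

definition len :: "'i::finite root_datum \<Rightarrow> 'i waf \<Rightarrow> nat" where
  "len D w = (LEAST n. \<exists>js. length js = n \<and> word_product D js = w)"

definition reduced_word :: "'i::finite root_datum \<Rightarrow> 'i waf \<Rightarrow> 'i option list \<Rightarrow> bool" where
  "reduced_word D w js \<longleftrightarrow> word_product D js = w \<and> length js = len D w"

definition affine_reflections :: "'i::finite root_datum \<Rightarrow> 'i waf set" where
  "affine_reflections D =
     {v \<otimes>\<^bsub>Waf D\<^esub> simple_reflection D j \<otimes>\<^bsub>Waf D\<^esub> inv\<^bsub>Waf D\<^esub> v | v j. v \<in> carrier (Waf D)}"

definition bruhat_le :: "'i::finite root_datum \<Rightarrow> 'i waf \<Rightarrow> 'i waf \<Rightarrow> bool" where
  "bruhat_le D =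
     (\<lambda>v w. v \<in> carrier (Waf D) \<and> len D v < len D w \<and>
            (\<exists>r\<in>affine_reflections D. w = v \<otimes>\<^bsub>Waf D\<^esub> r))\<^sup>*\<^sup>*"

text \<open>The set written \<open>W\<^sub>a\<^sub>f\<^sup>-\<close>.\<close>

definition Waf_min :: "'i::finite root_datum \<Rightarrow> 'i waf set" where
  "Waf_min D =
     {w \<in> carrier (Waf D). \<forall>z\<in>w <#\<^bsub>Waf D\<^esub> Wfin D. len D w \<le> len D z}"


section \<open>The twisted group algebra and the K-theoretic nil-Hecke ring\<close>

text \<open>
  \<open>'i RT\<close> is the group ring of the weight lattice, with \<open>e\<^sup>\<lambda> = frag_of \<lambda>\<close>. An ordering of
  \<open>'i\<close> (any enumeration of the Dynkin vertices) is required only because the library obtains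
  that this group ring is a domain from a linear order on the exponents.
\<close>

type_synonym 'i RT = "'i weight \<Rightarrow>\<^sub>0 int"
type_synonym 'i QT = "'i RT fract"
type_synonym 'i twisted = "'i waf \<Rightarrow>\<^sub>0 'i QT"

definition RT_to_QT :: "'i::{finite,linorder} RT \<Rightarrow> 'i QT" where
  "RT_to_QT p = Fract p 1"

definition RT_act :: "('i weight \<Rightarrow> 'i weight) \<Rightarrow> 'i RT \<Rightarrow> 'i RT" where
  "RT_act w = frag_extend (\<lambda>l. frag_of (w l))"

definition QT_act :: "('i::{finite,linorder} weight \<Rightarrow> 'i weight) \<Rightarrow> 'i QT \<Rightarrow> 'i QT" where
  "QT_act w f = (THE g. \<exists>p q. q \<noteq> 0 \<and> f = Fract p q \<and> g = Fract (RT_act w p) (RT_act w q))"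

text \<open>
  Elements of the twisted group algebra are finitely supported families of coefficients in
  \<open>Q(T)\<close>; the level-zero action lets \<open>(m, v)\<close> act through \<open>v\<close>.
\<close>

definition KQ :: "'i::{finite,linorder} root_datum \<Rightarrow> 'i twisted ring" where
  "KQ D = \<lparr>carrier = {a. Poly_Mapping.keys a \<subseteq> carrier (Waf D)},
           mult = (\<lambda>a b. \<Sum>v\<in>Poly_Mapping.keys a. \<Sum>w\<in>Poly_Mapping.keys b.
                     Poly_Mapping.single (v \<otimes>\<^bsub>Waf D\<^esub> w) (Poly_Mapping.lookup a v * QT_act (snd v) (Poly_Mapping.lookup b w))),
           one = Poly_Mapping.single \<one>\<^bsub>Waf D\<^esub> 1,
           zero = 0,
           add = (+)\<rparr>"

definition scale :: "'i::{finite,linorder} QT \<Rightarrow> 'i twisted \<Rightarrow> 'i twisted" where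
  "scale p a = Poly_Mapping.map ((*) p) a"

definition of_Waf :: "'i::{finite,linorder} waf \<Rightarrow> 'i twisted" where
  "of_Waf w = Poly_Mapping.single w 1"

definition of_RT :: "'i::{finite,linorder} root_datum \<Rightarrow> 'i RT \<Rightarrow> 'i twisted" where
  "of_RT D p = scale (RT_to_QT p) \<one>\<^bsub>KQ D\<^esub>"

definition T_gen :: "'i::{finite,linorder} root_datum \<Rightarrow> 'i option \<Rightarrow> 'i twisted" where
  "T_gen D j = scale (inverse (1 - RT_to_QT (frag_of (affine_simple_root D j))))
                     (of_Waf (simple_reflection D j) - \<one>\<^bsub>KQ D\<^esub>)"

definition y_gen :: "'i::{finite,linorder} root_datum \<Rightarrow> 'i option \<Rightarrow> 'i twisted" where
  "y_gen D j = \<one>\<^bsub>KQ D\<^esub> + T_gen D j"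

text \<open>By the braid relations the following products do not depend on the reduced word chosen.\<close>

definition T_elt :: "'i::{finite,linorder} root_datum \<Rightarrow> 'i waf \<Rightarrow> 'i twisted" where
  "T_elt D w = foldr (\<lambda>j a. T_gen D j \<otimes>\<^bsub>KQ D\<^esub> a) (SOME js. reduced_word D w js) \<one>\<^bsub>KQ D\<^esub>"

definition y_elt :: "'i::{finite,linorder} root_datum \<Rightarrow> 'i waf \<Rightarrow> 'i twisted" where
  "y_elt D w = foldr (\<lambda>j a. y_gen D j \<otimes>\<^bsub>KQ D\<^esub> a) (SOME js. reduced_word D w js) \<one>\<^bsub>KQ D\<^esub>"

definition b_coeff :: "'i::{finite,linorder} root_datum \<Rightarrow> 'i waf \<Rightarrow> 'i waf \<Rightarrow> 'i QT" where
  "b_coeff D w u = Poly_Mapping.lookup (y_elt D w) u"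

definition e_coeffs :: "'i::{finite,linorder} root_datum \<Rightarrow> 'i waf \<Rightarrow> ('i waf \<Rightarrow>\<^sub>0 'i QT)" where
  "e_coeffs D w = (THE e. Poly_Mapping.keys e \<subseteq> carrier (Waf D) \<and>
                          of_Waf w = (\<Sum>u\<in>Poly_Mapping.keys e. scale (Poly_Mapping.lookup e u) (y_elt D u)))"

definition e_coeff :: "'i::{finite,linorder} root_datum \<Rightarrow> 'i waf \<Rightarrow> 'i waf \<Rightarrow> 'i QT" where
  "e_coeff D w u = Poly_Mapping.lookup (e_coeffs D w) u"

definition b_coset :: "'i::{finite,linorder} root_datum \<Rightarrow> 'i waf \<Rightarrow> 'i waf \<Rightarrow> 'i QT" where
  "b_coset D x y = (\<Sum>z\<in>y <#\<^bsub>Waf D\<^esub> Wfin D. b_coeff D x z)"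

definition e_coset :: "'i::{finite,linorder} root_datum \<Rightarrow> 'i waf \<Rightarrow> 'i waf \<Rightarrow> 'i QT" where
  "e_coset D x y = (\<Sum>z\<in>y <#\<^bsub>Waf D\<^esub> Wfin D. e_coeff D x z)"

definition nil_hecke :: "'i::{finite,linorder} root_datum \<Rightarrow> 'i twisted set" where
  "nil_hecke D = generate_ring (KQ D) (range (of_RT D) \<union> range (T_gen D))"

definition RT_centralizer :: "'i::{finite,linorder} root_datum \<Rightarrow> 'i twisted set" where
  "RT_centralizer D =
     {a \<in> nil_hecke D. \<forall>p. a \<otimes>\<^bsub>KQ D\<^esub> of_RT D p = of_RT D p \<otimes>\<^bsub>KQ D\<^esub> a}"

definition k_elt :: "'i::{finite,linorder} root_datum \<Rightarrow> 'i waf \<Rightarrow> 'i twisted" where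
  "k_elt D v = (THE a. a \<in> RT_centralizer D \<and>
     (\<exists>c :: 'i waf \<Rightarrow>\<^sub>0 'i RT. Poly_Mapping.keys c \<subseteq> carrier (Waf D) - Waf_min D \<and>
        a = T_elt D v + (\<Sum>x\<in>Poly_Mapping.keys c. scale (RT_to_QT (Poly_Mapping.lookup c x)) (T_elt D x))))"

definition l_elt :: "'i::{finite,linorder} root_datum \<Rightarrow> 'i waf \<Rightarrow> 'i twisted" where
  "l_elt D w = (\<Sum>v\<in>{v \<in> Waf_min D. bruhat_le D v w}. k_elt D v)"


section \<open>Equivariant K-homology of the affine Grassmannian\<close>

text \<open>
  \<open>K\<^sub>0\<^sup>T(Gr)\<close> is the free \<open>R(T)\<close>-module on the Schubert classes \<open>O\<^sub>w\<close>, \<open>w\<close> in \<open>Waf_min D\<close>; a class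
  is represented by its finitely supported family of coefficients in this basis. The Pontryagin
  product is the one transported from the centralizer of \<open>R(T)\<close> along the \<open>R(T)\<close>-linear
  bijection sending \<open>O\<^sub>w\<close> to \<open>l_elt D w\<close>.
\<close>

type_synonym 'i KGr = "'i waf \<Rightarrow>\<^sub>0 'i RT"

definition KGr_carrier :: "'i::{finite,linorder} root_datum \<Rightarrow> 'i KGr set" where
  "KGr_carrier D = {f. Poly_Mapping.keys f \<subseteq> Waf_min D}"

definition schubert_class :: "'i::{finite,linorder} waf \<Rightarrow> 'i KGr" where
  "schubert_class w = Poly_Mapping.single w 1"

definition k_map :: "'i::{finite,linorder} root_datum \<Rightarrow> 'i KGr \<Rightarrow> 'i twisted" where
  "k_map D f = (\<Sum>w\<in>Poly_Mapping.keys f. scale (RT_to_QT (Poly_Mapping.lookup f w)) (l_elt D w))"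

definition pontryagin :: "'i::{finite,linorder} root_datum \<Rightarrow> 'i KGr \<Rightarrow> 'i KGr \<Rightarrow> 'i KGr" where
  "pontryagin D f g = the_inv_into (KGr_carrier D) (k_map D) (k_map D f \<otimes>\<^bsub>KQ D\<^esub> k_map D g)"

definition structure_constant ::
    "'i::{finite,linorder} root_datum \<Rightarrow> 'i waf \<Rightarrow> 'i waf \<Rightarrow> 'i waf \<Rightarrow> 'i RT" where
  "structure_constant D x y z =
     Poly_Mapping.lookup (pontryagin D (schubert_class x) (schubert_class y)) z"

end

theory Submission
  imports Defs
begin

text \<open>
  The quotient of the twisted group algebra by the right action of the finite Weyl group \<open>W\<close> has one
  basis vector for every coset in \<open>W\<^sub>a\<^sub>f/W\<close>. Every coset contains exactly one translation, and the
  \<open>Q(T)\<close>-span of the translations is the centralizer of \<open>R(T)\<close>, because \<open>W\<close> acts faithfully on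
  weights while translations act trivially. So there is a \<open>Q(T)\<close>-linear projection \<open>kappa\<close> of the
  twisted group algebra onto the centralizer that forgets everything but the coset.

  If \<open>x\<close> is not the shortest element of its coset, it has a reduced word that ends in a finite vertex
  \<open>i\<close>, and \<open>kappa (a T\<^sub>i) = 0\<close> shows \<open>kappa T\<^sub>x = 0\<close>. Since \<open>kappa\<close> fixes the centralizer, an element
  of the form \<open>T\<^sub>v + \<Sum> c\<^sub>x T\<^sub>x\<close> in the centralizer must be \<open>kappa T\<^sub>v\<close>; this is \<open>k\<^sub>v\<close>. From
  \<open>y\<^sub>w = (\<Sum>v\<le>w. T\<^sub>v)\<close> one gets \<open>l\<^sub>w = kappa y\<^sub>w = \<Sum> b\<^bsub>w,[t]\<^esub> t\<close>, the sum being
  over the translations. Translations commute with coefficients, so \<open>l\<^sub>x l\<^sub>y = \<Sum> b\<^bsub>x,[t\<^sub>1]\<^esub> b\<^bsub>y,[t\<^sub>2]\<^esub> t\<^sub>1 t\<^sub>2\<close>. Finally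
  \<open>kappa y\<^sub>u\<close> depends only on the coset of \<open>u\<close>, because \<open>y\<^sub>i = 1 + T\<^sub>i\<close>; hence \<open>kappa\<close> turns \<open>t = \<Sum> e\<^bsub>t,u\<^esub> y\<^sub>u\<close> into \<open>t = \<Sum> e\<^bsub>t,[z]\<^esub> l\<^sub>z\<close>, and
  comparing coefficients gives the formula (\<open>structure_constant_formula\<close>).

  What needs proof is integrality. That \<open>kappa T\<^sub>v\<close> lies in the nil-Hecke ring, so that \<open>k\<^sub>v\<close> exists at
  all, follows from the identity \<open>kappa_T_gen\<close>: the denominator in the operator which \<open>T\<^sub>j\<close> induces on
  the centralizer cancels. That products of the \<open>l\<^sub>w\<close> have coefficients in \<open>R(T)\<close> follows from
  \<open>nil_hecke_integral\<close>: the nil-Hecke ring is spanned over \<open>R(T)\<close> by the \<open>T\<^sub>w\<close>, and also by the \<open>y\<^sub>w\<close>.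

  All this presupposes that \<open>T\<^sub>w\<close> and \<open>y\<^sub>w\<close> are independent of reduced words, that they are bases, and that
  \<open>y\<^sub>w\<close> is the sum of the \<open>T\<^sub>v\<close> over the Bruhat interval. For this the action of the affine Weyl group on
  affine roots is used: it gives the exchange property (\<open>exchange\<close>), Matsumoto's theorem
  (\<open>foldr_reduced_word_unique\<close>) and the lifting property (\<open>bruhat_step_lift\<close>). The braid relations of
  the \<open>T\<^sub>i\<close> are verified in rank two by computing all coefficients.
\<close>

abbreviation lookup where "lookup \<equiv> Poly_Mapping.lookup"
abbreviation keys where "keys \<equiv> Poly_Mapping.keys"

section \<open>Braid relations in rank two\<close>

text \<open>
  A simple reflection acts by \<open>S\<close> on vectors and by \<open>\<sigma>\<close> on scalars; \<open>x\<close> stands for \<open>e\<^sup>\<alpha>\<close>. The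
  operator \<open>demazure\<close> is the one by which \<open>T\<^sub>i\<close> acts.
\<close>

locale semilinear_involution = vector_space scale
  for scale :: "'f::field \<Rightarrow> 'v::ab_group_add \<Rightarrow> 'v" (infixr "*s" 75) +
  fixes \<sigma> :: "'f \<Rightarrow> 'f" and S :: "'v \<Rightarrow> 'v" and x :: 'f
  assumes hom_add: "\<sigma> (f + g) = \<sigma> f + \<sigma> g"
    and hom_mult: "\<sigma> (f * g) = \<sigma> f * \<sigma> g"
    and hom_one: "\<sigma> 1 = 1"
    and S_add: "S (u + v) = S u + S v"
    and S_scale: "S (f *s v) = \<sigma> f *s S v"
    and S_S: "S (S v) = v"
    and hom_root: "\<sigma> x = inverse x"
    and root_nonzero: "x \<noteq> 0" and root_regular: "1 - x \<noteq> 0"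
begin

definition demazure :: "'v \<Rightarrow> 'v" where
  "demazure v = inverse (1 - x) *s (S v - v)"

lemma hom_zero: "\<sigma> 0 = 0"
  using hom_add[of 0 0] by (metis add_cancel_right_right add_0)

lemma hom_minus: "\<sigma> (- f) = - \<sigma> f"
  using hom_add[of f "- f"] by (simp add: hom_zero minus_unique)

lemma hom_diff: "\<sigma> (f - g) = \<sigma> f - \<sigma> g"
  using hom_add[of f "- g"] by (simp add: hom_minus)

lemma hom_power: "\<sigma> (f ^ n) = \<sigma> f ^ n"
  by (induction n) (simp_all add: hom_one hom_mult)

lemma hom_inverse: "\<sigma> (inverse f) = inverse (\<sigma> f)"
proof (cases "f = 0")
  case False
  then have "\<sigma> f * \<sigma> (inverse f) = 1"
    by (metis hom_mult hom_one right_inverse)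
  then show ?thesis
    by (metis inverse_unique)
qed (simp add: hom_zero)

lemma hom_divide: "\<sigma> (f / g) = \<sigma> f / \<sigma> g"
  by (simp add: divide_inverse hom_mult hom_inverse)

lemmas hom_simps = hom_add hom_mult hom_one hom_zero hom_minus hom_diff hom_power hom_divide

lemma S_zero: "S 0 = 0"
  using S_add[of 0 0] by (metis add_cancel_right_right add_0)

lemma S_minus: "S (- v) = - S v"
  using S_add[of v "- v"] by (simp add: S_zero minus_unique)

lemma S_diff: "S (u - v) = S u - S v"
  using S_add[of u "- v"] by (simp add: S_minus)

lemma demazure_add: "demazure (u + v) = demazure u + demazure v"
  by (simp add: demazure_def S_add scale_right_distrib scale_right_diff_distrib)

text \<open>
  The span of \<open>v\<close> and \<open>S v\<close> is stable under \<open>demazure\<close>. So its effect on a combination of the vectors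
  \<open>b, T b, S (T b), \<dots>\<close> is computed by cutting the combination into such pairs; the following rules do
  this from the left, where \<open>b\<close> itself spans a stable line and the last vector has no partner yet.
\<close>

lemma demazure_last:
  assumes "w = S v" and "f' = - f / (1 - x)" and "g' = \<sigma> f / (1 - x)"
  shows "demazure (f *s v) = f' *s v + g' *s w"
  by (simp add: assms demazure_def S_scale divide_inverse algebra_simps)

lemma pair_rest:
  assumes "w = S v" and "demazure r = r'" and "f' = (\<sigma> g - f) / (1 - x)" and "g' = (\<sigma> f - g) / (1 - x)"
  shows "demazure (f *s v + (g *s w + r)) = f' *s v + (g' *s w + r')"
proof -
  have "demazure (f *s v + g *s w) = f' *s v + g' *s w"
    by (simp add: assms demazure_def S_add S_scale S_S scale_right_distrib scale_right_diff_distrib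
        scale_left_diff_distrib diff_divide_distrib divide_inverse algebra_simps)
  then show ?thesis using assms(2) by (simp add: demazure_add flip: add.assoc)
qed

lemma alternating_rest:
  assumes "S v = - v" and "demazure r = r'" and "f' = - (\<sigma> f + f) / (1 - x)"
  shows "demazure (f *s v + r) = f' *s v + r'"
  by (simp add: demazure_add assms(2)) (simp add: demazure_def S_scale assms divide_inverse algebra_simps)

lemma alternating: "S (S v - v) = - (S v - v)"
  by (simp add: S_diff S_S)

lemma demazure_of: "demazure v = (1 / (1 - x)) *s (S v - v)"
  by (simp add: demazure_def divide_inverse)

lemma demazure_demazure: "demazure (demazure v) = - demazure v"
proof -
  have "\<sigma> (1 / (1 - x)) + 1 / (1 - x) = 1"
    using root_nonzero root_regular by (simp add: hom_simps hom_root divide_simps) (simp add: algebra_simps)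
  then have "demazure ((1 / (1 - x)) *s (S v - v) + 0) = (- (1 / (1 - x))) *s (S v - v) + 0"
    by (intro alternating_rest alternating) (simp_all add: add.commute demazure_def S_zero)
  then show ?thesis by (simp add: demazure_of)
qed

end

text \<open>
  Suppose that the operator of a braid word which is applied first belongs to \<open>S\<close>. It replaces \<open>v\<close> by a
  multiple of \<open>b = S v - v\<close>, which is antisymmetric under \<open>S\<close>. Hence an alternating word of length \<open>n\<close> gives a combination of only \<open>n\<close>
  vectors \<open>b, T b, S (T b), \<dots>\<close> instead of \<open>2 n\<close>, the size of a Bruhat interval. At the length \<open>m\<close> of the braid
  relation all coefficients are, up to sign, the inverse of the product of \<open>1 - e\<^sup>\<beta>\<close> over the positive roots
  \<open>\<beta>\<close>, which is symmetric in the two letters. This is the braid relation. The coefficients at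
  intermediate lengths have been found by polynomial division; each step of the proofs checks one
  application of an operator.
\<close>

locale rank_two = s: semilinear_involution scale \<sigma> S x + t: semilinear_involution scale \<tau> T y
  for scale :: "'f::field \<Rightarrow> 'v::ab_group_add \<Rightarrow> 'v" (infixr "*s" 75) and \<sigma> S x \<tau> T y
begin

abbreviation "C \<equiv> s.demazure"
abbreviation "D \<equiv> t.demazure"

text \<open>
  The names spell out the root: \<open>xxy\<close> is \<open>e\<close> to the power \<open>2 \<alpha> + \<beta>\<close>. Keeping them folded lets the reflections
  act by permuting names.
\<close>

definition "xy = x * y"
definition "xxy = x^2 * y"
definition "xxxy = x^3 * y"
definition "xxxyy = x^3 * y^2"
lemmas roots = xy_def xxy_def xxxy_def xxxyy_def
lemmas expand = roots power2_eq_square power3_eq_cube algebra_simps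

lemma braid_2:
  assumes st: "\<And>v. S (T v) = T (S v)" and sy: "\<sigma> y = y" and tx: "\<tau> x = x"
  shows "C (D v) = D (C v)"
  by (simp add: s.demazure_def t.demazure_def s.S_scale t.S_scale s.S_diff t.S_diff st
      s.hom_inverse t.hom_inverse s.hom_simps t.hom_simps sy tx s.scale_right_diff_distrib mult.commute)

end

locale A2 = rank_two +
  assumes sy: "\<sigma> y = x * y" and tx: "\<tau> x = x * y"
    and regular: "1 - xy \<noteq> 0"
begin

lemma images:
  "\<sigma> x = inverse x" "\<sigma> y = xy" "\<sigma> xy = y"
  "\<tau> x = xy" "\<tau> y = inverse y" "\<tau> xy = x"
  using s.root_nonzero t.root_nonzero
  by (simp_all add: roots s.hom_simps t.hom_simps s.hom_root t.hom_root sy tx power2_eq_square power3_eq_cube field_simps)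

lemmas nz = s.root_nonzero t.root_nonzero s.root_regular t.root_regular regular
lemmas field = images s.hom_simps t.hom_simps divide_simps

lemma A2_s:
  assumes b: "b = S v - v" and v1: "v1 = T b" and v2: "v2 = S v1"
  shows "C (D (C v)) =
      (1 / ((1 - x) * (1 - y) * (1 - xy))) *s b +
      ((- (1 / ((1 - x) * (1 - y) * (1 - xy)))) *s v1 +
      ((1 / ((1 - x) * (1 - y) * (1 - xy))) *s v2))"
proof -
  have alt: "S b = - b" unfolding b by (rule s.alternating)
  have 1: "C v = (1 / (1 - x)) *s b" by (simp add: s.demazure_of b)
  have 2: "D (C v) =
      (- (1 / ((1 - x) * (1 - y)))) *s b +
      ((1 / ((1 - y) * (1 - xy))) *s v1)"
    unfolding 1
    by (rule t.demazure_last[OF v1])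
      (use nz in \<open>simp_all add: field\<close>, (simp_all add: expand)?)
  show ?thesis
    unfolding 2
    by (rule s.alternating_rest[OF alt], rule s.demazure_last[OF v2])
      (use nz in \<open>simp_all add: field\<close>, (simp_all add: expand)?)
qed

lemma A2_t:
  assumes b: "b = T v - v" and v1: "v1 = S b" and v2: "v2 = T v1"
  shows "D (C (D v)) =
      (1 / ((1 - x) * (1 - y) * (1 - xy))) *s b +
      ((- (1 / ((1 - x) * (1 - y) * (1 - xy)))) *s v1 +
      ((1 / ((1 - x) * (1 - y) * (1 - xy))) *s v2))"
proof -
  have alt: "T b = - b" unfolding b by (rule t.alternating)
  have 1: "D v = (1 / (1 - y)) *s b" by (simp add: t.demazure_of b)
  have 2: "C (D v) =
      (- (1 / ((1 - x) * (1 - y)))) *s b +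
      ((1 / ((1 - x) * (1 - xy))) *s v1)"
    unfolding 1
    by (rule s.demazure_last[OF v1])
      (use nz in \<open>simp_all add: field\<close>, (simp_all add: expand)?)
  show ?thesis
    unfolding 2
    by (rule t.alternating_rest[OF alt], rule t.demazure_last[OF v2])
      (use nz in \<open>simp_all add: field\<close>, (simp_all add: expand)?)
qed

lemma braid_3:
  assumes braid: "\<And>v. S (T (S v)) = T (S (T v))"
  shows "C (D (C v)) = D (C (D v))"
  unfolding A2_s[OF refl refl refl] A2_t[OF refl refl refl]
  by (simp add: s.S_diff t.S_diff s.S_S t.S_S braid s.scale_right_diff_distrib)

end

locale B2 = rank_two +
  assumes sy: "\<sigma> y = x^2 * y" and tx: "\<tau> x = x * y"
    and regular: "1 - xy \<noteq> 0" "1 - xxy \<noteq> 0"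
begin

lemma images:
  "\<sigma> x = inverse x" "\<sigma> y = xxy" "\<sigma> xy = xy" "\<sigma> xxy = y"
  "\<tau> x = xy" "\<tau> y = inverse y" "\<tau> xy = x" "\<tau> xxy = xxy"
  using s.root_nonzero t.root_nonzero
  by (simp_all add: roots s.hom_simps t.hom_simps s.hom_root t.hom_root sy tx power2_eq_square power3_eq_cube field_simps)

lemmas nz = s.root_nonzero t.root_nonzero s.root_regular t.root_regular regular
lemmas field = images s.hom_simps t.hom_simps divide_simps

lemma B2_s:
  assumes b: "b = S v - v" and v1: "v1 = T b" and v2: "v2 = S v1" and v3: "v3 = T v2"
  shows "D (C (D (C v))) =
      (- (1 / ((1 - x) * (1 - y) * (1 - xy) * (1 - xxy)))) *s b +
      ((1 / ((1 - x) * (1 - y) * (1 - xy) * (1 - xxy))) *s v1 +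
      ((- (1 / ((1 - x) * (1 - y) * (1 - xy) * (1 - xxy)))) *s v2 +
      ((1 / ((1 - x) * (1 - y) * (1 - xy) * (1 - xxy))) *s v3)))"
proof -
  have alt: "S b = - b" unfolding b by (rule s.alternating)
  have 1: "C v = (1 / (1 - x)) *s b" by (simp add: s.demazure_of b)
  have 2: "D (C v) =
      (- (1 / ((1 - x) * (1 - y)))) *s b +
      ((1 / ((1 - y) * (1 - xy))) *s v1)"
    unfolding 1
    by (rule t.demazure_last[OF v1])
      (use nz in \<open>simp_all add: field\<close>, (simp_all add: expand)?)
  have 3: "C (D (C v)) =
      ((1 + xy) / ((1 - x) * (1 - y) * (1 - xxy))) *s b +
      ((- (1 / ((1 - x) * (1 - y) * (1 - xy)))) *s v1 +
      ((1 / ((1 - x) * (1 - xy) * (1 - xxy))) *s v2))"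
    unfolding 2
    by (rule s.alternating_rest[OF alt], rule s.demazure_last[OF v2])
      (use nz in \<open>simp_all add: field\<close>, (simp_all add: expand)?)
  show ?thesis
    unfolding 3
    by (rule t.pair_rest[OF v1], rule t.demazure_last[OF v3])
      (use nz in \<open>simp_all add: field\<close>, (simp_all add: expand)?)
qed

lemma B2_t:
  assumes b: "b = T v - v" and v1: "v1 = S b" and v2: "v2 = T v1" and v3: "v3 = S v2"
  shows "C (D (C (D v))) =
      (- (1 / ((1 - x) * (1 - y) * (1 - xy) * (1 - xxy)))) *s b +
      ((1 / ((1 - x) * (1 - y) * (1 - xy) * (1 - xxy))) *s v1 +
      ((- (1 / ((1 - x) * (1 - y) * (1 - xy) * (1 - xxy)))) *s v2 +
      ((1 / ((1 - x) * (1 - y) * (1 - xy) * (1 - xxy))) *s v3)))"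
proof -
  have alt: "T b = - b" unfolding b by (rule t.alternating)
  have 1: "D v = (1 / (1 - y)) *s b" by (simp add: t.demazure_of b)
  have 2: "C (D v) =
      (- (1 / ((1 - x) * (1 - y)))) *s b +
      ((1 / ((1 - x) * (1 - xxy))) *s v1)"
    unfolding 1
    by (rule s.demazure_last[OF v1])
      (use nz in \<open>simp_all add: field\<close>, (simp_all add: expand)?)
  have 3: "D (C (D v)) =
      (1 / ((1 - x) * (1 - y) * (1 - xy))) *s b +
      ((- (1 / ((1 - x) * (1 - y) * (1 - xxy)))) *s v1 +
      ((1 / ((1 - y) * (1 - xy) * (1 - xxy))) *s v2))"
    unfolding 2
    by (rule t.alternating_rest[OF alt], rule t.demazure_last[OF v2])
      (use nz in \<open>simp_all add: field\<close>, (simp_all add: expand)?)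
  show ?thesis
    unfolding 3
    by (rule s.pair_rest[OF v1], rule s.demazure_last[OF v3])
      (use nz in \<open>simp_all add: field\<close>, (simp_all add: expand)?)
qed

lemma braid_4:
  assumes braid: "\<And>v. S (T (S (T v))) = T (S (T (S v)))"
  shows "C (D (C (D v))) = D (C (D (C v)))"
  unfolding B2_s[OF refl refl refl refl] B2_t[OF refl refl refl refl]
  by (simp add: s.S_diff t.S_diff s.S_S t.S_S braid s.scale_right_diff_distrib)

end

locale G2 = rank_two +
  assumes sy: "\<sigma> y = x^3 * y" and tx: "\<tau> x = x * y"
    and regular: "1 - xy \<noteq> 0" "1 - xxy \<noteq> 0" "1 - xxxy \<noteq> 0" "1 - xxxyy \<noteq> 0"
begin

lemma images:
  "\<sigma> x = inverse x" "\<sigma> y = xxxy" "\<sigma> xy = xxy" "\<sigma> xxy = xy" "\<sigma> xxxy = y" "\<sigma> xxxyy = xxxyy"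
  "\<tau> x = xy" "\<tau> y = inverse y" "\<tau> xy = x" "\<tau> xxy = xxy" "\<tau> xxxy = xxxyy" "\<tau> xxxyy = xxxy"
  using s.root_nonzero t.root_nonzero
  by (simp_all add: roots s.hom_simps t.hom_simps s.hom_root t.hom_root sy tx power2_eq_square power3_eq_cube field_simps)

lemmas nz = s.root_nonzero t.root_nonzero s.root_regular t.root_regular regular
lemmas field = images s.hom_simps t.hom_simps divide_simps

lemma G2_s:
  assumes b: "b = S v - v" and v1: "v1 = T b" and v2: "v2 = S v1" and v3: "v3 = T v2" and v4: "v4 = S v3" and v5: "v5 = T v4"
  shows "D (C (D (C (D (C v))))) =
      (- (1 / ((1 - x) * (1 - y) * (1 - xy) * (1 - xxy) * (1 - xxxy) * (1 - xxxyy)))) *s b +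
      ((1 / ((1 - x) * (1 - y) * (1 - xy) * (1 - xxy) * (1 - xxxy) * (1 - xxxyy))) *s v1 +
      ((- (1 / ((1 - x) * (1 - y) * (1 - xy) * (1 - xxy) * (1 - xxxy) * (1 - xxxyy)))) *s v2 +
      ((1 / ((1 - x) * (1 - y) * (1 - xy) * (1 - xxy) * (1 - xxxy) * (1 - xxxyy))) *s v3 +
      ((- (1 / ((1 - x) * (1 - y) * (1 - xy) * (1 - xxy) * (1 - xxxy) * (1 - xxxyy)))) *s v4 +
      ((1 / ((1 - x) * (1 - y) * (1 - xy) * (1 - xxy) * (1 - xxxy) * (1 - xxxyy))) *s v5)))))"
proof -
  have alt: "S b = - b" unfolding b by (rule s.alternating)
  have 1: "C v = (1 / (1 - x)) *s b" by (simp add: s.demazure_of b)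
  have 2: "D (C v) =
      (- (1 / ((1 - x) * (1 - y)))) *s b +
      ((1 / ((1 - y) * (1 - xy))) *s v1)"
    unfolding 1
    by (rule t.demazure_last[OF v1])
      (use nz in \<open>simp_all add: field\<close>, (simp_all add: expand)?)
  have 3: "C (D (C v)) =
      ((1 + xy + xxy) / ((1 - x) * (1 - y) * (1 - xxxy))) *s b +
      ((- (1 / ((1 - x) * (1 - y) * (1 - xy)))) *s v1 +
      ((1 / ((1 - x) * (1 - xxy) * (1 - xxxy))) *s v2))"
    unfolding 2
    by (rule s.alternating_rest[OF alt], rule s.demazure_last[OF v2])
      (use nz in \<open>simp_all add: field\<close>, (simp_all add: expand)?)
  have 4: "D (C (D (C v))) =
      (- ((1 + xxy) / ((1 - x) * (1 - y) * (1 - xy) * (1 - xxxy)))) *s b +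
      (((1 + xxy) / ((1 - x) * (1 - y) * (1 - xy) * (1 - xxxyy))) *s v1 +
      ((- (1 / ((1 - x) * (1 - y) * (1 - xxy) * (1 - xxxy)))) *s v2 +
      ((1 / ((1 - y) * (1 - xy) * (1 - xxy) * (1 - xxxyy))) *s v3)))"
    unfolding 3
    by (rule t.pair_rest[OF v1], rule t.demazure_last[OF v3])
      (use nz in \<open>simp_all add: field\<close>, (simp_all add: expand)?)
  have 5: "C (D (C (D (C v)))) =
      ((1 + xxxyy) / ((1 - x) * (1 - y) * (1 - xy) * (1 - xxy) * (1 - xxxy))) *s b +
      ((- ((1 + xxy + xxy^2) / ((1 - x) * (1 - y) * (1 - xy) * (1 - xxxy) * (1 - xxxyy)))) *s v1 +
      (((1 + xy + xy^2) / ((1 - x) * (1 - y) * (1 - xxy) * (1 - xxxy) * (1 - xxxyy))) *s v2 +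
      ((- (1 / ((1 - x) * (1 - y) * (1 - xy) * (1 - xxy) * (1 - xxxyy)))) *s v3 +
      ((1 / ((1 - x) * (1 - xy) * (1 - xxy) * (1 - xxxy) * (1 - xxxyy))) *s v4))))"
    unfolding 4
    by (rule s.alternating_rest[OF alt], rule s.pair_rest[OF v2], rule s.demazure_last[OF v4])
      (use nz in \<open>simp_all add: field\<close>, (simp_all add: expand)?)
  show ?thesis
    unfolding 5
    by (rule t.pair_rest[OF v1], rule t.pair_rest[OF v3], rule t.demazure_last[OF v5])
      (use nz in \<open>simp_all add: field\<close>, (simp_all add: expand)?)
qed

lemma G2_t:
  assumes b: "b = T v - v" and v1: "v1 = S b" and v2: "v2 = T v1" and v3: "v3 = S v2" and v4: "v4 = T v3" and v5: "v5 = S v4"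
  shows "C (D (C (D (C (D v))))) =
      (- (1 / ((1 - x) * (1 - y) * (1 - xy) * (1 - xxy) * (1 - xxxy) * (1 - xxxyy)))) *s b +
      ((1 / ((1 - x) * (1 - y) * (1 - xy) * (1 - xxy) * (1 - xxxy) * (1 - xxxyy))) *s v1 +
      ((- (1 / ((1 - x) * (1 - y) * (1 - xy) * (1 - xxy) * (1 - xxxy) * (1 - xxxyy)))) *s v2 +
      ((1 / ((1 - x) * (1 - y) * (1 - xy) * (1 - xxy) * (1 - xxxy) * (1 - xxxyy))) *s v3 +
      ((- (1 / ((1 - x) * (1 - y) * (1 - xy) * (1 - xxy) * (1 - xxxy) * (1 - xxxyy)))) *s v4 +
      ((1 / ((1 - x) * (1 - y) * (1 - xy) * (1 - xxy) * (1 - xxxy) * (1 - xxxyy))) *s v5)))))"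
proof -
  have alt: "T b = - b" unfolding b by (rule t.alternating)
  have 1: "D v = (1 / (1 - y)) *s b" by (simp add: t.demazure_of b)
  have 2: "C (D v) =
      (- (1 / ((1 - x) * (1 - y)))) *s b +
      ((1 / ((1 - x) * (1 - xxxy))) *s v1)"
    unfolding 1
    by (rule s.demazure_last[OF v1])
      (use nz in \<open>simp_all add: field\<close>, (simp_all add: expand)?)
  have 3: "D (C (D v)) =
      (1 / ((1 - x) * (1 - y) * (1 - xy))) *s b +
      ((- (1 / ((1 - x) * (1 - y) * (1 - xxxy)))) *s v1 +
      ((1 / ((1 - y) * (1 - xy) * (1 - xxxyy))) *s v2))"
    unfolding 2
    by (rule t.alternating_rest[OF alt], rule t.demazure_last[OF v2])
      (use nz in \<open>simp_all add: field\<close>, (simp_all add: expand)?)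
  have 4: "C (D (C (D v))) =
      (- ((1 + xxy) / ((1 - x) * (1 - y) * (1 - xy) * (1 - xxxy)))) *s b +
      (((1 + xy) / ((1 - x) * (1 - y) * (1 - xxy) * (1 - xxxy))) *s v1 +
      ((- (1 / ((1 - x) * (1 - y) * (1 - xy) * (1 - xxxyy)))) *s v2 +
      ((1 / ((1 - x) * (1 - xxy) * (1 - xxxy) * (1 - xxxyy))) *s v3)))"
    unfolding 3
    by (rule s.pair_rest[OF v1], rule s.demazure_last[OF v3])
      (use nz in \<open>simp_all add: field\<close>, (simp_all add: expand)?)
  have 5: "D (C (D (C (D v)))) =
      ((1 + xxy) / ((1 - x) * (1 - y) * (1 - xy) * (1 - xxxy) * (1 - xxxyy))) *s b +
      ((- (1 / ((1 - x) * (1 - y) * (1 - xy) * (1 - xxy) * (1 - xxxy)))) *s v1 +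
      ((1 / ((1 - x) * (1 - y) * (1 - xy) * (1 - xxy) * (1 - xxxyy))) *s v2 +
      ((- (1 / ((1 - x) * (1 - y) * (1 - xxy) * (1 - xxxy) * (1 - xxxyy)))) *s v3 +
      ((1 / ((1 - y) * (1 - xy) * (1 - xxy) * (1 - xxxy) * (1 - xxxyy))) *s v4))))"
    unfolding 4
    by (rule t.alternating_rest[OF alt], rule t.pair_rest[OF v2], rule t.demazure_last[OF v4])
      (use nz in \<open>simp_all add: field\<close>, (simp_all add: expand)?)
  show ?thesis
    unfolding 5
    by (rule s.pair_rest[OF v1], rule s.pair_rest[OF v3], rule s.demazure_last[OF v5])
      (use nz in \<open>simp_all add: field\<close>, (simp_all add: expand)?)
qed

lemma braid_6:
  assumes braid: "\<And>v. S (T (S (T (S (T v))))) = T (S (T (S (T (S v)))))"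
  shows "C (D (C (D (C (D v))))) = D (C (D (C (D (C v)))))"
  unfolding G2_s[OF refl refl refl refl refl refl] G2_t[OF refl refl refl refl refl refl]
  by (simp add: s.S_diff t.S_diff s.S_S t.S_S braid s.scale_right_diff_distrib)

end

section \<open>The finite root system\<close>

lemma pairing_add_left: "pairing (l + l') m = pairing l m + pairing l' m"
  by (simp add: pairing_def lookup_add sum.distrib algebra_simps)

lemma pairing_add_right: "pairing l (m + m') = pairing l m + pairing l m'"
  by (simp add: pairing_def lookup_add sum.distrib algebra_simps)

lemma pairing_uminus_left: "pairing (- l) m = - pairing l m"
  by (simp add: pairing_def sum_negf)

lemma pairing_uminus_right: "pairing l (- m) = - pairing l m"
  by (simp add: pairing_def sum_negf)

lemma pairing_diff_left: "pairing (l - l') m = pairing l m - pairing l' m"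
  by (simp add: pairing_def lookup_minus sum_subtractf algebra_simps)

lemma pairing_diff_right: "pairing l (m - m') = pairing l m - pairing l m'"
  by (simp add: pairing_def lookup_minus sum_subtractf algebra_simps)

lemma pairing_cmul_left: "pairing (frag_cmul c l) m = c * pairing l m"
  by (simp add: pairing_def sum_distrib_left algebra_simps)

lemma pairing_cmul_right: "pairing l (frag_cmul c m) = c * pairing l m"
  by (simp add: pairing_def sum_distrib_left algebra_simps)

lemma pairing_zero_left: "pairing 0 m = 0"
  by (simp add: pairing_def)

lemma pairing_zero_right: "pairing l 0 = 0"
  by (simp add: pairing_def)

lemma pairing_sum_left: "pairing (sum f A) m = (\<Sum>i\<in>A. pairing (f i) m)"
  by (induction A rule: infinite_finite_induct) (simp_all add: pairing_zero_left pairing_add_left)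

lemma pairing_sum_right: "pairing l (sum f A) = (\<Sum>i\<in>A. pairing l (f i))"
  by (induction A rule: infinite_finite_induct) (simp_all add: pairing_zero_right pairing_add_right)

lemmas pairing_simps = pairing_add_left pairing_add_right pairing_uminus_left pairing_uminus_right
  pairing_diff_left pairing_diff_right pairing_cmul_left pairing_cmul_right
  pairing_zero_left pairing_zero_right

lemma pairing_frag_of_right: "pairing l (frag_of i) = lookup l i"
  by (simp add: pairing_def if_distrib cong: if_cong)

lemma pairing_frag_of_left: "pairing (frag_of i) m = lookup m i"
  by (simp add: pairing_def if_distrib if_distribR cong: if_cong)

lemma weight_eqI: "(\<And>i. pairing l (frag_of i) = pairing l' (frag_of i)) \<Longrightarrow> l = l'"
  by (rule poly_mapping_eqI) (simp add: pairing_frag_of_right)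

lemma coweight_eqI: "(\<And>l. pairing l m = pairing l m') \<Longrightarrow> m = m'"
  by (rule poly_mapping_eqI) (metis pairing_frag_of_left)

lemma reflection_add: "reflection D a (l + l') = reflection D a l + reflection D a l'"
  by (simp add: reflection_def pairing_simps frag_cmul_distrib)

lemma reflection_cmul: "reflection D a (frag_cmul c l) = frag_cmul c (reflection D a l)"
  by (rule poly_mapping_eqI) (simp add: reflection_def pairing_simps lookup_minus algebra_simps)

lemma reflection_uminus: "reflection D a (- l) = - reflection D a l"
  using reflection_cmul[of D a "- 1" l] by simp

lemma pairing_reflection: "pairing (reflection D a l) m = pairing l (coreflection D a m)"
  by (simp add: reflection_def coreflection_def pairing_simps)

lemma nonneg_comb_add: "nonneg_comb D l \<Longrightarrow> nonneg_comb D l' \<Longrightarrow> nonneg_comb D (l + l')"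
  unfolding nonneg_comb_def
  by (elim exE, rule_tac x = "\<lambda>i. n i + na i" in exI) (simp add: frag_cmul_distrib sum.distrib)

lemma nonneg_comb_zero: "nonneg_comb D 0"
  unfolding nonneg_comb_def by (rule exI[of _ "\<lambda>_. 0"]) simp

lemma nonneg_comb_cmul: "nonneg_comb D l \<Longrightarrow> 0 \<le> c \<Longrightarrow> nonneg_comb D (frag_cmul c l)"
  unfolding nonneg_comb_def
  by (elim exE, rule_tac x = "\<lambda>i. nat c * n i" in exI) (simp add: frag_cmul_sum)

definition root_comb :: "'i::finite root_datum \<Rightarrow> ('i \<Rightarrow> int) \<Rightarrow> 'i weight" where
  "root_comb D n = (\<Sum>i\<in>UNIV. frag_cmul (n i) (simple_root D i))"

lemma root_comb_diff: "root_comb D (\<lambda>i. n i - m i) = root_comb D n - root_comb D m"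
  by (simp add: root_comb_def frag_cmul_diff_distrib sum_subtractf)

lemma root_comb_cmul: "root_comb D (\<lambda>i. c * n i) = frag_cmul c (root_comb D n)"
  by (simp add: root_comb_def frag_cmul_sum)

lemma root_comb_uminus: "root_comb D (\<lambda>i. - n i) = - root_comb D n"
  using root_comb_cmul[of D "- 1" n] by simp

lemma root_comb_single: "root_comb D (\<lambda>j. if j = i then c else 0) = frag_cmul c (simple_root D i)"
  by (simp add: root_comb_def if_distrib if_distribR cong: if_cong)

lemma root_comb_update:
  "root_comb D (n(i := n i - c)) = root_comb D n - frag_cmul c (simple_root D i)"
proof -
  have "n(i := n i - c) = (\<lambda>j. n j - (if j = i then c else 0))" by auto
  then show ?thesis by (simp add: root_comb_diff root_comb_single)
qed

lemma simple_root_nonneg: "nonneg_comb D (simple_root D i)"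
  unfolding nonneg_comb_def
  by (rule exI[of _ "\<lambda>j. if j = i then 1 else 0"]) (simp add: if_distrib if_distribR cong: if_cong)

context simple_sc_root_datum
begin

lemma root_comb_eq_iff: "root_comb D n = root_comb D m \<longleftrightarrow> n = m"
proof
  assume "root_comb D n = root_comb D m"
  then have "root_comb D (\<lambda>i. n i - m i) = 0" by (simp add: root_comb_diff)
  then have "n i - m i = 0" for i
    using simple_roots_independent[of "\<lambda>i. n i - m i" i] by (simp add: root_comb_def)
  then show "n = m" by auto
qed simp

lemma nonneg_comb_iff: "nonneg_comb D (root_comb D n) \<longleftrightarrow> (\<forall>i. 0 \<le> n i)"
proof
  assume "nonneg_comb D (root_comb D n)"
  then obtain m where "root_comb D n = root_comb D (\<lambda>i. int (m i))"
    unfolding nonneg_comb_def root_comb_def by blast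
  then show "\<forall>i. 0 \<le> n i" by (simp add: root_comb_eq_iff)
next
  assume "\<forall>i. 0 \<le> n i"
  then show "nonneg_comb D (root_comb D n)"
    unfolding nonneg_comb_def by (intro exI[of _ "\<lambda>i. nat (n i)"]) (simp add: root_comb_def)
qed

lemma nonneg_combE:
  assumes "nonneg_comb D l"
  obtains n where "l = root_comb D n" and "\<And>i. 0 \<le> n i"
  using assms unfolding nonneg_comb_def
proof (elim exE)
  fix n assume "l = (\<Sum>i\<in>UNIV. frag_cmul (int (n i)) (simple_root D i))"
  then show thesis by (intro that[of "\<lambda>i. int (n i)"]) (simp_all add: root_comb_def)
qed

lemma root_combE:
  assumes "a \<in> roots D"
  obtains n where "a = root_comb D n" and "(\<forall>i. 0 \<le> n i) \<or> (\<forall>i. n i \<le> 0)"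
  using roots_sign_coherent[OF assms]
proof
  assume "nonneg_comb D (- a)"
  then obtain n where n: "- a = root_comb D n" "\<And>i. 0 \<le> n i" by (elim nonneg_combE) blast
  have "a = root_comb D (\<lambda>i. - n i)" unfolding root_comb_uminus n(1)[symmetric] by simp
  with n(2) show thesis by (intro that[of "\<lambda>i. - n i"]) simp_all
qed (metis nonneg_combE that)

lemma nonneg_comb_antisym: "nonneg_comb D l \<Longrightarrow> nonneg_comb D (- l) \<Longrightarrow> l = 0"
proof -
  assume "nonneg_comb D l" "nonneg_comb D (- l)"
  then obtain n where n: "l = root_comb D n" "\<And>i. 0 \<le> n i" by (elim nonneg_combE) blast
  with \<open>nonneg_comb D (- l)\<close> have "\<forall>i. 0 \<le> - n i"
    using nonneg_comb_iff[of "\<lambda>i. - n i"] by (simp add: root_comb_uminus)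
  with n have "n = (\<lambda>i. 0)" by (auto intro!: ext antisym)
  with n show "l = 0" by (simp add: root_comb_def)
qed

subsection \<open>The invariant form\<close>

text \<open>
  The canonical invariant form. It makes coroots computable: \<open>\<langle>l, a\<^sup>\<or>\<rangle> = 2 (l, a) / (a, a)\<close>, see
  \<open>form_root\<close>.
\<close>

definition form :: "'i weight \<Rightarrow> 'i weight \<Rightarrow> int" where
  "form l m = (\<Sum>a\<in>roots D. pairing l (coroot D a) * pairing m (coroot D a))"

lemma form_commute: "form l m = form m l"
  by (simp add: form_def mult.commute)

lemma form_add: "form l (m + m') = form l m + form l m'"
  by (simp add: form_def pairing_simps sum.distrib algebra_simps)

lemma form_cmul: "form l (frag_cmul c m) = c * form l m"
  by (simp add: form_def pairing_simps sum_distrib_left algebra_simps)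

lemma form_zero: "form l 0 = 0"
  by (simp add: form_def pairing_simps)

lemma form_sum: "form l (sum f A) = (\<Sum>i\<in>A. form l (f i))"
  by (induction A rule: infinite_finite_induct) (simp_all add: form_zero form_add)

lemma form_uminus: "form l (- m) = - form l m"
  using form_cmul[of l "- 1" m] by simp

lemma form_diff: "form l (m - m') = form l m - form l m'"
  using form_add[of l m "- m'"] by (simp add: form_uminus)

lemma form_root_comb: "form l (root_comb D n) = (\<Sum>i\<in>UNIV. n i * form l (simple_root D i))"
  by (simp add: root_comb_def form_sum form_cmul)

lemma coreflection_coreflection: "a \<in> roots D \<Longrightarrow> coreflection D a (coreflection D a m) = m"
  by (rule poly_mapping_eqI)
    (simp add: coreflection_def pairing_simps pairing_coroot lookup_minus lookup_add algebra_simps)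

lemma reflection_reflection: "a \<in> roots D \<Longrightarrow> reflection D a (reflection D a l) = l"
  by (rule poly_mapping_eqI)
    (simp add: reflection_def pairing_simps pairing_coroot lookup_minus lookup_add algebra_simps)

lemma reflection_self: "a \<in> roots D \<Longrightarrow> reflection D a a = - a"
  by (rule poly_mapping_eqI) (simp add: reflection_def pairing_coroot lookup_minus)

lemma reflection_root: "a \<in> roots D \<Longrightarrow> b \<in> roots D \<Longrightarrow> reflection D a b \<in> roots D"
  using reflection_roots by blast

lemma form_reflection:
  assumes a: "a \<in> roots D"
  shows "form (reflection D a l) (reflection D a m) = form l m"
proof -
  let ?c = "coreflection D a"
  have bij: "bij_betw ?c (coroot D ` roots D) (coroot D ` roots D)"
    using coreflection_coroots[OF a] coreflection_coreflection[OF a]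
    by (intro bij_betwI[where g = ?c]) auto
  have "form l m = (\<Sum>c\<in>coroot D ` roots D. pairing l c * pairing m c)" for l m
    by (simp add: form_def sum.reindex[OF inj_coroot])
  then show ?thesis
    using sum.reindex_bij_betw[OF bij, of "\<lambda>c. pairing l c * pairing m c"]
    by (simp add: pairing_reflection)
qed

lemma form_root:
  assumes a: "a \<in> roots D"
  shows "pairing l (coroot D a) * form a a = 2 * form l a"
proof -
  have "form (reflection D a l) a = - form l a"
    using form_reflection[OF a, of l "- a"]
    by (simp add: reflection_uminus reflection_self[OF a] form_uminus)
  then show ?thesis
    by (simp add: reflection_def form_commute[of "l - frag_cmul c a" a for c] form_commute[of l a] form_diff form_cmul)
qed

lemma form_self_nonneg: "0 \<le> form l l"
  by (simp add: form_def sum_nonneg)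

lemma form_self_eq_0:
  assumes "form l l = 0"
  shows "l = 0"
proof (rule weight_eqI)
  fix i
  have "\<forall>a\<in>roots D. pairing l (coroot D a) * pairing l (coroot D a) = 0"
    using assms unfolding form_def by (subst (asm) sum_nonneg_eq_0_iff) (simp_all add: finite_roots)
  then show "pairing l (frag_of i) = pairing 0 (frag_of i)"
    using simple_root_root[of i] coroot_simple[of i] by (force simp: pairing_simps)
qed

lemma root_nonzero: "a \<in> roots D \<Longrightarrow> a \<noteq> 0"
  using pairing_coroot[of a] by (auto simp: pairing_simps)

lemma form_root_pos: "a \<in> roots D \<Longrightarrow> 0 < form a a"
  using form_self_nonneg[of a] form_self_eq_0[of a] root_nonzero[of a] by linarith

lemma pairing_pos_iff: "a \<in> roots D \<Longrightarrow> 0 < pairing l (coroot D a) \<longleftrightarrow> 0 < form l a"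
proof -
  assume a: "a \<in> roots D"
  have "0 < pairing l (coroot D a) \<longleftrightarrow> 0 < pairing l (coroot D a) * form a a"
    using form_root_pos[OF a] by (simp add: zero_less_mult_iff)
  then show ?thesis by (simp add: form_root[OF a])
qed

lemma pairing_zero_iff: "a \<in> roots D \<Longrightarrow> pairing l (coroot D a) = 0 \<longleftrightarrow> form l a = 0"
  using form_root[of a l] form_root_pos[of a] by auto

text \<open>
  The form determines the coroot of a root, and it is invariant.
\<close>

lemma coroot_reflection:
  assumes a: "a \<in> roots D" and b: "b \<in> roots D"
  shows "coroot D (reflection D a b) = coreflection D a (coroot D b)"
proof (rule coweight_eqI)
  fix l
  let ?b = "reflection D a b"
  have b': "?b \<in> roots D" using a b by (rule reflection_root)
  have "pairing l (coroot D ?b) * form b b = 2 * form l ?b"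
    using form_root[OF b', of l] by (simp add: form_reflection[OF a])
  also have "form l ?b = form (reflection D a l) b"
    using form_reflection[OF a, of "reflection D a l" b] by (simp add: reflection_reflection[OF a])
  also have "2 * \<dots> = pairing l (coreflection D a (coroot D b)) * form b b"
    using form_root[OF b, of "reflection D a l"] by (simp add: pairing_reflection)
  finally show "pairing l (coroot D ?b) = pairing l (coreflection D a (coroot D b))"
    using form_root_pos[OF b] by simp
qed

lemma uminus_root: "a \<in> roots D \<Longrightarrow> - a \<in> roots D"
  using reflection_root[of a a] by (simp add: reflection_self)

lemma coroot_uminus: "a \<in> roots D \<Longrightarrow> coroot D (- a) = - coroot D a"
  using coroot_reflection[of a a]
  by (simp add: reflection_self coreflection_def pairing_coroot poly_mapping_eq_iff lookup_minus fun_eq_iff)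

lemma reflection_of_uminus: "a \<in> roots D \<Longrightarrow> reflection D (- a) = reflection D a"
  by (rule ext) (simp add: reflection_def coroot_uminus pairing_simps poly_mapping_eq_iff lookup_minus fun_eq_iff)

lemma pairing_symmetric_sign:
  assumes "a \<in> roots D" "b \<in> roots D"
  shows "pairing a (coroot D b) = 0 \<longleftrightarrow> pairing b (coroot D a) = 0"
  using assms by (simp add: pairing_zero_iff form_commute)

text \<open>Cauchy--Schwarz, in the form that controls the Cartan integers of two roots.\<close>

lemma cartan_product:
  assumes a: "a \<in> roots D" and b: "b \<in> roots D"
  defines "p \<equiv> pairing a (coroot D b)" and "q \<equiv> pairing b (coroot D a)"
  shows "p * q \<le> 4" and "p * q = 4 \<Longrightarrow> frag_cmul 2 a = frag_cmul p b"
    and "p * q \<ge> 0"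
proof -
  \<comment> \<open>The norm of this vector is \<open>(4 - p q) (a, a)\<close>; it is twice the part of \<open>a\<close> orthogonal to \<open>b\<close>.\<close>
  let ?v = "frag_cmul 2 a - frag_cmul p b"
  have pb: "p * form b b = 2 * form a b" and qa: "q * form a a = 2 * form a b"
    using form_root[OF b, of a] form_root[OF a, of b] by (simp_all add: p_def q_def form_commute)
  have "form ?v ?v = 4 * form a a - 2 * p * (2 * form a b) + p * (p * form b b)"
    unfolding form_diff form_cmul form_commute[of ?v a] form_commute[of ?v b] form_commute[of b a]
    by (simp add: algebra_simps)
  also have "\<dots> = 4 * form a a - p * (q * form a a)"
    unfolding pb qa[symmetric] by (simp add: algebra_simps)
  finally have v: "form ?v ?v = (4 - p * q) * form a a" by (simp add: algebra_simps)
  show "p * q \<le> 4"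
    using v form_self_nonneg[of ?v] form_root_pos[OF a] by (simp add: zero_le_mult_iff)
  show "frag_cmul 2 a = frag_cmul p b" if "p * q = 4"
    using v that form_self_eq_0[of ?v] by simp
  have "p * q * (form b b * form a a) = (p * form b b) * (q * form a a)" by simp
  also have "\<dots> \<ge> 0" unfolding pb qa by (simp add: zero_le_mult_iff)
  finally have "0 \<le> p * q * (form b b * form a a)" .
  moreover have "0 < form b b * form a a" using form_root_pos[OF a] form_root_pos[OF b] by simp
  ultimately show "p * q \<ge> 0" by (meson not_le mult_neg_pos)
qed

text \<open>
  Both Cartan integers are positive and their product is at most \<open>4\<close>, with \<open>2 \<cdot> 2\<close> only if \<open>a = b\<close>. So one
  of them is \<open>1\<close>, and the corresponding reflection produces \<open>a - b\<close> or \<open>b - a\<close>.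
\<close>

lemma diff_root:
  assumes a: "a \<in> roots D" and b: "b \<in> roots D" and pos: "0 < form a b" and "a \<noteq> b"
  shows "a - b \<in> roots D"
proof -
  define p where "p = pairing a (coroot D b)"
  define q where "q = pairing b (coroot D a)"
  have "0 < p" "0 < q"
    using pos pairing_pos_iff[OF a, of b] pairing_pos_iff[OF b, of a] by (simp_all add: p_def q_def form_commute)
  have pq: "p * q \<le> 4" using cartan_product(1)[OF a b] by (simp add: p_def q_def)
  have "\<not> (p \<ge> 2 \<and> q \<ge> 2)"
  proof
    assume *: "p \<ge> 2 \<and> q \<ge> 2"
    then have "p * q \<ge> 2 * q" "2 * q \<ge> 4" by auto
    then have "p * q = 4" "q = 2" using pq by linarith+
    then have "p = 2" by simp
    then have "frag_cmul 2 a = frag_cmul 2 b"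
      using cartan_product(2)[OF a b] \<open>p * q = 4\<close> by (simp add: p_def q_def)
    then have "a = b" by (simp add: poly_mapping_eq_iff fun_eq_iff)
    then show False using \<open>a \<noteq> b\<close> by simp
  qed
  then consider "p = 1" | "q = 1" using \<open>0 < p\<close> \<open>0 < q\<close> by linarith
  then show ?thesis
  proof cases
    case 1
    then show ?thesis using reflection_root[OF b a] by (simp add: reflection_def p_def)
  next
    case 2
    then have "b - a \<in> roots D" using reflection_root[OF a b] by (simp add: reflection_def q_def)
    then show ?thesis using uminus_root by fastforce
  qed
qed

lemma root_multiple:
  assumes a: "a \<in> roots D" and ca: "frag_cmul c a \<in> roots D" and "0 < c"
  shows "c = 1"
proof -
  have "c * pairing a (coroot D (frag_cmul c a)) = 2"
    using pairing_coroot[OF ca] by (simp add: pairing_simps)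
  then have "c dvd 2" by (metis dvd_triv_left)
  then have "c \<le> 2" using zdvd_imp_le by auto
  moreover have "c \<noteq> 2"
    using reduced[OF a] ca frag_cmul_distrib[of 1 1 a] by auto
  ultimately show ?thesis using \<open>0 < c\<close> by simp
qed

subsection \<open>Positive roots\<close>

definition pos_roots :: "'i weight set" where
  "pos_roots = {a \<in> roots D. nonneg_comb D a}"

lemma pos_rootsD: "a \<in> pos_roots \<Longrightarrow> a \<in> roots D"
  by (simp add: pos_roots_def)

lemma pos_or_neg: "a \<in> roots D \<Longrightarrow> a \<in> pos_roots \<or> - a \<in> pos_roots"
  using roots_sign_coherent uminus_root by (auto simp: pos_roots_def)

lemma not_pos_and_neg: "a \<in> pos_roots \<Longrightarrow> - a \<notin> pos_roots"
  using nonneg_comb_antisym root_nonzero by (auto simp: pos_roots_def)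

lemma simple_root_pos: "simple_root D i \<in> pos_roots"
  by (simp add: pos_roots_def simple_root_root simple_root_nonneg)

text \<open>
  A positive root other than the simple one involves a second simple root, and the reflection does not
  change the coefficient there; sign coherence does the rest.
\<close>

lemma reflection_simple_pos:
  assumes a: "a \<in> pos_roots" and ne: "a \<noteq> simple_root D i"
  shows "reflection D (simple_root D i) a \<in> pos_roots"
proof -
  let ?s = "simple_root D i"
  obtain n where n: "a = root_comb D n" "\<And>i. 0 \<le> n i"
    using a by (auto simp: pos_roots_def elim: nonneg_combE)
  obtain j where j: "j \<noteq> i" "0 < n j"
  proof (rule ccontr)
    assume "\<not> thesis"
    then have "\<forall>j. j \<noteq> i \<longrightarrow> n j = 0" using n(2) that by (meson antisym not_le)
    then have "n = (\<lambda>j. if j = i then n i else 0)" by auto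
    then have eq: "a = frag_cmul (n i) ?s" using n(1) root_comb_single by metis
    moreover have "n i \<noteq> 0" using eq root_nonzero[OF pos_rootsD[OF a]] by auto
    ultimately have "n i = 1"
      using root_multiple[OF simple_root_root, of "n i" i] n(2)[of i] pos_rootsD[OF a] by simp
    then show False using eq ne by simp
  qed
  define m where "m = n(i := n i - pairing a (coroot D ?s))"
  have m: "reflection D ?s a = root_comb D m"
    unfolding m_def root_comb_update by (simp add: reflection_def n(1))
  have r: "reflection D ?s a \<in> roots D"
    using pos_rootsD[OF a] simple_root_root by (rule reflection_root[rotated])
  moreover have "m j > 0" using j by (simp add: m_def)
  then have "\<not> nonneg_comb D (- root_comb D m)"
    using nonneg_comb_iff[of "\<lambda>i. - m i"] unfolding root_comb_uminus by (metis neg_0_le_iff_le not_le)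
  ultimately show ?thesis
    using roots_sign_coherent[OF r] by (simp add: pos_roots_def m)
qed

text \<open>
  Otherwise \<open>(a, a) \<le> 0\<close>.
\<close>

lemma exists_simple_pairing_pos:
  assumes a: "a \<in> pos_roots"
  obtains i where "0 < pairing a (coroot D (simple_root D i))"
proof (rule ccontr)
  assume "\<not> thesis"
  with that have *: "form a (simple_root D i) \<le> 0" for i
    using pairing_pos_iff[OF simple_root_root] by (metis linorder_not_le)
  obtain n where n: "a = root_comb D n" "\<And>i. 0 \<le> n i"
    using a by (auto simp: pos_roots_def elim: nonneg_combE)
  have "form a a = (\<Sum>i\<in>UNIV. n i * form a (simple_root D i))"
    by (subst (2) n(1)) (rule form_root_comb)
  also have "\<dots> \<le> 0" using n(2) * by (intro sum_nonpos) (simp add: mult_le_0_iff)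
  finally show False using form_root_pos[OF pos_rootsD[OF a]] by simp
qed

text \<open>A simple reflection with positive pairing lowers the height and, unless the root is simple, keeps it positive.\<close>

lemma pos_root_induct [consumes 1, case_names simple reflect]:
  assumes a: "a \<in> pos_roots"
    and simple: "\<And>i. P (simple_root D i)"
    and reflect: "\<And>i b. b \<in> pos_roots \<Longrightarrow> b \<noteq> simple_root D i \<Longrightarrow> P b \<Longrightarrow> P (reflection D (simple_root D i) b)"
  shows "P a"
proof -
  have "a = root_comb D n \<Longrightarrow> a \<in> pos_roots \<Longrightarrow> P a" for n a
  proof (induction "nat (\<Sum>i\<in>UNIV. n i)" arbitrary: a n rule: less_induct)
    case less
    note a = less.prems
    show ?case
    proof (cases "\<exists>i. a = simple_root D i")
      case False
      obtain i where i: "0 < pairing a (coroot D (simple_root D i))"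
        using a(2) by (rule exists_simple_pairing_pos)
      define m where "m = n(i := n i - pairing a (coroot D (simple_root D i)))"
      define b where "b = reflection D (simple_root D i) a"
      have b: "b = root_comb D m"
        unfolding m_def root_comb_update by (simp add: b_def reflection_def a(1))
      have bp: "b \<in> pos_roots"
        unfolding b_def using a(2) False by (intro reflection_simple_pos) auto
      have m0: "\<forall>i. 0 \<le> m i" using bp b nonneg_comb_iff by (simp add: pos_roots_def)
      have "(\<Sum>j\<in>UNIV. m j) < (\<Sum>j\<in>UNIV. n j)"
        using i by (intro sum_strict_mono_ex1) (auto simp: m_def)
      moreover have "0 \<le> (\<Sum>j\<in>UNIV. m j)" using m0 by (intro sum_nonneg) auto
      ultimately have "P b" using less.hyps[of m b] b bp by simp
      moreover have "b \<noteq> simple_root D i"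
        using a(2) not_pos_and_neg[OF simple_root_pos] reflection_self[OF simple_root_root]
          reflection_reflection[OF simple_root_root] unfolding b_def by metis
      ultimately have "P (reflection D (simple_root D i) b)" using bp by (intro reflect) auto
      then show ?thesis by (simp add: b_def reflection_reflection simple_root_root)
    qed (use simple in auto)
  qed
  then show ?thesis using a nonneg_combE unfolding pos_roots_def by blast
qed

subsection \<open>The highest root\<close>

abbreviation simple_refl :: "'i \<Rightarrow> 'i weight \<Rightarrow> 'i weight" where
  "simple_refl i \<equiv> reflection D (simple_root D i)"

text \<open>
  Otherwise the difference of the two simple roots would be a root, with coefficients of both signs.
\<close>

lemma simple_pairing_nonpos:
  assumes "i \<noteq> j"
  shows "pairing (simple_root D i) (coroot D (simple_root D j)) \<le> 0"
proof (rule ccontr)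
  assume neg: "\<not> ?thesis"
  have ne: "simple_root D i \<noteq> simple_root D j"
    using assms coroot_simple[of i] coroot_simple[of j] by (metis frag_of_eq)
  have "simple_root D i - simple_root D j \<in> roots D"
    using neg ne pairing_pos_iff[OF simple_root_root]
    by (intro diff_root simple_root_root) (auto simp: not_le)
  then obtain n where n: "simple_root D i - simple_root D j = root_comb D n"
    "(\<forall>k. 0 \<le> n k) \<or> (\<forall>k. n k \<le> 0)"
    by (rule root_combE)
  have "simple_root D i - simple_root D j
      = root_comb D (\<lambda>k. (if k = i then 1 else 0) - (if k = j then 1 else 0))"
    by (simp add: root_comb_diff root_comb_single)
  then have "n = (\<lambda>k. (if k = i then 1 else 0) - (if k = j then 1 else 0))"
    using n(1) by (simp only: root_comb_eq_iff)
  then have "n i = 1" "n j = -1" using assms by simp_all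
  then show False using n(2) by (metis not_one_le_zero neg_0_le_iff_le)
qed

text \<open>
  The support of a dominant positive root is a union of connected components of the Dynkin diagram;
  irreducibility makes it everything.
\<close>

lemma dominant_full_support:
  assumes a: "root_comb D n \<in> pos_roots"
    and dom: "\<And>i. 0 \<le> pairing (root_comb D n) (coroot D (simple_root D i))"
  shows "0 < n i"
proof -
  let ?\<alpha> = "simple_root D"
  have n0: "0 \<le> n i" for i using a by (simp add: pos_roots_def nonneg_comb_iff)
  define J where "J = {i. 0 < n i}"
  have orth: "pairing (?\<alpha> j) (coroot D (?\<alpha> i)) = 0" if "j \<in> J" "i \<notin> J" for i j
  proof -
    have ni: "n i = 0" using that n0[of i] by (simp add: J_def)
    have "pairing (root_comb D n) (coroot D (?\<alpha> i)) = (\<Sum>k\<in>UNIV. n k * pairing (?\<alpha> k) (coroot D (?\<alpha> i)))"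
      by (simp add: root_comb_def pairing_sum_left pairing_simps)
    moreover have le: "n k * pairing (?\<alpha> k) (coroot D (?\<alpha> i)) \<le> 0" for k
      using simple_pairing_nonpos[of k i] n0[of k] ni by (cases "k = i") (auto simp: mult_le_0_iff)
    ultimately have "(\<Sum>k\<in>UNIV. - (n k * pairing (?\<alpha> k) (coroot D (?\<alpha> i)))) = 0"
      using dom[of i] sum_nonpos[of UNIV "\<lambda>k. n k * pairing (?\<alpha> k) (coroot D (?\<alpha> i))"]
      by (simp add: sum_negf)
    then have "n j * pairing (?\<alpha> j) (coroot D (?\<alpha> i)) = 0"
      using le by (subst (asm) sum_nonneg_eq_0_iff) auto
    then show ?thesis using that(1) by (simp add: J_def)
  qed
  have orth': "pairing (?\<alpha> i) (coroot D (?\<alpha> j)) = 0" if "j \<in> J" "i \<notin> J" for i j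
    using orth[OF that] pairing_symmetric_sign[OF simple_root_root simple_root_root] by blast
  \<comment> \<open>If some vertex were outside \<open>J\<close>, the sets \<open>R\<close> and \<open>S\<close> would decompose the root system.\<close>
  define R where "R = {root_comb D m | m. root_comb D m \<in> roots D \<and> (\<forall>i. i \<notin> J \<longrightarrow> m i = 0)}"
  define S where "S = {root_comb D m | m. root_comb D m \<in> roots D \<and> (\<forall>i. i \<in> J \<longrightarrow> m i = 0)}"
  have RI: "root_comb D m \<in> R" if "root_comb D m \<in> roots D" "\<forall>i. i \<notin> J \<longrightarrow> m i = 0" for m
    using that unfolding R_def by blast
  have SI: "root_comb D m \<in> S" if "root_comb D m \<in> roots D" "\<forall>i. i \<in> J \<longrightarrow> m i = 0" for m
    using that unfolding S_def by blast
  have RSE: "\<exists>m. b = root_comb D m \<and> ((\<forall>i. i \<notin> J \<longrightarrow> m i = 0) \<or> (\<forall>i. i \<in> J \<longrightarrow> m i = 0))"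
    if "b \<in> R \<union> S" for b
    using that unfolding R_def S_def by blast
  have single: "?\<alpha> i = root_comb D (\<lambda>j. if j = i then 1 else 0)" for i by (simp add: root_comb_single)
  have pos: "b \<in> R \<union> S" if "b \<in> pos_roots" for b
    using that
  proof (induction rule: pos_root_induct)
    case (simple i)
    have "root_comb D (\<lambda>j. if j = i then 1 else 0) \<in> R \<union> S"
      using simple_root_root[of i] RI SI unfolding single by (cases "i \<in> J") simp_all
    then show ?case by (simp only: single)
  next
    case (reflect i b)
    have r: "reflection D (?\<alpha> i) b \<in> roots D"
      using reflect(1) by (intro reflection_root simple_root_root) (rule pos_rootsD)
    obtain m where m: "b = root_comb D m" and mJ: "(\<forall>i. i \<notin> J \<longrightarrow> m i = 0) \<or> (\<forall>i. i \<in> J \<longrightarrow> m i = 0)"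
      using RSE[OF reflect(3)] by blast
    have e: "pairing b (coroot D (?\<alpha> i)) = (\<Sum>k\<in>UNIV. m k * pairing (?\<alpha> k) (coroot D (?\<alpha> i)))"
      by (simp add: m root_comb_def pairing_sum_left pairing_simps)
    define m' where "m' = m(i := m i - pairing b (coroot D (?\<alpha> i)))"
    have m': "reflection D (?\<alpha> i) b = root_comb D m'"
      unfolding m'_def root_comb_update by (simp add: m reflection_def)
    have "(\<forall>i. i \<notin> J \<longrightarrow> m' i = 0) \<or> (\<forall>i. i \<in> J \<longrightarrow> m' i = 0)"
      using mJ
    proof
      assume A: "\<forall>i. i \<notin> J \<longrightarrow> m i = 0"
      then have "i \<notin> J \<Longrightarrow> pairing b (coroot D (?\<alpha> i)) = 0"
        unfolding e using orth by (intro sum.neutral) auto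
      then show ?thesis using A by (auto simp: m'_def)
    next
      assume A: "\<forall>i. i \<in> J \<longrightarrow> m i = 0"
      then have "i \<in> J \<Longrightarrow> pairing b (coroot D (?\<alpha> i)) = 0"
        unfolding e using orth' by (intro sum.neutral) auto
      then show ?thesis using A by (auto simp: m'_def)
    qed
    then show ?case using r RI[of m'] SI[of m'] unfolding m' by blast
  qed
  have neg: "- b \<in> R \<Longrightarrow> b \<in> R" "- b \<in> S \<Longrightarrow> b \<in> S" if "b \<in> roots D" for b
  proof -
    have e: "b = root_comb D (\<lambda>i. - m i)" if "- b = root_comb D m" for m
      unfolding root_comb_uminus that[symmetric] by simp
    show "b \<in> R" if R: "- b \<in> R"
    proof -
      obtain m where m: "- b = root_comb D m" "\<forall>i. i \<notin> J \<longrightarrow> m i = 0" using R unfolding R_def by blast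
      show ?thesis unfolding R_def using e[OF m(1)] m(2) \<open>b \<in> roots D\<close>
        by (intro CollectI exI[of _ "\<lambda>i. - m i"]) simp
    qed
    show "b \<in> S" if S: "- b \<in> S"
    proof -
      obtain m where m: "- b = root_comb D m" "\<forall>i. i \<in> J \<longrightarrow> m i = 0" using S unfolding S_def by blast
      show ?thesis unfolding S_def using e[OF m(1)] m(2) \<open>b \<in> roots D\<close>
        by (intro CollectI exI[of _ "\<lambda>i. - m i"]) simp
    qed
  qed
  have RS: "R \<union> S = roots D"
  proof
    show "roots D \<subseteq> R \<union> S" using pos pos_or_neg neg by blast
  next
    show "R \<union> S \<subseteq> roots D" unfolding R_def S_def by blast
  qed
  have disj: "R \<inter> S = {}"
  proof (rule ccontr)
    assume "R \<inter> S \<noteq> {}"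
    then obtain m m' where m: "root_comb D m = root_comb D m'" "root_comb D m \<in> roots D"
      "\<forall>i. i \<notin> J \<longrightarrow> m i = 0" "\<forall>i. i \<in> J \<longrightarrow> m' i = 0"
      unfolding R_def S_def by blast
    then have "m = m'" by (simp add: root_comb_eq_iff)
    then have "m = (\<lambda>_. 0)" using m by auto
    then show False using m(2) root_nonzero by (force simp: root_comb_def)
  qed
  have RSorth: "pairing b (coroot D c) = 0" if bR: "b \<in> R" and cS: "c \<in> S" for b c
  proof -
    obtain m where m: "b = root_comb D m" "\<forall>i. i \<notin> J \<longrightarrow> m i = 0" using bR unfolding R_def by blast
    obtain k where k: "c = root_comb D k" "\<forall>i. i \<in> J \<longrightarrow> k i = 0" "c \<in> roots D" using cS unfolding S_def by blast
    have sorth: "form (?\<alpha> j) (?\<alpha> i) = 0" if "j \<in> J" "i \<notin> J" for i j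
      using orth[OF that] pairing_zero_iff[OF simple_root_root] by blast
    have "form (?\<alpha> j) c = 0" if "j \<in> J" for j
      unfolding k(1) form_root_comb using k(2) sorth[OF that] by (intro sum.neutral) auto
    then have "m j * form c (?\<alpha> j) = 0" for j
      using m(2) form_commute[of c "?\<alpha> j"] by (cases "j \<in> J") simp_all
    then have "form c b = 0"
      unfolding m(1) form_root_comb by (intro sum.neutral) blast
    then show ?thesis using pairing_zero_iff[OF k(3)] by (simp add: form_commute)
  qed
  have "root_comb D n \<in> R"
  proof -
    have "\<forall>i. i \<notin> J \<longrightarrow> n i = 0" using n0 unfolding J_def by (simp add: order.antisym not_less)
    then show ?thesis unfolding R_def using pos_rootsD[OF a] by blast
  qed
  then have "R \<noteq> {}" by blast
  have "S = {}"
  proof (rule ccontr)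
    assume "S \<noteq> {}"
    have "\<forall>a\<in>R. \<forall>b\<in>S. pairing a (coroot D b) = 0" by (intro ballI RSorth)
    with \<open>R \<noteq> {}\<close> \<open>S \<noteq> {}\<close> disj RS
    have "R \<noteq> {} \<and> S \<noteq> {} \<and> R \<inter> S = {} \<and> R \<union> S = roots D \<and>
        (\<forall>a\<in>R. \<forall>b\<in>S. pairing a (coroot D b) = 0)"
      by (intro conjI)
    then show False using irreducible by metis
  qed
  moreover have "?\<alpha> i \<in> S" if "i \<notin> J"
    using that simple_root_root[of i] SI unfolding single by simp
  ultimately show ?thesis unfolding J_def by blast
qed

lemma maximal_dominant:
  assumes a: "a \<in> roots D" and max: "\<And>b. b \<in> roots D \<Longrightarrow> nonneg_comb D (b - a) \<Longrightarrow> b = a"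
  shows "0 \<le> pairing a (coroot D (simple_root D i))"
proof (rule ccontr)
  assume neg: "\<not> ?thesis"
  have "nonneg_comb D (simple_refl i a - a)"
    using neg nonneg_comb_cmul[OF simple_root_nonneg[of D i], of "- pairing a (coroot D (simple_root D i))"]
    by (simp add: reflection_def)
  then have "simple_refl i a = a"
    using max reflection_root[OF simple_root_root a] by blast
  then show False using neg root_nonzero[OF simple_root_root] by (simp add: reflection_def)
qed

lemma maximal_pos:
  assumes a: "a \<in> roots D" and max: "\<And>b. b \<in> roots D \<Longrightarrow> nonneg_comb D (b - a) \<Longrightarrow> b = a"
  shows "a \<in> pos_roots"
proof (rule ccontr)
  assume "a \<notin> pos_roots"
  then have na: "- a \<in> pos_roots" using pos_or_neg[OF a] by blast
  then have "nonneg_comb D (- a - a)"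
    using nonneg_comb_add[of D "- a" "- a"] by (simp add: pos_roots_def)
  then have "- a = a" using max pos_rootsD[OF na] by blast
  then show False using na \<open>a \<notin> pos_roots\<close> by simp
qed

text \<open>
  Two maximal roots are dominant and have full support, so their inner product is positive. Then their
  difference is a root, which makes them comparable.
\<close>

lemma maximal_unique:
  assumes a: "a \<in> roots D" and maxa: "\<And>b. b \<in> roots D \<Longrightarrow> nonneg_comb D (b - a) \<Longrightarrow> b = a"
    and c: "c \<in> roots D" and maxc: "\<And>b. b \<in> roots D \<Longrightarrow> nonneg_comb D (b - c) \<Longrightarrow> b = c"
  shows "a = c"
proof (rule ccontr)
  assume "a \<noteq> c"
  let ?\<alpha> = "simple_root D"
  note pa = maximal_pos[OF a maxa] and pc = maximal_pos[OF c maxc]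
  obtain n where n: "c = root_comb D n" using pc by (auto simp: pos_roots_def elim: nonneg_combE)
  have n0: "0 < n i" for i
    using dominant_full_support[of n i] pc maximal_dominant[OF c maxc] unfolding n by blast
  have da: "0 \<le> form a (?\<alpha> i)" for i
    using maximal_dominant[OF a maxa, of i] pairing_pos_iff[OF simple_root_root, of a i]
      pairing_zero_iff[OF simple_root_root, of a i] by linarith
  obtain i where "0 < pairing a (coroot D (?\<alpha> i))" using pa by (rule exists_simple_pairing_pos)
  then have i: "0 < form a (?\<alpha> i)" by (simp add: pairing_pos_iff simple_root_root)
  have "form a c = (\<Sum>i\<in>UNIV. n i * form a (?\<alpha> i))" unfolding n by (rule form_root_comb)
  also have "\<dots> > 0"
    by (intro sum_pos2[of _ i] mult_pos_pos mult_nonneg_nonneg n0 da i less_imp_le[OF n0]) simp_all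
  finally have "a - c \<in> roots D" using a c \<open>a \<noteq> c\<close> by (intro diff_root)
  then consider "nonneg_comb D (a - c)" | "nonneg_comb D (c - a)"
    using roots_sign_coherent by fastforce
  then show False using maxa[OF c] maxc[OF a] \<open>a \<noteq> c\<close> by cases auto
qed

lemma below_maximal:
  assumes a: "a \<in> roots D"
  shows "\<exists>c\<in>roots D. nonneg_comb D (c - a) \<and> (\<forall>b\<in>roots D. nonneg_comb D (b - c) \<longrightarrow> b = c)"
  using assms
proof (induction "card {b\<in>roots D. nonneg_comb D (b - a)}" arbitrary: a rule: less_induct)
    case less
    show ?case
    proof (cases "\<forall>b\<in>roots D. nonneg_comb D (b - a) \<longrightarrow> b = a")
      case True
      moreover have "nonneg_comb D (a - a)" by (simp add: nonneg_comb_zero)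
      ultimately show ?thesis using less.prems by blast
    next
      case False
      then obtain b where b: "b \<in> roots D" "nonneg_comb D (b - a)" "b \<noteq> a" by blast
      have tr: "nonneg_comb D (c - a)" if "nonneg_comb D (c - b)" for c
        using nonneg_comb_add[OF that b(2)] by simp
      have "a \<notin> {c\<in>roots D. nonneg_comb D (c - b)}"
        using nonneg_comb_antisym[of "b - a"] b by auto
      moreover have "a \<in> {c\<in>roots D. nonneg_comb D (c - a)}" using less.prems by (simp add: nonneg_comb_zero)
      ultimately have "{c\<in>roots D. nonneg_comb D (c - b)} \<subset> {c\<in>roots D. nonneg_comb D (c - a)}"
        using tr by blast
      then have "card {c\<in>roots D. nonneg_comb D (c - b)} < card {c\<in>roots D. nonneg_comb D (c - a)}"
        using finite_roots by (intro psubset_card_mono) auto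
      from less.hyps[OF this b(1)] show ?thesis using tr by blast
    qed
qed

definition theta :: "'i weight" ("\<theta>") where "\<theta> = highest_root D"

lemma highest_root: "\<theta> \<in> roots D" and below_highest_root: "b \<in> roots D \<Longrightarrow> nonneg_comb D (\<theta> - b)"
proof -
  obtain c where c: "c \<in> roots D" "\<And>b. b \<in> roots D \<Longrightarrow> nonneg_comb D (b - c) \<Longrightarrow> b = c"
    using below_maximal[OF simple_root_root] by blast
  have top: "nonneg_comb D (c - b)" if "b \<in> roots D" for b
  proof -
    obtain c' where c': "c' \<in> roots D" "nonneg_comb D (c' - b)"
      "\<And>b. b \<in> roots D \<Longrightarrow> nonneg_comb D (b - c') \<Longrightarrow> b = c'"
      using below_maximal[OF \<open>b \<in> roots D\<close>] by blast
    have "c' = c" by (rule maximal_unique[OF c'(1,3) c])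
    then show ?thesis using c'(2) by simp
  qed
  have "highest_root D = c"
    unfolding highest_root_def
  proof (rule the_equality)
    fix a assume "a \<in> roots D \<and> (\<forall>b\<in>roots D. nonneg_comb D (a - b))"
    then show "a = c" using c by blast
  qed (use c top in blast)
  then show "\<theta> \<in> roots D" "b \<in> roots D \<Longrightarrow> nonneg_comb D (\<theta> - b)"
    using c top by (simp_all add: theta_def)
qed

lemma highest_root_pos: "\<theta> \<in> pos_roots"
proof (rule maximal_pos[OF highest_root])
  fix b assume "b \<in> roots D" "nonneg_comb D (b - \<theta>)"
  then show "b = \<theta>" using nonneg_comb_antisym[of "b - \<theta>"] below_highest_root[of b] by simp
qed

subsection \<open>The finite Weyl group\<close>

abbreviation winv :: "('i weight \<Rightarrow> 'i weight) \<Rightarrow> 'i weight \<Rightarrow> 'i weight" where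
  "winv \<equiv> Hilbert_Choice.inv"

lemma weyl_reflection: "a \<in> roots D \<Longrightarrow> reflection D a \<in> weyl D"
  using weyl.reflection[OF weyl.id] by simp

lemma weyl_comp: "v \<in> weyl D \<Longrightarrow> w \<in> weyl D \<Longrightarrow> v \<circ> w \<in> weyl D"
  by (induction v rule: weyl.induct) (auto simp: comp_assoc intro: weyl.intros)

lemma weyl_inverse_ex:
  "w \<in> weyl D \<Longrightarrow> \<exists>w'\<in>weyl D. w \<circ> w' = id \<and> w' \<circ> w = id"
proof (induction w rule: weyl.induct)
  case (reflection w a)
  then obtain w' where w': "w' \<in> weyl D" "w \<circ> w' = id" "w' \<circ> w = id" by blast
  have ss: "reflection D a \<circ> reflection D a = id"
    using reflection(2) by (auto simp: reflection_reflection)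
  have "reflection D a \<circ> w \<circ> (w' \<circ> reflection D a) = reflection D a \<circ> (w \<circ> w') \<circ> reflection D a"
    by (simp only: comp_assoc)
  moreover have "w' \<circ> reflection D a \<circ> (reflection D a \<circ> w) = w' \<circ> (reflection D a \<circ> reflection D a) \<circ> w"
    by (simp only: comp_assoc)
  ultimately show ?case
    using w' ss weyl_comp[OF w'(1) weyl_reflection[OF reflection(2)]]
    by (intro bexI[of _ "w' \<circ> reflection D a"] conjI) (simp_all only: id_comp comp_id)
next
  case id
  show ?case by (rule bexI[OF _ weyl.id]) simp
qed

lemma weyl_bij: "w \<in> weyl D \<Longrightarrow> bij w"
  using weyl_inverse_ex o_bij by metis

lemma weyl_inv:
  assumes "w \<in> weyl D"
  shows "winv w \<in> weyl D" "winv w (w l) = l" "w (winv w l) = l" "winv w \<circ> w = id" "w \<circ> winv w = id"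
proof -
  obtain w' where w': "w' \<in> weyl D" "w \<circ> w' = id" "w' \<circ> w = id"
    using weyl_inverse_ex[OF assms] by blast
  then have "winv w = w'" using inv_unique_comp by blast
  then show "winv w \<in> weyl D" using w' by simp
  show "winv w (w l) = l" "w (winv w l) = l" "winv w \<circ> w = id" "w \<circ> winv w = id"
    using weyl_bij[OF assms] by (auto simp: bij_is_inj bij_is_surj surj_f_inv_f)
qed

lemma weyl_add: "w \<in> weyl D \<Longrightarrow> w (l + l') = w l + w l'"
  by (induction w rule: weyl.induct) (simp_all add: reflection_add)

lemma weyl_cmul: "w \<in> weyl D \<Longrightarrow> w (frag_cmul c l) = frag_cmul c (w l)"
  by (induction w rule: weyl.induct) (simp_all add: reflection_cmul)

lemma weyl_zero: "w \<in> weyl D \<Longrightarrow> w 0 = 0"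
  using weyl_cmul[of w 0 0] by simp

lemma weyl_uminus: "w \<in> weyl D \<Longrightarrow> w (- l) = - w l"
  using weyl_cmul[of w "- 1" l] by simp

lemma weyl_diff: "w \<in> weyl D \<Longrightarrow> w (l - l') = w l - w l'"
  using weyl_add[of w l "- l'"] by (simp add: weyl_uminus)

lemma weyl_sum: "w \<in> weyl D \<Longrightarrow> w (sum f A) = (\<Sum>i\<in>A. w (f i))"
  by (induction A rule: infinite_finite_induct) (simp_all add: weyl_zero weyl_add)

lemma weyl_root: "w \<in> weyl D \<Longrightarrow> a \<in> roots D \<Longrightarrow> w a \<in> roots D"
  by (induction w rule: weyl.induct) (simp_all add: reflection_root)

lemma weyl_form: "w \<in> weyl D \<Longrightarrow> form (w l) (w m) = form l m"
  by (induction w rule: weyl.induct) (simp_all add: form_reflection)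

lemma reflection_conj:
  assumes w: "w \<in> weyl D" and a: "a \<in> roots D"
  shows "reflection D (w a) \<circ> w = w \<circ> reflection D a"
proof
  fix l
  have wa: "w a \<in> roots D" using assms by (rule weyl_root)
  have "pairing (w l) (coroot D (w a)) * form a a = pairing l (coroot D a) * form a a"
    using form_root[OF wa, of "w l"] form_root[OF a, of l] by (simp add: weyl_form[OF w])
  then have "pairing (w l) (coroot D (w a)) = pairing l (coroot D a)"
    using form_root_pos[OF a] by simp
  then show "(reflection D (w a) \<circ> w) l = (w \<circ> reflection D a) l"
    by (simp add: reflection_def weyl_diff[OF w] weyl_cmul[OF w])
qed

text \<open>
  The simple coroots separate weights, so an isometry is determined by its values on roots.
\<close>

lemma weyl_eqI_roots:
  assumes v: "v \<in> weyl D" and w: "w \<in> weyl D" and eq: "\<And>a. a \<in> roots D \<Longrightarrow> v a = w a"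
  shows "v = w"
proof
  fix l
  have "form (v l - w l) (v a) = 0" if "a \<in> roots D" for a
    using weyl_form[OF v, of l a] weyl_form[OF w, of l a] eq[OF that]
    by (simp add: form_commute[of "v l - w l"] form_diff form_commute[of "w a"])
  then have "form (v l - w l) b = 0" if "b \<in> roots D" for b
    using weyl_root[OF weyl_inv(1)[OF v] that] weyl_inv(3)[OF v, of b] by metis
  then have "pairing (v l - w l) (frag_of i) = pairing 0 (frag_of i)" for i
    using pairing_zero_iff[OF simple_root_root[of i], of "v l - w l"] simple_root_root[of i]
    by (simp add: coroot_simple pairing_zero_left)
  then have "v l - w l = 0" by (rule weight_eqI)
  then show "v l = w l" by simp
qed

lemma finite_weyl: "finite (weyl D)"
proof (rule inj_on_finite)
  show "inj_on (\<lambda>w. restrict w (roots D)) (weyl D)"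
    by (rule inj_onI, rule weyl_eqI_roots) (metis restrict_apply')+
  show "(\<lambda>w. restrict w (roots D)) ` weyl D \<subseteq> roots D \<rightarrow>\<^sub>E roots D"
    using weyl_root by auto
  show "finite (roots D \<rightarrow>\<^sub>E roots D)" using finite_roots by (simp add: finite_PiE)
qed

lemma root_conj_simple:
  assumes "a \<in> roots D"
  shows "\<exists>w\<in>weyl D. \<exists>i. a = w (simple_root D i)"
proof -
  have pos: "\<exists>w\<in>weyl D. \<exists>i. a = w (simple_root D i)" if "a \<in> pos_roots" for a
    using that
  proof (induction rule: pos_root_induct)
    case (simple i)
    then show ?case using weyl.id by (metis id_apply)
  next
    case (reflect i b)
    then show ?case using weyl.reflection simple_root_root by (metis comp_apply)
  qed
  show ?thesis
  proof (cases "a \<in> pos_roots")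
    case False
    then have "- a \<in> pos_roots" using assms pos_or_neg by blast
    then obtain w i where w: "w \<in> weyl D" "- a = w (simple_root D i)" using pos by blast
    then have "a = (w \<circ> simple_refl i) (simple_root D i)"
      by (simp add: reflection_self simple_root_root weyl_uminus flip: w(2))
    then show ?thesis using weyl_comp[OF w(1) weyl_reflection[OF simple_root_root]] by blast
  qed (rule pos)
qed

lemma weight_expansion: "(l :: 'i weight) = (\<Sum>i\<in>UNIV. frag_cmul (lookup l i) (frag_of i))"
  by (rule poly_mapping_eqI) (simp add: lookup_sum if_distrib sum.delta' cong: if_cong)

text \<open>
  The contragredient action is characterized by this adjunction; its further properties are
  checked after pairing with an arbitrary weight.
\<close>

lemma pairing_coweight_act:
  assumes w: "w \<in> weyl D"
  shows "pairing l (coweight_act w m) = pairing (winv w l) m"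
proof -
  have "pairing l (coweight_act w m)
      = (\<Sum>i\<in>UNIV. lookup l i * pairing (winv w (frag_of i)) m)"
    by (simp add: coweight_act_def pairing_sum_right pairing_cmul_right pairing_frag_of_right mult.commute)
  also have "\<dots> = pairing (winv w (\<Sum>i\<in>UNIV. frag_cmul (lookup l i) (frag_of i))) m"
    by (simp add: weyl_sum[OF weyl_inv(1)[OF w]] weyl_cmul[OF weyl_inv(1)[OF w]] pairing_sum_left pairing_cmul_left)
  finally show ?thesis by (simp flip: weight_expansion)
qed

lemma pairing_weyl_coweight_act:
  "w \<in> weyl D \<Longrightarrow> pairing (w l) (coweight_act w m) = pairing l m"
  by (simp add: pairing_coweight_act weyl_inv)

lemma coweight_act_add: "w \<in> weyl D \<Longrightarrow> coweight_act w (m + n) = coweight_act w m + coweight_act w n"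
  by (rule coweight_eqI) (simp add: pairing_coweight_act pairing_simps)

lemma coweight_act_cmul: "w \<in> weyl D \<Longrightarrow> coweight_act w (frag_cmul c m) = frag_cmul c (coweight_act w m)"
  by (rule coweight_eqI) (simp add: pairing_coweight_act pairing_simps)

lemma coweight_act_zero: "w \<in> weyl D \<Longrightarrow> coweight_act w 0 = 0"
  by (rule coweight_eqI) (simp add: pairing_coweight_act pairing_simps)

lemma coweight_act_id: "coweight_act id (m :: 'i coweight) = m"
  by (rule coweight_eqI) (simp add: pairing_coweight_act[OF weyl.id])

lemma coweight_act_comp:
  assumes v: "v \<in> weyl D" and w: "w \<in> weyl D"
  shows "coweight_act (v \<circ> w) m = coweight_act v (coweight_act w m)"
proof (rule coweight_eqI)
  fix l
  show "pairing l (coweight_act (v \<circ> w) m) = pairing l (coweight_act v (coweight_act w m))"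
    using weyl_bij[OF v] weyl_bij[OF w]
    by (simp add: pairing_coweight_act v w weyl_comp o_inv_distrib)
qed

lemma coroot_weyl:
  assumes w: "w \<in> weyl D" and a: "a \<in> roots D"
  shows "coroot D (w a) = coweight_act w (coroot D a)"
proof (rule coweight_eqI)
  fix l
  have wa: "w a \<in> roots D" using assms by (rule weyl_root)
  have "pairing l (coroot D (w a)) * form a a = 2 * form l (w a)"
    using form_root[OF wa, of l] by (simp add: weyl_form[OF w])
  also have "form l (w a) = form (winv w l) a"
    using weyl_form[OF w, of "winv w l" a] by (simp add: weyl_inv(3)[OF w])
  also have "2 * \<dots> = pairing (winv w l) (coroot D a) * form a a"
    by (simp add: form_root[OF a])
  finally show "pairing l (coroot D (w a)) = pairing l (coweight_act w (coroot D a))"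
    using form_root_pos[OF a] by (simp add: pairing_coweight_act[OF w])
qed

lemma inv_reflection: "a \<in> roots D \<Longrightarrow> winv (reflection D a) = reflection D a"
  by (rule inv_unique_comp) (auto simp: reflection_reflection)

lemma coweight_act_reflection: "a \<in> roots D \<Longrightarrow> coweight_act (reflection D a) m = coreflection D a m"
  by (rule coweight_eqI) (simp add: pairing_coweight_act weyl_reflection inv_reflection pairing_reflection)

section \<open>The affine Weyl group\<close>

lemma carrier_Waf: "x \<in> carrier (Waf D) \<longleftrightarrow> snd x \<in> weyl D"
  by (cases x) (simp add: Waf_def)

lemma mult_Waf: "(m, v) \<otimes>\<^bsub>Waf D\<^esub> (n, w) = (m + coweight_act v n, v \<circ> w)"
  by (simp add: Waf_def)

lemma one_Waf: "\<one>\<^bsub>Waf D\<^esub> = (0, id)"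
  by (simp add: Waf_def)

lemma group_Waf: "group (Waf D)"
proof (rule groupI)
  fix x y z assume "x \<in> carrier (Waf D)" "y \<in> carrier (Waf D)" "z \<in> carrier (Waf D)"
  then show "x \<otimes>\<^bsub>Waf D\<^esub> y \<otimes>\<^bsub>Waf D\<^esub> z = x \<otimes>\<^bsub>Waf D\<^esub> (y \<otimes>\<^bsub>Waf D\<^esub> z)"
    by (cases x; cases y; cases z)
      (simp add: carrier_Waf mult_Waf coweight_act_add coweight_act_comp comp_assoc add.assoc)
next
  fix x assume "x \<in> carrier (Waf D)"
  then obtain m w where x: "x = (m, w)" "w \<in> weyl D" by (cases x) (simp add: carrier_Waf)
  show "\<exists>y\<in>carrier (Waf D). y \<otimes>\<^bsub>Waf D\<^esub> x = \<one>\<^bsub>Waf D\<^esub>"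
  proof (intro bexI)
    show "(- coweight_act (winv w) m, winv w) \<otimes>\<^bsub>Waf D\<^esub> x = \<one>\<^bsub>Waf D\<^esub>"
      using x by (simp add: mult_Waf one_Waf weyl_inv)
  qed (use x in \<open>simp add: carrier_Waf weyl_inv\<close>)
qed (auto simp: carrier_Waf mult_Waf one_Waf weyl_comp weyl.id coweight_act_id Waf_def split: prod.splits)

sublocale W: group "Waf D"
  by (rule group_Waf)

abbreviation waf_mult (infixl "\<cdot>" 70) where "x \<cdot> y \<equiv> x \<otimes>\<^bsub>Waf D\<^esub> y"
abbreviation waf_one ("\<e>") where "\<e> \<equiv> \<one>\<^bsub>Waf D\<^esub>"
abbreviation waf_inv where "waf_inv x \<equiv> inv\<^bsub>Waf D\<^esub> x"
abbreviation "\<W> \<equiv> carrier (Waf D)"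
abbreviation "\<s> \<equiv> simple_reflection D"

subsection \<open>Affine roots\<close>

text \<open>The pair \<open>(a, k)\<close> stands for the real affine root \<open>a + k \<delta>\<close>.\<close>

definition aff_roots :: "('i weight \<times> int) set" where
  "aff_roots = roots D \<times> UNIV"

definition aff_act :: "'i waf \<Rightarrow> 'i weight \<times> int \<Rightarrow> 'i weight \<times> int" where
  "aff_act x r = (snd x (fst r), snd r - pairing (snd x (fst r)) (fst x))"

definition aff_uminus :: "'i weight \<times> int \<Rightarrow> 'i weight \<times> int" where
  "aff_uminus r = (- fst r, - snd r)"

text \<open>
  Since the simple affine root at the affine vertex is \<open>\<delta> - \<theta>\<close>, the coefficients of \<open>a + k \<delta>\<close> in
  simple affine roots are \<open>k\<close> there, and those of \<open>a + k \<theta>\<close> at the finite vertices.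
\<close>

definition aff_pos :: "'i weight \<times> int \<Rightarrow> bool" where
  "aff_pos r \<longleftrightarrow> r \<in> aff_roots \<and> 0 \<le> snd r \<and> nonneg_comb D (fst r + frag_cmul (snd r) \<theta>)"

text \<open>
  The reflection in the affine hyperplane of \<open>a + k \<delta>\<close>, written as a translation times a finite
  reflection.
\<close>

definition aff_refl :: "'i weight \<times> int \<Rightarrow> 'i waf" where
  "aff_refl r = (frag_cmul (- snd r) (coroot D (fst r)), reflection D (fst r))"

fun aff_simple :: "'i option \<Rightarrow> 'i weight \<times> int" where
  "aff_simple None = (- \<theta>, 1)"
| "aff_simple (Some i) = (simple_root D i, 0)"

lemma aff_simple_root: "aff_simple j \<in> aff_roots"
  by (cases j) (simp_all add: aff_roots_def simple_root_root highest_root uminus_root)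

lemma fst_aff_simple: "fst (aff_simple j) = affine_simple_root D j"
  by (cases j) (simp_all add: theta_def)

lemma affine_simple_root_root: "affine_simple_root D j \<in> roots D"
  using aff_simple_root[of j] unfolding aff_roots_def fst_aff_simple[symmetric] by auto

lemma simple_reflection_eq: "\<s> j = aff_refl (aff_simple j)"
  by (cases j) (simp_all add: aff_refl_def reflection_of_uminus coroot_uminus highest_root flip: theta_def)

declare simple_reflection.simps [simp del]

lemma snd_simple_reflection: "snd (\<s> j) = reflection D (affine_simple_root D j)"
  by (simp add: simple_reflection_eq aff_refl_def fst_aff_simple)

lemma aff_refl_carrier: "r \<in> aff_roots \<Longrightarrow> aff_refl r \<in> \<W>"
  by (auto simp: aff_refl_def carrier_Waf aff_roots_def weyl_reflection)

lemma simple_carrier [simp]: "\<s> j \<in> \<W>"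
  by (simp add: simple_reflection_eq aff_refl_carrier aff_simple_root)

lemma aff_act_root: "x \<in> \<W> \<Longrightarrow> r \<in> aff_roots \<Longrightarrow> aff_act x r \<in> aff_roots"
  by (auto simp: aff_act_def carrier_Waf aff_roots_def weyl_root)

lemma aff_act_one: "aff_act \<e> r = r"
  by (simp add: aff_act_def one_Waf pairing_simps)

lemma aff_act_mult: "x \<in> \<W> \<Longrightarrow> y \<in> \<W> \<Longrightarrow> aff_act (x \<cdot> y) r = aff_act x (aff_act y r)"
  by (cases x; cases y) (simp add: aff_act_def carrier_Waf mult_Waf pairing_simps pairing_weyl_coweight_act)

lemma aff_act_inv: "x \<in> \<W> \<Longrightarrow> aff_act (waf_inv x) (aff_act x r) = r" "x \<in> \<W> \<Longrightarrow> aff_act x (aff_act (waf_inv x) r) = r"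
  by (simp_all flip: aff_act_mult add: aff_act_one)

lemma aff_act_uminus: "x \<in> \<W> \<Longrightarrow> aff_act x (aff_uminus r) = aff_uminus (aff_act x r)"
  by (cases x) (simp add: aff_act_def carrier_Waf aff_uminus_def weyl_uminus pairing_simps)

lemma aff_uminus_root: "r \<in> aff_roots \<Longrightarrow> aff_uminus r \<in> aff_roots"
  by (auto simp: aff_uminus_def aff_roots_def uminus_root)

lemma aff_refl_uminus: "r \<in> aff_roots \<Longrightarrow> aff_refl (aff_uminus r) = aff_refl r"
  by (auto simp: aff_uminus_def aff_refl_def aff_roots_def coroot_uminus reflection_of_uminus
      intro: poly_mapping_eqI)

lemma aff_refl_act:
  "s \<in> aff_roots \<Longrightarrow> aff_act (aff_refl s) r =
    (reflection D (fst s) (fst r), snd r - snd s * pairing (fst r) (coroot D (fst s)))"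
  by (auto simp: aff_act_def aff_refl_def aff_roots_def pairing_simps pairing_reflection coreflection_def pairing_coroot)

lemma aff_refl_self: "r \<in> aff_roots \<Longrightarrow> aff_act (aff_refl r) r = aff_uminus r"
  by (auto simp: aff_refl_act aff_roots_def aff_uminus_def reflection_self pairing_coroot)

lemma aff_refl_conj:
  assumes x: "x \<in> \<W>" and r: "r \<in> aff_roots"
  shows "aff_refl (aff_act x r) \<cdot> x = x \<cdot> aff_refl r"
proof -
  obtain m w where xw: "x = (m, w)" and w: "w \<in> weyl D" using x by (cases x) (simp add: carrier_Waf)
  obtain a k where ra: "r = (a, k)" and a: "a \<in> roots D" using r by (cases r) (simp add: aff_roots_def)
  note wa = weyl_root[OF w a]
  have "frag_cmul (- (k - pairing (w a) m)) (coroot D (w a)) + coreflection D (w a) m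
      = m + coweight_act w (frag_cmul (- k) (coroot D a))"
    unfolding coweight_act_cmul[OF w] coroot_weyl[OF w a, symmetric]
    by (rule poly_mapping_eqI) (simp add: coreflection_def lookup_add lookup_minus algebra_simps)
  then show ?thesis
    using reflection_conj[OF w a]
    by (simp add: xw ra aff_act_def aff_refl_def mult_Waf coweight_act_reflection[OF wa])
qed

lemma aff_refl_square:
  assumes r: "r \<in> aff_roots"
  shows "aff_refl r \<cdot> aff_refl r = \<e>"
proof -
  obtain a k where ra: "r = (a, k)" and a: "a \<in> roots D" using r by (cases r) (simp add: aff_roots_def)
  have "reflection D a \<circ> reflection D a = id" using a by (auto simp: reflection_reflection)
  moreover have "frag_cmul (- k) (coroot D a) + coreflection D a (frag_cmul (- k) (coroot D a)) = 0"
    using a by (intro poly_mapping_eqI)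
      (simp add: coreflection_def lookup_add lookup_minus pairing_simps pairing_coroot)
  ultimately show ?thesis
    using a by (simp add: ra aff_refl_def mult_Waf one_Waf coweight_act_reflection)
qed

lemma simple_square [simp]: "\<s> j \<cdot> \<s> j = \<e>"
  by (simp add: simple_reflection_eq aff_refl_square aff_simple_root)

lemma simple_cancel [simp]: "x \<in> \<W> \<Longrightarrow> \<s> j \<cdot> (\<s> j \<cdot> x) = x"
  by (simp flip: W.m_assoc)

lemma aff_posD: "aff_pos r \<Longrightarrow> r \<in> aff_roots"
  by (simp add: aff_pos_def)

lemma aff_simple_pos: "aff_pos (aff_simple j)"
  by (cases j) (simp_all add: aff_pos_def nonneg_comb_zero aff_simple_root[of None, simplified]
      aff_simple_root[of "Some i" for i, simplified] simple_root_nonneg)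

lemma aff_pos_or_neg:
  assumes r: "r \<in> aff_roots"
  shows "aff_pos r \<or> aff_pos (aff_uminus r)"
proof -
  have pos: "aff_pos (a, k)" if "a \<in> roots D" "0 < k" for a k
  proof -
    have "nonneg_comb D (\<theta> + a)" using below_highest_root[OF uminus_root[OF that(1)]] by simp
    moreover have "nonneg_comb D (frag_cmul (k - 1) \<theta>)"
      using that highest_root_pos by (intro nonneg_comb_cmul) (auto simp: pos_roots_def)
    ultimately have "nonneg_comb D ((\<theta> + a) + frag_cmul (k - 1) \<theta>)" by (rule nonneg_comb_add)
    moreover have "(\<theta> + a) + frag_cmul (k - 1) \<theta> = a + frag_cmul k \<theta>"
      by (rule poly_mapping_eqI) (simp add: lookup_add algebra_simps)
    ultimately show ?thesis using that by (simp add: aff_pos_def aff_roots_def)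
  qed
  obtain a k where ra: "r = (a, k)" "a \<in> roots D" using r by (cases r) (simp add: aff_roots_def)
  consider "0 < k" | "k < 0" | "k = 0" by linarith
  then show ?thesis
  proof cases
    case 3
    then show ?thesis using ra roots_sign_coherent[of a] uminus_root[of a]
      by (auto simp: aff_pos_def aff_roots_def aff_uminus_def)
  qed (use pos[of a k] pos[of "- a" "- k"] ra uminus_root[of a] in \<open>simp_all add: aff_uminus_def\<close>)
qed

lemma aff_not_pos_and_neg: "aff_pos r \<Longrightarrow> \<not> aff_pos (aff_uminus r)"
  using nonneg_comb_antisym[of "fst r"] root_nonzero
  by (auto simp: aff_pos_def aff_uminus_def aff_roots_def)

lemma simple_act_finite_part:
  "fst (aff_act (\<s> j) r) + frag_cmul (snd (aff_act (\<s> j) r)) \<theta> = (fst r + frag_cmul (snd r) \<theta>)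
      - (case j of None \<Rightarrow> 0 | Some i \<Rightarrow> frag_cmul (pairing (fst r) (coroot D (simple_root D i))) (simple_root D i))"
  "snd (aff_act (\<s> j) r) = snd r - (case j of None \<Rightarrow> pairing (fst r) (coroot D (- \<theta>)) | Some i \<Rightarrow> 0)"
  unfolding simple_reflection_eq aff_refl_act[OF aff_simple_root]
  by (cases j; simp add: reflection_of_uminus reflection_def coroot_uminus highest_root pairing_simps
      poly_mapping_eq_iff fun_eq_iff lookup_add lookup_minus algebra_simps)+

text \<open>
  As in the finite case, all coefficients but one are preserved. For the affine vertex the preserved
  coefficients are those of \<open>a + k \<theta>\<close>, and they vanish together only for multiples of \<open>\<theta>\<close>.
\<close>

lemma simple_permutes_pos:
  assumes r: "aff_pos r" and ne: "r \<noteq> aff_simple j"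
  shows "aff_pos (aff_act (\<s> j) r)"
proof (rule ccontr)
  assume neg: "\<not> ?thesis"
  let ?r = "aff_act (\<s> j) r"
  have rr: "?r \<in> aff_roots" using r by (intro aff_act_root) (auto dest: aff_posD)
  have n: "aff_pos (aff_uminus ?r)" using aff_pos_or_neg[OF rr] neg by blast
  obtain a k where ra: "r = (a, k)" "a \<in> roots D" "0 \<le> k" "nonneg_comb D (a + frag_cmul k \<theta>)"
    using r by (cases r) (auto simp: aff_pos_def aff_roots_def)
  have n': "nonneg_comb D (- (fst ?r + frag_cmul (snd ?r) \<theta>))" and s0: "snd ?r \<le> 0"
    using n by (simp_all add: aff_pos_def aff_uminus_def)
  show False
  proof (cases j)
    case None
    have "fst ?r + frag_cmul (snd ?r) \<theta> = a + frag_cmul k \<theta>"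
      unfolding simple_act_finite_part(1) by (simp add: ra(1) None)
    then have "nonneg_comb D (- (a + frag_cmul k \<theta>))"
      using n' by (simp only:)
    then have eq: "a + frag_cmul k \<theta> = 0" using nonneg_comb_antisym ra by blast
    then have ak: "- a = frag_cmul k \<theta>" by (simp add: add_eq_0_iff2)
    then have "frag_cmul k \<theta> \<in> roots D" using uminus_root[OF ra(2)] by simp
    moreover have "k \<noteq> 0" using ak root_nonzero[OF ra(2)] by auto
    ultimately have "k = 1" using root_multiple[OF highest_root, of k] ra(3) by simp
    then have "r = aff_simple None" using ak ra(1) by (metis add.inverse_inverse aff_simple.simps(1) frag_cmul_one)
    then show False using ne None by simp
  next
    case (Some i)
    have "snd ?r = k" by (simp add: simple_act_finite_part ra(1) Some)
    then have "k = 0" using s0 ra(3) by simp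
    then have "a \<in> pos_roots" "a \<noteq> simple_root D i" using ra ne Some by (auto simp: pos_roots_def)
    then have "simple_refl i a \<in> pos_roots" by (rule reflection_simple_pos)
    then have "aff_pos (simple_refl i a, 0)" by (simp add: aff_pos_def aff_roots_def pos_roots_def)
    moreover have "?r = (simple_refl i a, 0)"
      unfolding simple_reflection_eq aff_refl_act[OF aff_simple_root] using \<open>k = 0\<close> ra(1) Some by simp
    ultimately show False using neg by simp
  qed
qed

text \<open>
  If \<open>a\<close> pairs non-positively with all simple affine roots, then \<open>(a, \<theta>) \<ge> 0\<close> while \<open>(a, \<alpha>\<^sub>i) \<le> 0\<close>. As \<open>\<theta>\<close> has
  full support, \<open>a\<close> is orthogonal to all \<open>\<alpha>\<^sub>i\<close>.
\<close>

lemma exists_aff_simple_pairing_pos: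
  assumes a: "a \<in> roots D"
  obtains j where "0 < pairing a (coroot D (affine_simple_root D j))"
proof (rule ccontr)
  assume "\<not> thesis"
  with that have *: "pairing a (coroot D (affine_simple_root D j)) \<le> 0" for j by (metis linorder_not_le)
  have s: "form a (simple_root D i) \<le> 0" for i
    using *[of "Some i"] pairing_pos_iff[OF simple_root_root, of a i] by simp
  have "\<not> 0 < form a (- \<theta>)"
    using *[of None] pairing_pos_iff[OF uminus_root[OF highest_root], of a] by (simp add: theta_def)
  then have t: "0 \<le> form a \<theta>" by (simp add: form_uminus)
  obtain n where n: "\<theta> = root_comb D n" using highest_root_pos by (auto simp: pos_roots_def elim: nonneg_combE)
  have n1: "1 \<le> n i" for i
  proof -
    have "\<theta> - simple_root D i = root_comb D (n(i := n i - 1))" by (simp add: n root_comb_update)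
    then have "nonneg_comb D (root_comb D (n(i := n i - 1)))"
      using below_highest_root[OF simple_root_root[of i]] by simp
    then show ?thesis by (simp add: nonneg_comb_iff all_conj_distrib split: if_splits)
  qed
  have "(\<Sum>i\<in>UNIV. n i * form a (simple_root D i)) \<ge> 0" using t unfolding n form_root_comb .
  moreover have le: "n i * form a (simple_root D i) \<le> 0" for i
    using s[of i] n1[of i] by (simp add: mult_le_0_iff)
  ultimately have "(\<Sum>i\<in>UNIV. - (n i * form a (simple_root D i))) = 0"
    using sum_nonpos[of UNIV "\<lambda>i. n i * form a (simple_root D i)"] by (simp add: sum_negf)
  then have "n i * form a (simple_root D i) = 0" for i
    using le by (subst (asm) sum_nonneg_eq_0_iff) auto
  then have z: "form a (simple_root D i) = 0" for i using n1[of i] by (metis mult_eq_0_iff not_one_le_zero)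
  obtain k where "a = root_comb D k" using a by (rule root_combE)
  then have "form a a = 0" using z form_root_comb[of a k] by simp
  then show False using form_root_pos[OF a] by simp
qed

text \<open>
  Reflecting in a simple affine root with positive pairing lowers the sum of the coefficients.
\<close>

lemma aff_pos_induct [consumes 1, case_names simple reflect]:
  assumes r: "aff_pos r"
    and simple: "\<And>j. P (aff_simple j)"
    and reflect: "\<And>j r. aff_pos r \<Longrightarrow> P r \<Longrightarrow> P (aff_act (\<s> j) r)"
  shows "P r"
proof -
  have "fst r + frag_cmul (snd r) \<theta> = root_comb D n \<Longrightarrow> aff_pos r \<Longrightarrow> P r" for n r
  proof (induction "nat (snd r + (\<Sum>i\<in>UNIV. n i))" arbitrary: r n rule: less_induct)
    case less
    show ?case
    proof (cases "\<exists>j. r = aff_simple j")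
      case False
      have "fst r \<in> roots D" using less.prems(2) by (auto simp: aff_pos_def aff_roots_def)
      then obtain j where j: "0 < pairing (fst r) (coroot D (affine_simple_root D j))"
        by (rule exists_aff_simple_pairing_pos)
      let ?r = "aff_act (\<s> j) r"
      have p: "aff_pos ?r" using less.prems(2) False by (intro simple_permutes_pos) auto
      define m where "m = (case j of None \<Rightarrow> n
          | Some i \<Rightarrow> n(i := n i - pairing (fst r) (coroot D (simple_root D i))))"
      have m: "fst ?r + frag_cmul (snd ?r) \<theta> = root_comb D m"
        by (simp add: simple_act_finite_part(1) less.prems(1) m_def root_comb_update split: option.splits)
      have m0: "0 \<le> m i" for i using p m by (simp add: aff_pos_def nonneg_comb_iff)
      have "snd ?r + (\<Sum>i\<in>UNIV. m i) < snd r + (\<Sum>i\<in>UNIV. n i)"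
      proof (cases j)
        case None
        then show ?thesis using j by (simp add: simple_act_finite_part(2) m_def theta_def)
      next
        case (Some i)
        then have "(\<Sum>j\<in>UNIV. m j) < (\<Sum>j\<in>UNIV. n j)"
          using j by (intro sum_strict_mono_ex1) (auto simp: m_def)
        then show ?thesis using Some by (simp add: simple_act_finite_part(2))
      qed
      moreover have "0 \<le> snd ?r + (\<Sum>i\<in>UNIV. m i)"
        using m0 p by (intro add_nonneg_nonneg sum_nonneg) (auto simp: aff_pos_def)
      ultimately have "P ?r" using less.hyps[of ?r m] m p by simp
      then have "P (aff_act (\<s> j) ?r)" using p by (rule reflect[rotated])
      then show ?thesis by (simp add: aff_act_one flip: aff_act_mult)
    qed (use simple in auto)
  qed
  then show ?thesis using r nonneg_combE unfolding aff_pos_def by blast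
qed

subsection \<open>Words, lengths and the exchange property\<close>

abbreviation "wp \<equiv> word_product D"
abbreviation "\<l> \<equiv> len D"

lemma wp_Nil: "wp [] = \<e>"
  by (simp add: word_product_def)

lemma wp_Cons: "wp (j # js) = \<s> j \<cdot> wp js"
  by (simp add: word_product_def)

lemma wp_carrier [simp]: "wp js \<in> \<W>"
  by (induction js) (simp_all add: wp_Nil wp_Cons)

lemma wp_append: "wp (js @ ks) = wp js \<cdot> wp ks"
  by (induction js) (simp_all add: wp_Nil wp_Cons W.m_assoc)

lemma wp_single: "wp [j] = \<s> j"
  by (simp add: wp_Nil wp_Cons)

lemma inv_simple: "waf_inv (\<s> j) = \<s> j"
  by (rule W.inv_equality) simp_all

lemma wp_rev: "wp (rev js) = waf_inv (wp js)"
  by (induction js) (simp_all add: wp_Nil wp_Cons wp_append W.inv_mult_group inv_simple)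

text \<open>
  Conjugating by simple reflections reduces a positive affine root to a simple one.
\<close>

lemma aff_refl_word:
  assumes "r \<in> aff_roots"
  shows "aff_refl r \<in> range wp"
proof -
  have pos: "aff_refl r \<in> range wp" if "aff_pos r" for r
    using that
  proof (induction rule: aff_pos_induct)
    case (simple j)
    then show ?case using wp_single[of j] simple_reflection_eq[of j] by (metis rangeI)
  next
    case (reflect j r)
    then obtain js where js: "aff_refl r = wp js" by blast
    have r: "r \<in> aff_roots" using reflect(1) by (rule aff_posD)
    have "aff_refl (aff_act (\<s> j) r) = aff_refl (aff_act (\<s> j) r) \<cdot> \<s> j \<cdot> \<s> j"
      using aff_refl_carrier[OF aff_act_root[OF simple_carrier r]] by (simp add: W.m_assoc)
    also have "\<dots> = wp (j # js @ [j])"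
      by (simp add: aff_refl_conj r js wp_Cons wp_append wp_Nil W.m_assoc)
    finally show ?case by simp
  qed
  show ?thesis
    using pos[of r] pos[of "aff_uminus r"] aff_pos_or_neg[OF assms] aff_refl_uminus[OF assms] by auto
qed

lemma range_wp_mult: "x \<in> range wp \<Longrightarrow> y \<in> range wp \<Longrightarrow> x \<cdot> y \<in> range wp"
  by (elim imageE) (simp flip: wp_append)

lemma range_wp_inv: "x \<in> range wp \<Longrightarrow> waf_inv x \<in> range wp"
  by (elim imageE) (simp flip: wp_rev)

text \<open>
  The translation by a simple coroot is a product of two parallel reflections.
\<close>

lemma range_wp: "range wp = \<W>"
proof
  show "\<W> \<subseteq> range wp"
  proof
    fix x assume "x \<in> \<W>"
    then obtain m w where x: "x = (m, w)" "w \<in> weyl D" by (cases x) (simp add: carrier_Waf)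
    have "(0, w) \<in> range wp" using x(2)
    proof (induction w rule: weyl.induct)
      case id
      then show ?case using wp_Nil one_Waf by (metis rangeI)
    next
      case (reflection w a)
      have "(0, reflection D a \<circ> w) = aff_refl (a, 0) \<cdot> (0, w)"
        by (simp add: aff_refl_def mult_Waf reflection(2) coweight_act_zero weyl_reflection)
      moreover have "aff_refl (a, 0) \<in> range wp"
        using reflection(2) by (intro aff_refl_word) (simp add: aff_roots_def)
      ultimately show ?case using range_wp_mult reflection(3) by metis
    qed
    moreover have "(m, id) \<in> range wp"
    proof -
      have car: "(b, id) \<in> \<W>" for b by (simp add: carrier_Waf weyl.id)
      have "keys m \<subseteq> UNIV" by simp
      then show ?thesis
      proof (induction m rule: frag_induction)
        case zero
        then show ?case using wp_Nil one_Waf by (metis rangeI)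
      next
        case (one i)
        let ?a = "simple_root D i"
        have "(frag_of i, id) = aff_refl (?a, -1) \<cdot> aff_refl (?a, 0)"
          by (simp add: aff_refl_def mult_Waf coroot_simple coweight_act_zero weyl_reflection
              simple_root_root fun_eq_iff reflection_reflection)
        moreover have "aff_refl (?a, k) \<in> range wp" for k
          by (intro aff_refl_word) (simp add: aff_roots_def simple_root_root)
        ultimately show ?case using range_wp_mult by metis
      next
        case (diff a b)
        have "(a - b, id) \<cdot> (b, id) = (a, id)" by (simp add: mult_Waf coweight_act_id)
        then have "(a - b, id) = (a, id) \<cdot> waf_inv (b, id)"
          using W.inv_solve_right[OF car car car] by metis
        then show ?case using range_wp_mult range_wp_inv diff by metis
      qed
    qed
    moreover have "x = (m, id) \<cdot> (0, w)" by (simp add: x mult_Waf coweight_act_zero weyl.id)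
    ultimately show "x \<in> range wp" using range_wp_mult by metis
  qed
qed auto

lemma len_le: "\<l> (wp js) \<le> length js"
  unfolding len_def by (rule Least_le) auto

lemma reduced_word_ex:
  assumes "x \<in> \<W>"
  obtains js where "reduced_word D x js"
proof -
  have "\<exists>n js. length js = n \<and> wp js = x" using assms range_wp by (metis imageE)
  then have "\<exists>js. length js = \<l> x \<and> wp js = x" unfolding len_def by (rule LeastI_ex)
  then show thesis using that by (auto simp: reduced_word_def)
qed

text \<open>
  Reading the word from the right, the root \<open>r\<close> turns negative at some letter \<open>j\<close>. At that point it has
  been moved to the simple root of \<open>j\<close>, so the part of the word behind \<open>j\<close> conjugates the reflection
  in \<open>r\<close> into that of \<open>j\<close>, and multiplying by it deletes the letter.
\<close>

lemma exchange:
  assumes "aff_pos r" and "\<not> aff_pos (aff_act (wp js) r)"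
  shows "\<exists>ks. Suc (length ks) = length js \<and> wp ks = wp js \<cdot> aff_refl r"
  using assms(2)
proof (induction js)
  case Nil
  then show ?case using assms(1) by (simp add: wp_Nil aff_act_one)
next
  case (Cons j js)
  have r: "r \<in> aff_roots" using assms(1) by (rule aff_posD)
  note rc = aff_refl_carrier[OF r]
  show ?case
  proof (cases "aff_pos (aff_act (wp js) r)")
    case True
    have "\<not> aff_pos (aff_act (\<s> j) (aff_act (wp js) r))"
      using Cons.prems by (simp add: wp_Cons aff_act_mult)
    then have "aff_act (wp js) r = aff_simple j" using simple_permutes_pos[OF True] by blast
    then have "\<s> j \<cdot> wp js = wp js \<cdot> aff_refl r"
      using aff_refl_conj[OF wp_carrier r, of js] by (simp add: simple_reflection_eq)
    then have "wp (j # js) \<cdot> aff_refl r = \<s> j \<cdot> (\<s> j \<cdot> wp js)"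
      unfolding wp_Cons W.m_assoc[OF simple_carrier wp_carrier rc] by (rule arg_cong[OF sym])
    then show ?thesis by (intro exI[of _ js]) simp
  next
    case False
    then obtain ks where "Suc (length ks) = length js" "wp ks = wp js \<cdot> aff_refl r" using Cons.IH by blast
    then show ?thesis using rc by (intro exI[of _ "j # ks"]) (simp add: wp_Cons W.m_assoc)
  qed
qed

lemma len_refl_less:
  assumes x: "x \<in> \<W>" and r: "aff_pos r" and neg: "\<not> aff_pos (aff_act x r)"
  shows "\<l> (x \<cdot> aff_refl r) < \<l> x"
proof -
  obtain js where js: "reduced_word D x js" using x by (rule reduced_word_ex)
  obtain ks where "Suc (length ks) = length js" "wp ks = wp js \<cdot> aff_refl r"
    using exchange[OF r, of js] neg js by (auto simp: reduced_word_def)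
  then show ?thesis using len_le[of ks] js by (simp add: reduced_word_def)
qed

lemma len_refl_greater:
  assumes x: "x \<in> \<W>" and r: "aff_pos r" and pos: "aff_pos (aff_act x r)"
  shows "\<l> x < \<l> (x \<cdot> aff_refl r)"
proof -
  have rr: "r \<in> aff_roots" using r by (rule aff_posD)
  note rc = aff_refl_carrier[OF rr]
  have "aff_act (x \<cdot> aff_refl r) r = aff_uminus (aff_act x r)"
    by (simp add: aff_act_mult x rc aff_refl_self rr aff_act_uminus)
  then have "\<l> (x \<cdot> aff_refl r \<cdot> aff_refl r) < \<l> (x \<cdot> aff_refl r)"
    using aff_not_pos_and_neg[OF pos] by (intro len_refl_less) (simp_all add: x r rc)
  then show ?thesis by (simp add: W.m_assoc x rc aff_refl_square rr)
qed

lemma len_refl_iff: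
  assumes x: "x \<in> \<W>" and r: "aff_pos r"
  shows "\<l> x < \<l> (x \<cdot> aff_refl r) \<longleftrightarrow> aff_pos (aff_act x r)"
  using len_refl_less[OF x r] len_refl_greater[OF x r] by force

lemma len_mult_le: "x \<in> \<W> \<Longrightarrow> y \<in> \<W> \<Longrightarrow> \<l> (x \<cdot> y) \<le> \<l> x + \<l> y"
proof -
  assume "x \<in> \<W>" "y \<in> \<W>"
  then obtain js ks where "reduced_word D x js" "reduced_word D y ks"
    by (elim reduced_word_ex)
  then show ?thesis using len_le[of "js @ ks"] by (simp add: wp_append reduced_word_def)
qed

lemma len_simple_le: "\<l> (\<s> j) \<le> 1"
  using len_le[of "[j]"] by (simp add: wp_single)

lemma len_mult_simple:
  assumes x: "x \<in> \<W>"
  shows "\<l> (x \<cdot> \<s> j) = (if aff_pos (aff_act x (aff_simple j)) then \<l> x + 1 else \<l> x - 1)"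
    and "\<not> aff_pos (aff_act x (aff_simple j)) \<Longrightarrow> 0 < \<l> x"
proof -
  have "x \<cdot> \<s> j \<cdot> \<s> j = x" using x by (simp add: W.m_assoc)
  then have "\<l> x \<le> \<l> (x \<cdot> \<s> j) + 1" "\<l> (x \<cdot> \<s> j) \<le> \<l> x + 1"
    using len_mult_le[of "x \<cdot> \<s> j" "\<s> j"] len_mult_le[of x "\<s> j"] len_simple_le[of j] x by auto
  then show "\<l> (x \<cdot> \<s> j) = (if aff_pos (aff_act x (aff_simple j)) then \<l> x + 1 else \<l> x - 1)"
    using len_refl_less[OF x aff_simple_pos, of j] len_refl_greater[OF x aff_simple_pos, of j]
    by (auto simp: simple_reflection_eq)
  show "\<not> aff_pos (aff_act x (aff_simple j)) \<Longrightarrow> 0 < \<l> x"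
    using len_refl_less[OF x aff_simple_pos, of j] by auto
qed

definition left_descent :: "'i option \<Rightarrow> 'i waf \<Rightarrow> bool" where
  "left_descent j x \<longleftrightarrow> \<not> aff_pos (aff_act (waf_inv x) (aff_simple j))"

lemma simple_mult_eq_refl:
  assumes x: "x \<in> \<W>"
  shows "\<s> j \<cdot> x = x \<cdot> aff_refl (aff_act (waf_inv x) (aff_simple j))"
proof -
  have "aff_act (waf_inv x) (aff_simple j) \<in> aff_roots"
    using x by (intro aff_act_root aff_simple_root) simp
  from aff_refl_conj[OF x this] show ?thesis
    using x by (simp add: aff_act_inv simple_reflection_eq)
qed

lemma len_inv: "x \<in> \<W> \<Longrightarrow> \<l> (waf_inv x) = \<l> x"
proof -
  have le: "\<l> (waf_inv x) \<le> \<l> x" if x: "x \<in> \<W>" for x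
  proof -
    obtain js where "reduced_word D x js" using x by (rule reduced_word_ex)
    then show ?thesis using len_le[of "rev js"] by (simp add: wp_rev reduced_word_def)
  qed
  assume "x \<in> \<W>"
  then show ?thesis using le[of x] le[of "waf_inv x"] by simp
qed

lemma len_simple_mult:
  assumes x: "x \<in> \<W>"
  shows "\<l> (\<s> j \<cdot> x) = (if left_descent j x then \<l> x - 1 else \<l> x + 1)"
    and "left_descent j x \<Longrightarrow> 0 < \<l> x"
proof -
  have "waf_inv (\<s> j \<cdot> x) = waf_inv x \<cdot> \<s> j"
    using x by (simp add: W.inv_mult_group inv_simple)
  then have "\<l> (\<s> j \<cdot> x) = \<l> (waf_inv x \<cdot> \<s> j)"
    using len_inv[of "\<s> j \<cdot> x"] x by simp
  then show "\<l> (\<s> j \<cdot> x) = (if left_descent j x then \<l> x - 1 else \<l> x + 1)"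
    using len_mult_simple(1)[of "waf_inv x" j] x by (simp add: left_descent_def len_inv)
  show "left_descent j x \<Longrightarrow> 0 < \<l> x"
    using len_mult_simple(2)[of "waf_inv x" j] x by (simp add: left_descent_def len_inv)
qed

lemma left_descent_iff:
  assumes x: "x \<in> \<W>"
  shows "left_descent j x \<longleftrightarrow> \<l> (\<s> j \<cdot> x) < \<l> x"
    and "\<not> left_descent j x \<longleftrightarrow> \<l> x < \<l> (\<s> j \<cdot> x)"
  using len_simple_mult[OF x, of j] by (cases "left_descent j x"; simp)+

lemma left_descent_simple_mult:
  assumes x: "x \<in> \<W>"
  shows "left_descent j (\<s> j \<cdot> x) \<longleftrightarrow> \<not> left_descent j x"
proof -
  have "\<s> j \<cdot> x \<in> \<W>" using x by simp
  from left_descent_iff(1)[OF this, of j] left_descent_iff(2)[OF x, of j]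
  show ?thesis unfolding simple_cancel[OF x] by blast
qed

lemma reduced_word_Cons:
  assumes "reduced_word D x (j # js)"
  shows "reduced_word D (\<s> j \<cdot> x) js" "left_descent j x" "x \<in> \<W>" "\<s> j \<cdot> x \<in> \<W>"
proof -
  have x: "x = \<s> j \<cdot> wp js" and l: "\<l> x = Suc (length js)"
    using assms by (simp_all add: reduced_word_def wp_Cons)
  show xc: "x \<in> \<W>" "\<s> j \<cdot> x \<in> \<W>" by (simp_all add: x)
  have e: "\<s> j \<cdot> x = wp js" by (simp add: x)
  have "\<l> (\<s> j \<cdot> x) \<le> length js" unfolding e by (rule len_le)
  then show "left_descent j x" "reduced_word D (\<s> j \<cdot> x) js"
    using len_simple_mult[OF xc(1), of j] l unfolding reduced_word_def
    by (simp_all only: e split: if_splits) simp_all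
qed

lemma reduced_word_ConsI:
  "x \<in> \<W> \<Longrightarrow> \<not> left_descent j x \<Longrightarrow> reduced_word D x js \<Longrightarrow> reduced_word D (\<s> j \<cdot> x) (j # js)"
  by (simp add: reduced_word_def wp_Cons len_simple_mult)

lemma left_descent_induct [consumes 1, case_names one step]:
  assumes x: "x \<in> \<W>" and one: "P \<e>"
    and step: "\<And>j x. x \<in> \<W> \<Longrightarrow> \<not> left_descent j x \<Longrightarrow> P x \<Longrightarrow> P (\<s> j \<cdot> x)"
  shows "P x"
proof -
  obtain js where "reduced_word D x js" using x by (rule reduced_word_ex)
  then show ?thesis
  proof (induction js arbitrary: x)
    case Nil
    then show ?case using one by (simp add: reduced_word_def wp_Nil)
  next
    case (Cons j js)
    note c = reduced_word_Cons[OF Cons.prems]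
    have "P (\<s> j \<cdot> (\<s> j \<cdot> x))"
    proof (rule step[OF c(4)])
      show "\<not> left_descent j (\<s> j \<cdot> x)" using c(2) left_descent_simple_mult[OF c(3)] by blast
    qed (rule Cons.IH[OF c(1)])
    then show ?case using c by simp
  qed
qed

lemma finite_bounded_length: "finite {x \<in> \<W>. \<l> x \<le> n}"
proof (rule finite_subset)
  show "finite (wp ` {js. set js \<subseteq> UNIV \<and> length js \<le> n})"
    by (intro finite_imageI finite_lists_length_le) simp
  show "{x \<in> \<W>. \<l> x \<le> n} \<subseteq> wp ` {js. set js \<subseteq> UNIV \<and> length js \<le> n}"
  proof
    fix x assume "x \<in> {x \<in> \<W>. \<l> x \<le> n}"
    then have x: "x \<in> \<W>" "\<l> x \<le> n" by simp_all
    obtain js where "reduced_word D x js" using x(1) by (rule reduced_word_ex)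
    then show "x \<in> wp ` {js. set js \<subseteq> UNIV \<and> length js \<le> n}"
      using x(2) by (intro image_eqI[of _ _ js]) (simp_all add: reduced_word_def)
  qed
qed

subsection \<open>Braid relations and reduced words\<close>

definition cartan :: "'i option \<Rightarrow> 'i option \<Rightarrow> int" where
  "cartan i j = pairing (affine_simple_root D i) (coroot D (affine_simple_root D j))"

lemma cartan_nonpos:
  assumes "i \<noteq> j"
  shows "cartan i j \<le> 0"
proof -
  have 0: "pairing (- \<theta>) (coroot D (simple_root D i)) \<le> 0" for i
  proof -
    have "0 \<le> pairing \<theta> (coroot D (simple_root D i))"
    proof (rule maximal_dominant[OF highest_root])
      fix b assume "b \<in> roots D" "nonneg_comb D (b - \<theta>)"
      then show "b = \<theta>" using nonneg_comb_antisym[of "b - \<theta>"] below_highest_root[of b] by simp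
    qed
    then show ?thesis by (simp add: pairing_simps)
  qed
  have sym: "pairing b (coroot D a) \<le> 0"
    if "a \<in> roots D" "b \<in> roots D" "pairing a (coroot D b) \<le> 0" for a b
    using that pairing_pos_iff[of b a] pairing_pos_iff[of a b] by (metis form_commute not_le)
  show ?thesis
  proof (cases i)
    case None
    then obtain k where "j = Some k" using assms by (cases j) auto
    then show ?thesis using None 0[of k] by (simp add: cartan_def theta_def)
  next
    case (Some k)
    show ?thesis
    proof (cases j)
      case None
      then show ?thesis
        using sym[OF uminus_root[OF highest_root] simple_root_root 0[of k]] Some
        by (simp add: cartan_def theta_def)
    qed (use Some assms simple_pairing_nonpos in \<open>simp add: cartan_def\<close>)
  qed
qed

definition braid_length :: "'i option \<Rightarrow> 'i option \<Rightarrow> nat \<Rightarrow> bool" where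
  "braid_length i j m \<longleftrightarrow> i \<noteq> j \<and> (cartan i j * cartan j i, m) \<in> {(0, 2), (1, 3), (2, 4), (3, 6)}"

text \<open>
  The product of the Cartan integers is \<open>0, 1, 2, 3\<close> or \<open>4\<close>. The last value forces proportional roots, hence
  opposite ones; this is the infinite dihedral group in type \<open>A\<^sub>1\<close>.
\<close>

lemma cartan_cases:
  assumes "i \<noteq> j"
  obtains m where "braid_length i j m" | "cartan i j = -2" "cartan j i = -2"
proof -
  let ?a = "affine_simple_root D i" and ?b = "affine_simple_root D j"
  note a = affine_simple_root_root[of i] and b = affine_simple_root_root[of j]
  have "cartan i j * cartan j i \<le> 4" "0 \<le> cartan i j * cartan j i"
    using cartan_product[OF a b] by (simp_all add: cartan_def)
  moreover have "c = 0 \<or> c = 1 \<or> c = 2 \<or> c = 3 \<or> c = 4" if "0 \<le> c" "c \<le> 4" for c :: int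
    using that by presburger
  ultimately consider "cartan i j * cartan j i \<in> {0,1,2,3}" | "cartan i j * cartan j i = 4" by blast
  then show thesis
  proof cases
    case 1
    then show ?thesis using that(1) assms by (auto simp: braid_length_def)
  next
    case 2
    note e = cartan_product(2)[OF a b, folded cartan_def, OF 2]
    have "cartan i j dvd 4" using 2 by (metis dvd_triv_left)
    moreover have "cartan i j < 0" using 2 cartan_nonpos[OF assms] by (cases "cartan i j = 0") auto
    moreover have "c = -1 \<or> c = -2 \<or> c = -4" if "c dvd 4" "c < 0" for c :: int
    proof -
      have "- c \<le> 4" using zdvd_imp_le[of "- c" 4] that by simp
      then have "c = -1 \<or> c = -2 \<or> c = -3 \<or> c = -4" using that(2) by presburger
      then show ?thesis using that(1) by auto
    qed
    ultimately consider "cartan i j = -1" | "cartan i j = -2" | "cartan i j = -4" by blast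
    then show thesis
    proof cases
      case 1
      then have "frag_cmul 2 ?a = - ?b" using e by simp
      then have "frag_cmul 2 ?a \<in> roots D" using uminus_root[OF b] by simp
      then show ?thesis using root_multiple[OF a] by fastforce
    next
      case c: 2
      then show ?thesis using that(2) 2 by simp
    next
      case 3
      have "- ?a = frag_cmul 2 ?b"
      proof (rule poly_mapping_eqI)
        fix k
        have "2 * lookup ?a k = -4 * lookup ?b k"
          using arg_cong[OF e, of "\<lambda>l. lookup l k"] 3 by simp
        then show "lookup (- ?a) k = lookup (frag_cmul 2 ?b) k" by simp
      qed
      then have "frag_cmul 2 ?b \<in> roots D" using uminus_root[OF a] by simp
      then show ?thesis using root_multiple[OF b] by fastforce
    qed
  qed
qed

fun alt :: "nat \<Rightarrow> 'a \<Rightarrow> 'a \<Rightarrow> 'a list" where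
  "alt 0 i j = []"
| "alt (Suc m) i j = i # alt m j i"

lemma length_alt [simp]: "length (alt m i j) = m"
  by (induction m arbitrary: i j) simp_all

fun alt_last :: "nat \<Rightarrow> 'a \<Rightarrow> 'a \<Rightarrow> 'a" where
  "alt_last 0 i j = i"
| "alt_last (Suc m) i j = alt_last m j i"

lemma alt_snoc: "alt (Suc m) i j = alt m i j @ [alt_last m i j]"
  by (induction m arbitrary: i j) simp_all

text \<open>
  The coefficients, in the basis of the two simple affine roots, of the root that the last letter of
  an alternating word contributes; \<open>p\<close> and \<open>q\<close> are minus the two Cartan integers.
\<close>

fun alt_coeff :: "nat \<Rightarrow> int \<Rightarrow> int \<Rightarrow> int \<times> int" where
  "alt_coeff 0 p q = (1, 0)"
| "alt_coeff (Suc k) p q = (q * fst (alt_coeff k q p) - snd (alt_coeff k q p), fst (alt_coeff k q p))"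

definition aff_comb :: "'i weight \<times> int \<Rightarrow> 'i weight \<times> int \<Rightarrow> int \<times> int \<Rightarrow> 'i weight \<times> int" where
  "aff_comb r s c = (frag_cmul (fst c) (fst r) + frag_cmul (snd c) (fst s), fst c * snd r + snd c * snd s)"

lemma alt_root:
  "aff_act (wp (alt k i j)) (aff_simple (alt_last k i j))
     = aff_comb (aff_simple i) (aff_simple j) (alt_coeff k (- cartan i j) (- cartan j i))"
proof (induction k arbitrary: i j)
  case 0
  then show ?case by (simp add: wp_Nil aff_act_one aff_comb_def prod_eq_iff)
next
  case (Suc k)
  have c: "pairing (fst (aff_simple i)) (coroot D (fst (aff_simple i))) = 2"
    "pairing (fst (aff_simple j)) (coroot D (fst (aff_simple i))) = cartan j i"
    using pairing_coroot[OF affine_simple_root_root] by (simp_all add: fst_aff_simple cartan_def)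
  have "aff_act (wp (alt (Suc k) i j)) (aff_simple (alt_last (Suc k) i j))
      = aff_act (\<s> i) (aff_comb (aff_simple j) (aff_simple i) (alt_coeff k (- cartan j i) (- cartan i j)))"
    by (simp add: wp_Cons aff_act_mult Suc)
  also have "\<dots> = aff_comb (aff_simple i) (aff_simple j) (alt_coeff (Suc k) (- cartan i j) (- cartan j i))"
    unfolding simple_reflection_eq aff_refl_act[OF aff_simple_root]
    by (auto simp: aff_comb_def reflection_def pairing_simps c lookup_add lookup_minus algebra_simps
        intro!: poly_mapping_eqI)
  finally show ?case .
qed

lemma braid_cartan:
  assumes "braid_length i j m"
  defines "p \<equiv> - cartan i j" and "q \<equiv> - cartan j i"
  shows "(p, q, m) \<in> {(0,0,2), (1,1,3), (1,2,4), (2,1,4), (1,3,6), (3,1,6)}"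
proof -
  have ne: "i \<noteq> j" using assms by (simp add: braid_length_def)
  have pq: "0 \<le> p" "0 \<le> q" using cartan_nonpos[of i j] cartan_nonpos[of j i] ne by (auto simp: p_def q_def)
  have m: "(p * q, m) \<in> {(0, 2), (1, 3), (2, 4), (3, 6)}"
    using assms by (simp add: braid_length_def p_def q_def)
  have z: "p = 0 \<longleftrightarrow> q = 0"
    using pairing_symmetric_sign[OF affine_simple_root_root affine_simple_root_root, of i j]
    by (simp add: p_def q_def cartan_def)
  show "(p, q, m) \<in> {(0,0,2), (1,1,3), (1,2,4), (2,1,4), (1,3,6), (3,1,6)}"
  proof (cases "p = 0")
    case True
    then show ?thesis using m z by simp
  next
    case False
    then have 1: "1 \<le> p" "1 \<le> q" using z pq by auto
    have le: "p * q \<le> 3" using m by auto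
    have "p * 1 \<le> p * q" "1 * q \<le> p * q" using 1 by (intro mult_left_mono mult_right_mono; simp)+
    then have "p \<le> 3" "q \<le> 3" using le by linarith+
    then have "p = 1 \<or> p = 2 \<or> p = 3" "q = 1 \<or> q = 2 \<or> q = 3" using 1 by presburger+
    then show ?thesis using m by (elim disjE) simp_all
  qed
qed

lemma braid_alt_coeff:
  assumes "braid_length i j m"
  shows "alt_coeff (m - 1) (- cartan i j) (- cartan j i) = (0, 1)"
    and "k < m \<Longrightarrow> 0 \<le> fst (alt_coeff k (- cartan i j) (- cartan j i))
        \<and> 0 \<le> snd (alt_coeff k (- cartan i j) (- cartan j i))"
proof -
  define p q where "p = - cartan i j" and "q = - cartan j i"
  have "(p, q, m) \<in> {(0,0,2), (1,1,3), (1,2,4), (2,1,4), (1,3,6), (3,1,6)}"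
    using braid_cartan[OF assms] by (simp add: p_def q_def)
  then have "alt_coeff (m - 1) p q = (0, 1) \<and> (\<forall>k<m. 0 \<le> fst (alt_coeff k p q) \<and> 0 \<le> snd (alt_coeff k p q))"
    by (auto simp: numeral_eq_Suc less_Suc_eq)
  then show "alt_coeff (m - 1) (- cartan i j) (- cartan j i) = (0, 1)"
    "k < m \<Longrightarrow> 0 \<le> fst (alt_coeff k (- cartan i j) (- cartan j i))
        \<and> 0 \<le> snd (alt_coeff k (- cartan i j) (- cartan j i))"
    by (simp_all add: p_def q_def)
qed

text \<open>
  The word of length \<open>m - 1\<close> sends the simple root of the missing letter to \<open>\<alpha>\<^sub>j\<close> (the coefficients are
  \<open>(0, 1)\<close>), so it conjugates the one simple reflection into the other.
\<close>

lemma wp_braid: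
  assumes "braid_length i j m"
  shows "wp (alt m i j) = wp (alt m j i)"
proof -
  obtain k where m: "m = Suc k" using assms by (auto simp: braid_length_def numeral_eq_Suc)
  have "aff_act (wp (alt k i j)) (aff_simple (alt_last k i j)) = aff_simple j"
    using braid_alt_coeff(1)[OF assms] unfolding alt_root by (simp add: m aff_comb_def)
  then have "\<s> j \<cdot> wp (alt k i j) = wp (alt k i j) \<cdot> \<s> (alt_last k i j)"
    using aff_refl_conj[OF wp_carrier aff_simple_root, of "alt k i j" "alt_last k i j"]
    by (simp add: simple_reflection_eq)
  then show ?thesis unfolding m alt_snoc[of k i j] by (simp add: wp_append wp_Cons wp_Nil)
qed

lemma aff_comb_not_pos:
  assumes x: "x \<in> \<W>" and c: "0 \<le> fst c" "0 \<le> snd c" and root: "aff_comb r s c \<in> aff_roots"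
    and r: "r \<in> aff_roots" "\<not> aff_pos (aff_act x r)" and s: "s \<in> aff_roots" "\<not> aff_pos (aff_act x s)"
  shows "\<not> aff_pos (aff_act x (aff_comb r s c))"
proof -
  let ?t = "aff_comb r s c"
  obtain m w where xw: "x = (m, w)" "w \<in> weyl D" using x by (cases x) (simp add: carrier_Waf)
  have "aff_pos (aff_uminus (aff_act x r))" "aff_pos (aff_uminus (aff_act x s))"
    using aff_pos_or_neg aff_act_root x r s by blast+
  then have n: "snd (aff_act x r) \<le> 0" "snd (aff_act x s) \<le> 0"
    "nonneg_comb D (- fst (aff_act x r) + frag_cmul (- snd (aff_act x r)) \<theta>)"
    "nonneg_comb D (- fst (aff_act x s) + frag_cmul (- snd (aff_act x s)) \<theta>)"
    by (simp_all add: aff_pos_def aff_uminus_def)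
  have lin: "aff_act x ?t = aff_comb (aff_act x r) (aff_act x s) c"
    by (simp add: aff_act_def aff_comb_def xw weyl_add weyl_cmul pairing_simps algebra_simps)
  have "- fst (aff_act x ?t) + frag_cmul (- snd (aff_act x ?t)) \<theta>
      = frag_cmul (fst c) (- fst (aff_act x r) + frag_cmul (- snd (aff_act x r)) \<theta>)
      + frag_cmul (snd c) (- fst (aff_act x s) + frag_cmul (- snd (aff_act x s)) \<theta>)"
    unfolding lin by (rule poly_mapping_eqI) (simp add: aff_comb_def lookup_add lookup_minus algebra_simps)
  moreover have "nonneg_comb D \<dots>" by (intro nonneg_comb_add nonneg_comb_cmul n c)
  moreover have "snd (aff_act x ?t) \<le> 0"
    unfolding lin using c n by (simp add: aff_comb_def add_nonpos_nonpos mult_nonneg_nonpos)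
  moreover have "aff_uminus (aff_act x ?t) \<in> aff_roots"
    by (intro aff_uminus_root aff_act_root x root)
  ultimately have "aff_pos (aff_uminus (aff_act x ?t))" by (simp add: aff_pos_def aff_uminus_def)
  then show ?thesis using aff_not_pos_and_neg by blast
qed

lemma reduced_word_prefix:
  assumes x: "x \<in> \<W>"
    and neg: "\<And>k. k < m \<Longrightarrow> \<not> aff_pos (aff_act (waf_inv x) (aff_act (wp (alt k i j)) (aff_simple (alt_last k i j))))"
  shows "\<exists>js. reduced_word D x (alt m i j @ js)"
  using neg
proof (induction m)
  case 0
  obtain js where "reduced_word D x js" using x by (rule reduced_word_ex)
  then show ?case by auto
next
  case (Suc m)
  have "\<exists>js. reduced_word D x (alt m i j @ js)" by (intro Suc.IH Suc.prems less_SucI)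
  then obtain js where js: "reduced_word D x (alt m i j @ js)" by blast
  let ?b = "alt_last m i j"
  have xe: "x = wp (alt m i j) \<cdot> wp js" and l: "\<l> x = m + length js"
    using js by (simp_all add: reduced_word_def wp_append)
  have "waf_inv x \<cdot> wp (alt m i j) = waf_inv (wp js)"
    unfolding xe by (simp add: W.inv_mult_group W.m_assoc)
  then have "left_descent ?b (wp js)"
    using Suc.prems[of m] x by (simp add: left_descent_def flip: aff_act_mult)
  then have lt: "\<l> (\<s> ?b \<cdot> wp js) < \<l> (wp js)" using left_descent_iff(1)[OF wp_carrier] by blast
  obtain ks where ks: "reduced_word D (\<s> ?b \<cdot> wp js) ks" by (rule reduced_word_ex[of "\<s> ?b \<cdot> wp js"]) simp_all
  have "wp (?b # ks) = wp js" using ks by (simp add: wp_Cons reduced_word_def)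
  then have "wp (alt (Suc m) i j @ ks) = x" unfolding alt_snoc xe by (simp add: wp_append)
  moreover have "length (alt (Suc m) i j @ ks) \<le> \<l> x"
    using lt ks len_le[of js] l by (simp add: reduced_word_def)
  ultimately have "reduced_word D x (alt (Suc m) i j @ ks)"
    using len_le[of "alt (Suc m) i j @ ks"] by (simp only: reduced_word_def) simp
  then show ?case by blast
qed

text \<open>
  All roots which are non-negative combinations of \<open>\<alpha>\<^sub>i\<close> and \<open>\<alpha>\<^sub>j\<close> become negative under \<open>x\<^sup>-\<^sup>1\<close>. These are
  the roots contributed by the letters of an alternating word, so a reduced word of \<open>x\<close> can start with an
  alternating word as long as the coefficients stay non-negative. In the infinite dihedral group they
  always do, which contradicts the finite length of \<open>x\<close>.
\<close>

lemma two_left_descents: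
  assumes x: "x \<in> \<W>" and ij: "i \<noteq> j" and d: "left_descent i x" "left_descent j x"
  obtains m js where "braid_length i j m" "reduced_word D x (alt m i j @ js)" "reduced_word D x (alt m j i @ js)"
proof -
  have neg: "\<not> aff_pos (aff_act (waf_inv x) (aff_act (wp (alt k i j)) (aff_simple (alt_last k i j))))"
    if "0 \<le> fst (alt_coeff k (- cartan i j) (- cartan j i))" "0 \<le> snd (alt_coeff k (- cartan i j) (- cartan j i))" for k
  proof -
    have "aff_act (wp (alt k i j)) (aff_simple (alt_last k i j)) \<in> aff_roots"
      by (intro aff_act_root aff_simple_root wp_carrier)
    then show ?thesis
      using that x d unfolding alt_root left_descent_def by (intro aff_comb_not_pos aff_simple_root) auto
  qed
  show thesis
    using ij
  proof (cases rule: cartan_cases)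
    case (1 m)
    then obtain js where js: "reduced_word D x (alt m i j @ js)"
      using reduced_word_prefix[OF x, of m i j] neg braid_alt_coeff(2)[OF 1] by blast
    then have "reduced_word D x (alt m j i @ js)"
      by (simp add: reduced_word_def wp_append wp_braid[OF 1])
    then show ?thesis using that 1 js by blast
  next
    case 2
    have "alt_coeff k 2 2 = (int k + 1, int k)" for k by (induction k) simp_all
    then have "\<exists>js. reduced_word D x (alt (Suc (\<l> x)) i j @ js)"
      using neg 2 by (intro reduced_word_prefix x) simp
    then show ?thesis by (auto simp: reduced_word_def)
  qed
qed

text \<open>
  This is Matsumoto's theorem. Two reduced words with different first letters \<open>i\<close> and \<open>j\<close> are compared, by
  induction, with two words that start with the two sides of a braid relation and continue in the same way.
\<close>

lemma foldr_reduced_word_unique: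
  assumes braid: "\<And>i j m v. braid_length i j m \<Longrightarrow> foldr f (alt m i j) v = foldr f (alt m j i) v"
    and "reduced_word D x js" "reduced_word D x ks"
  shows "foldr f js v = foldr f ks v"
  using assms(2,3)
proof (induction "length js" arbitrary: x js ks rule: less_induct)
  case less
  have len: "length js = length ks" using less.prems by (simp add: reduced_word_def)
  show ?case
  proof (cases js)
    case Nil
    then show ?thesis using len by simp
  next
    case (Cons i js')
    then obtain j ks' where ks: "ks = j # ks'" using len by (cases ks) auto
    note jc = reduced_word_Cons[OF less.prems(1)[unfolded Cons]]
    note kc = reduced_word_Cons[OF less.prems(2)[unfolded ks]]
    show ?thesis
    proof (cases "i = j")
      case True
      then have "foldr f js' v = foldr f ks' v"
        by (intro less.hyps[OF _ jc(1)]) (use kc(1) in \<open>simp_all add: Cons\<close>)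
      then show ?thesis using Cons ks True by simp
    next
      case False
      obtain m us where m: "braid_length i j m" and us: "reduced_word D x (alt m i j @ us)" "reduced_word D x (alt m j i @ us)"
        using two_left_descents[OF jc(3) False jc(2) kc(2)] by blast
      obtain k where k: "m = Suc k" using m by (auto simp: braid_length_def numeral_eq_Suc)
      \<comment> \<open>Behind the first letter, all four words are reduced words of \<open>s\<^sub>i x\<close> or of \<open>s\<^sub>j x\<close>, which are shorter.\<close>
      have 1: "reduced_word D (\<s> i \<cdot> x) (alt k j i @ us)" "reduced_word D (\<s> j \<cdot> x) (alt k i j @ us)"
        using reduced_word_Cons(1)[of x i "alt k j i @ us"] reduced_word_Cons(1)[of x j "alt k i j @ us"] us
        by (simp_all add: k)
      have "foldr f js' v = foldr f (alt k j i @ us) v"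
        by (rule less.hyps[OF _ jc(1) 1(1)]) (simp add: Cons)
      moreover have "foldr f ks' v = foldr f (alt k i j @ us) v"
        by (rule less.hyps[OF _ kc(1) 1(2)]) (use len in \<open>simp add: Cons ks\<close>)
      ultimately have "foldr f js v = foldr f (alt m i j) (foldr f us v)"
        "foldr f ks v = foldr f (alt m j i) (foldr f us v)"
        by (simp_all add: Cons ks k)
      then show ?thesis using braid[OF m] by simp
    qed
  qed
qed

subsection \<open>Bruhat order\<close>

lemma affine_reflections_eq: "affine_reflections D = aff_refl ` {r. aff_pos r}"
proof
  have "v \<cdot> \<s> j \<cdot> waf_inv v \<in> aff_refl ` {r. aff_pos r}" if v: "v \<in> \<W>" for v j
  proof -
    let ?r = "aff_act v (aff_simple j)"
    have r: "?r \<in> aff_roots" by (intro aff_act_root v aff_simple_root)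
    have "v \<cdot> \<s> j \<cdot> waf_inv v = aff_refl ?r \<cdot> v \<cdot> waf_inv v"
      by (simp add: aff_refl_conj v aff_simple_root simple_reflection_eq)
    also have "\<dots> = aff_refl ?r" using v aff_refl_carrier[OF r] by (simp add: W.m_assoc)
    finally have e: "v \<cdot> \<s> j \<cdot> waf_inv v = aff_refl ?r" .
    show ?thesis
    proof (cases "aff_pos ?r")
      case True
      then show ?thesis unfolding e by blast
    next
      case False
      then have "aff_pos (aff_uminus ?r)" using aff_pos_or_neg[OF r] by blast
      then show ?thesis unfolding e by (intro image_eqI[of _ _ "aff_uminus ?r"]) (simp_all add: aff_refl_uminus[OF r])
    qed
  qed
  then show "affine_reflections D \<subseteq> aff_refl ` {r. aff_pos r}"
    unfolding affine_reflections_def by blast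
next
  have "\<exists>v\<in>\<W>. \<exists>j. aff_refl r = v \<cdot> \<s> j \<cdot> waf_inv v" if "aff_pos r" for r
    using that
  proof (induction rule: aff_pos_induct)
    case (simple j)
    then show ?case by (intro bexI[of _ \<e>] exI[of _ j]) (simp_all add: simple_reflection_eq aff_refl_carrier aff_simple_root)
  next
    case (reflect i r)
    then obtain v j where v: "v \<in> \<W>" "aff_refl r = v \<cdot> \<s> j \<cdot> waf_inv v" by blast
    have r: "r \<in> aff_roots" using reflect(1) by (rule aff_posD)
    have "aff_refl (aff_act (\<s> i) r) = aff_refl (aff_act (\<s> i) r) \<cdot> \<s> i \<cdot> \<s> i"
      using aff_refl_carrier[OF aff_act_root[OF simple_carrier r]] by (simp add: W.m_assoc)
    also have "\<dots> = (\<s> i \<cdot> v) \<cdot> \<s> j \<cdot> waf_inv (\<s> i \<cdot> v)"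
      by (simp add: aff_refl_conj r v W.m_assoc W.inv_mult_group inv_simple)
    finally show ?case using v(1) by (intro bexI[of _ "\<s> i \<cdot> v"] exI[of _ j]) simp_all
  qed
  then show "aff_refl ` {r. aff_pos r} \<subseteq> affine_reflections D"
    unfolding affine_reflections_def by blast
qed

definition bruhat_step :: "'i waf \<Rightarrow> 'i waf \<Rightarrow> bool" where
  "bruhat_step x y \<longleftrightarrow> x \<in> \<W> \<and> (\<exists>r. aff_pos r \<and> aff_pos (aff_act x r) \<and> y = x \<cdot> aff_refl r)"

lemma bruhat_le_eq: "bruhat_le D = bruhat_step\<^sup>*\<^sup>*"
  unfolding bruhat_le_def
proof (rule arg_cong[of _ _ rtranclp], intro ext)
  fix v w
  show "(v \<in> \<W> \<and> \<l> v < \<l> w \<and> (\<exists>r\<in>affine_reflections D. w = v \<cdot> r)) = bruhat_step v w"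
    unfolding affine_reflections_eq bruhat_step_def using len_refl_iff by blast
qed

lemma bruhat_step_carrier: "bruhat_step x y \<Longrightarrow> x \<in> \<W>" "bruhat_step x y \<Longrightarrow> y \<in> \<W>"
  by (auto simp: bruhat_step_def aff_refl_carrier aff_posD)

lemma bruhat_step_len: "bruhat_step x y \<Longrightarrow> \<l> x < \<l> y"
  by (auto simp: bruhat_step_def len_refl_greater)

lemma bruhat_refl: "bruhat_le D x x"
  by (simp add: bruhat_le_eq)

lemma bruhat_trans: "bruhat_le D x y \<Longrightarrow> bruhat_le D y z \<Longrightarrow> bruhat_le D x z"
  unfolding bruhat_le_eq by (rule rtranclp_trans)

lemma bruhat_stepI: "bruhat_step x y \<Longrightarrow> bruhat_le D x y"
  by (simp add: bruhat_le_eq)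

lemma bruhat_carrier: "bruhat_le D x y \<Longrightarrow> y \<in> \<W> \<Longrightarrow> x \<in> \<W>"
  unfolding bruhat_le_eq by (induction rule: converse_rtranclp_induct) (auto dest: bruhat_step_carrier)

lemma bruhat_len: "bruhat_le D x y \<Longrightarrow> \<l> x \<le> \<l> y \<and> (x \<noteq> y \<longrightarrow> \<l> x < \<l> y)"
  unfolding bruhat_le_eq by (induction rule: rtranclp_induct) (auto dest: bruhat_step_len)

lemma bruhat_step_simple:
  assumes x: "x \<in> \<W>" and nd: "\<not> left_descent j x"
  shows "bruhat_step x (\<s> j \<cdot> x)"
  using x nd unfolding bruhat_step_def simple_mult_eq_refl[OF x]
  by (intro conjI exI[of _ "aff_act (waf_inv x) (aff_simple j)"])
    (simp_all add: left_descent_def aff_act_inv aff_simple_pos)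

lemma bruhat_step_simple':
  assumes x: "x \<in> \<W>" and d: "left_descent j x"
  shows "bruhat_step (\<s> j \<cdot> x) x"
  using bruhat_step_simple[of "\<s> j \<cdot> x" j] left_descent_simple_mult[OF x] x d by simp

definition lower :: "'i option \<Rightarrow> 'i waf \<Rightarrow> 'i waf" where
  "lower j x = (if left_descent j x then \<s> j \<cdot> x else x)"

definition upper :: "'i option \<Rightarrow> 'i waf \<Rightarrow> 'i waf" where
  "upper j x = (if left_descent j x then x else \<s> j \<cdot> x)"

text \<open>
  If \<open>y = x r > x\<close> with a reflection \<open>r\<close>, then also \<open>s y = (s x) r\<close>, and this again goes up unless
  \<open>y = s x\<close>, as \<open>s\<close> makes only one positive root negative. This is the lifting property.
\<close>

lemma bruhat_step_lift:
  assumes st: "bruhat_step x y"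
  shows "bruhat_le D (lower j x) (lower j y) \<and> bruhat_le D (upper j x) (upper j y)"
proof -
  note xy = bruhat_step_carrier[OF st]
  obtain r where r: "aff_pos r" "aff_pos (aff_act x r)" "y = x \<cdot> aff_refl r"
    using st by (auto simp: bruhat_step_def)
  note rr = aff_posD[OF r(1)]
  have low: "bruhat_le D (lower j z) z" "bruhat_le D (lower j z) (\<s> j \<cdot> z)"
    and up: "bruhat_le D z (upper j z)" "bruhat_le D (\<s> j \<cdot> z) (upper j z)" if "z \<in> \<W>" for z
    using bruhat_step_simple[OF that, of j] bruhat_step_simple'[OF that, of j]
    by (auto simp: lower_def upper_def bruhat_refl intro: bruhat_stepI)
  show ?thesis
  proof (cases "aff_act x r = aff_simple j")
    case True
    then have "y = \<s> j \<cdot> x" using aff_refl_conj[OF xy(1) rr] r(3) by (simp add: simple_reflection_eq)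
    then have "lower j y = lower j x" "upper j y = upper j x"
      using left_descent_simple_mult[OF xy(1), of j] xy(1) by (auto simp: lower_def upper_def)
    then show ?thesis by (simp add: bruhat_refl)
  next
    case False
    then have "aff_pos (aff_act (\<s> j \<cdot> x) r)"
      using simple_permutes_pos[OF r(2)] xy(1) by (simp add: aff_act_mult)
    then have s: "bruhat_step (\<s> j \<cdot> x) (\<s> j \<cdot> y)"
      unfolding bruhat_step_def using r xy(1) aff_refl_carrier[OF rr]
      by (intro conjI exI[of _ r]) (simp_all add: W.m_assoc)
    have 1: "bruhat_le D (lower j x) y" "bruhat_le D (lower j x) (\<s> j \<cdot> y)"
      using low[OF xy(1)] bruhat_stepI[OF st] bruhat_stepI[OF s] bruhat_trans by blast+
    have 2: "bruhat_le D x (upper j y)" "bruhat_le D (\<s> j \<cdot> x) (upper j y)"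
      using up[OF xy(2)] bruhat_stepI[OF st] bruhat_stepI[OF s] bruhat_trans by blast+
    show ?thesis
      using 1 2 unfolding lower_def[of j y] upper_def[of j x] by simp
  qed
qed

lemma bruhat_lift:
  assumes "bruhat_le D x y"
  shows "bruhat_le D (lower j x) (lower j y)" "bruhat_le D (upper j x) (upper j y)"
proof -
  have "bruhat_le D (lower j x) (lower j y) \<and> bruhat_le D (upper j x) (upper j y)"
    using assms unfolding bruhat_le_eq
  proof (induction rule: rtranclp_induct)
    case (step y z)
    then show ?case using bruhat_step_lift[of y z j] unfolding bruhat_le_eq by (auto intro: rtranclp_trans)
  qed simp
  then show "bruhat_le D (lower j x) (lower j y)" "bruhat_le D (upper j x) (upper j y)" by auto
qed

text \<open>
  By lifting, \<open>v \<le> s x\<close> holds exactly if the smaller one of \<open>v\<close> and \<open>s v\<close> is below \<open>x\<close>. So the interval is a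
  disjoint union of pairs \<open>{v, s v}\<close>.
\<close>

lemma bruhat_interval_step:
  assumes x: "x \<in> \<W>" and nd: "\<not> left_descent j x"
  defines "A \<equiv> {v. bruhat_le D v x \<and> \<not> left_descent j v}"
  shows "{v. bruhat_le D v (\<s> j \<cdot> x)} = A \<union> (\<lambda>v. \<s> j \<cdot> v) ` A" "A \<inter> (\<lambda>v. \<s> j \<cdot> v) ` A = {}"
    "inj_on (\<lambda>v. \<s> j \<cdot> v) A" "A \<subseteq> \<W>"
proof -
  show AW: "A \<subseteq> \<W>" unfolding A_def using bruhat_carrier x by blast
  have sx: "\<s> j \<cdot> x \<in> \<W>" "left_descent j (\<s> j \<cdot> x)"
    using x nd left_descent_simple_mult[OF x] by simp_all
  have lx: "lower j (\<s> j \<cdot> x) = x" "upper j x = \<s> j \<cdot> x" using sx x nd by (simp_all add: lower_def upper_def)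
  show "{v. bruhat_le D v (\<s> j \<cdot> x)} = A \<union> (\<lambda>v. \<s> j \<cdot> v) ` A"
  proof (intro equalityI subsetI)
    fix v assume "v \<in> {v. bruhat_le D v (\<s> j \<cdot> x)}"
    then have v: "bruhat_le D v (\<s> j \<cdot> x)" "v \<in> \<W>" using bruhat_carrier sx by auto
    have l: "bruhat_le D (lower j v) x" using bruhat_lift(1)[OF v(1), of j] by (simp add: lx)
    show "v \<in> A \<union> (\<lambda>v. \<s> j \<cdot> v) ` A"
    proof (cases "left_descent j v")
      case True
      then have "\<s> j \<cdot> v \<in> A"
        using l left_descent_simple_mult[OF v(2)] by (simp add: A_def lower_def)
      then have "\<s> j \<cdot> (\<s> j \<cdot> v) \<in> (\<lambda>v. \<s> j \<cdot> v) ` A" by blast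
      then show ?thesis using v(2) by simp
    qed (use l in \<open>simp add: A_def lower_def\<close>)
  next
    fix v assume "v \<in> A \<union> (\<lambda>v. \<s> j \<cdot> v) ` A"
    then show "v \<in> {v. bruhat_le D v (\<s> j \<cdot> x)}"
    proof
      assume "v \<in> A"
      then show ?thesis
        using bruhat_trans[OF _ bruhat_stepI[OF bruhat_step_simple[OF x nd]]] by (simp add: A_def)
    next
      assume "v \<in> (\<lambda>v. \<s> j \<cdot> v) ` A"
      then obtain u where u: "u \<in> A" "v = \<s> j \<cdot> u" by blast
      then have "bruhat_le D (upper j u) (upper j x)" using bruhat_lift(2) by (simp add: A_def)
      then show ?thesis using u by (simp add: lx(2)) (simp add: A_def upper_def)
    qed
  qed
  show "A \<inter> (\<lambda>v. \<s> j \<cdot> v) ` A = {}"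
    using left_descent_simple_mult AW by (fastforce simp: A_def)
  show "inj_on (\<lambda>v. \<s> j \<cdot> v) A"
    by (rule inj_on_inverseI[of _ "\<lambda>v. \<s> j \<cdot> v"]) (use AW in auto)
qed

lemma finite_bruhat_interval: "x \<in> \<W> \<Longrightarrow> finite {v. bruhat_le D v x}"
  using bruhat_carrier bruhat_len by (intro finite_subset[OF _ finite_bounded_length[of "\<l> x"]]) blast

subsection \<open>Minimal coset representatives\<close>

lemma coset_eq: "x \<in> \<W> \<Longrightarrow> x <#\<^bsub>Waf D\<^esub> Wfin D = {fst x} \<times> weyl D"
proof -
  assume x: "x \<in> \<W>"
  obtain m v where xv: "x = (m, v)" and v: "v \<in> weyl D" using x by (cases x) (simp add: carrier_Waf)
  have "(m, w) \<in> x <#\<^bsub>Waf D\<^esub> Wfin D" if w: "w \<in> weyl D" for w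
  proof -
    have "winv v \<circ> w \<in> weyl D" using v w by (intro weyl_comp weyl_inv)
    moreover have "(m, w) = x \<cdot> (0, winv v \<circ> w)"
      using v by (simp add: xv mult_Waf coweight_act_zero weyl_inv flip: comp_assoc)
    ultimately show ?thesis unfolding l_coset_def Wfin_def by blast
  qed
  then show ?thesis
    using v by (auto simp: l_coset_def Wfin_def xv mult_Waf coweight_act_zero weyl_comp)
qed

lemma in_coset: "m = fst x \<Longrightarrow> x \<in> \<W> \<Longrightarrow> x \<in> {m} \<times> weyl D"
  by (cases x) (simp add: carrier_Waf)

lemma Waf_minD: "x \<in> Waf_min D \<Longrightarrow> x \<in> \<W>"
  by (simp add: Waf_min_def)

lemma Waf_min_le: "x \<in> Waf_min D \<Longrightarrow> y \<in> \<W> \<Longrightarrow> fst y = fst x \<Longrightarrow> \<l> x \<le> \<l> y"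
  using in_coset[of "fst x" y] by (simp add: Waf_min_def coset_eq)

lemma mult_finite_fst: "x \<in> \<W> \<Longrightarrow> w \<in> weyl D \<Longrightarrow> fst (x \<cdot> (0, w)) = fst x"
  by (cases x) (simp add: mult_Waf carrier_Waf coweight_act_zero)

lemma fst_mult_simple: "x \<in> \<W> \<Longrightarrow> fst (x \<cdot> \<s> (Some i)) = fst x"
  using mult_finite_fst[of x "simple_refl i"]
  by (simp add: simple_reflection.simps weyl_reflection simple_root_root)

lemma Waf_min_right_ascent:
  assumes x: "x \<in> Waf_min D"
  shows "aff_pos (aff_act x (simple_root D i, 0))"
proof (rule ccontr)
  assume neg: "\<not> ?thesis"
  note xW = Waf_minD[OF x]
  have "\<l> (x \<cdot> \<s> (Some i)) < \<l> x"
    using len_refl_less[OF xW aff_simple_pos, of "Some i"] neg by (simp add: simple_reflection_eq)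
  moreover have "\<l> x \<le> \<l> (x \<cdot> \<s> (Some i))"
    using xW by (intro Waf_min_le[OF x]) (simp_all add: fst_mult_simple)
  ultimately show False by simp
qed

lemma right_ascent_pos_root:
  assumes x: "x \<in> \<W>" and asc: "\<And>i. aff_pos (aff_act x (simple_root D i, 0))" and a: "a \<in> pos_roots"
  shows "aff_pos (aff_act x (a, 0))"
proof -
  obtain m w where xw: "x = (m, w)" and w: "w \<in> weyl D" using x by (cases x) (simp add: carrier_Waf)
  obtain n where n: "a = root_comb D n" and n0: "\<And>i. 0 \<le> n i"
    using a by (auto simp: pos_roots_def elim: nonneg_combE)
  let ?p = "\<lambda>i. - pairing (w (simple_root D i)) m"
  have lev: "- pairing (w a) m = (\<Sum>i\<in>UNIV. n i * ?p i)"
    by (simp add: n root_comb_def weyl_sum[OF w] weyl_cmul[OF w] pairing_sum_left pairing_cmul_left sum_negf)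
  have asc': "0 \<le> ?p i" "nonneg_comb D (w (simple_root D i) + frag_cmul (?p i) \<theta>)" for i
    using asc[of i] by (simp_all add: aff_pos_def aff_act_def xw)
  have "w a + frag_cmul (- pairing (w a) m) \<theta>
      = (\<Sum>i\<in>UNIV. frag_cmul (n i) (w (simple_root D i) + frag_cmul (?p i) \<theta>))"
    unfolding lev
    by (rule poly_mapping_eqI)
      (simp add: n root_comb_def weyl_sum[OF w] weyl_cmul[OF w] lookup_add lookup_sum
        sum_distrib_right sum_distrib_left sum_subtractf sum_negf algebra_simps)
  moreover have "nonneg_comb D \<dots>"
  proof -
    have sum: "nonneg_comb D (sum f A)" if "\<And>i. nonneg_comb D (f i)" for f :: "'i \<Rightarrow> 'i weight" and A
      using that by (induction A rule: infinite_finite_induct) (auto intro: nonneg_comb_zero nonneg_comb_add)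
    show ?thesis by (intro sum nonneg_comb_cmul asc' n0)
  qed
  moreover have "0 \<le> - pairing (w a) m" unfolding lev by (intro sum_nonneg mult_nonneg_nonneg n0 asc')
  moreover have "aff_act x (a, 0) \<in> aff_roots"
    using pos_rootsD[OF a] by (intro aff_act_root x) (simp add: aff_roots_def)
  ultimately show ?thesis by (simp add: aff_pos_def aff_act_def xw)
qed

lemma len_zero:
  assumes "x \<in> \<W>" "\<And>j. aff_pos (aff_act x (aff_simple j))"
  shows "x = \<e>"
proof -
  have "waf_inv x \<in> \<W>" using assms by simp
  then obtain js where js: "reduced_word D (waf_inv x) js" by (rule reduced_word_ex)
  show ?thesis
  proof (cases js)
    case Nil
    then have "waf_inv x = \<e>" using js by (simp add: reduced_word_def wp_Nil)
    then show ?thesis using assms(1) W.inv_eq_1_iff by blast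
  next
    case (Cons j ks)
    then have "left_descent j (waf_inv x)" using js reduced_word_Cons(2) by blast
    then show ?thesis using assms by (simp add: left_descent_def)
  qed
qed

text \<open>
  Otherwise \<open>u\<close> keeps all simple affine roots positive, including \<open>\<delta> - \<theta>\<close> as the level stays \<open>1\<close>; such an
  element has length \<open>0\<close>.
\<close>

lemma weyl_nontrivial_descent:
  assumes u: "u \<in> weyl D" and ne: "u \<noteq> id"
  obtains i where "- u (simple_root D i) \<in> pos_roots"
proof (rule ccontr)
  assume "\<not> thesis"
  then have pos: "u (simple_root D i) \<in> pos_roots" for i
    using that pos_or_neg[OF weyl_root[OF u simple_root_root]] by blast
  have "(0, u) = \<e>"
  proof (rule len_zero)
    show "(0, u) \<in> \<W>" using u by (simp add: carrier_Waf)
    fix j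
    show "aff_pos (aff_act (0, u) (aff_simple j))"
    proof (cases j)
      case None
      have "- u \<theta> \<in> roots D" by (rule uminus_root[OF weyl_root[OF u highest_root]])
      moreover have "nonneg_comb D (- u \<theta> + \<theta>)"
        using below_highest_root[OF weyl_root[OF u highest_root]] by simp
      moreover have "aff_act (0, u) (aff_simple j) = (- u \<theta>, 1)"
        unfolding None by (simp add: aff_act_def pairing_zero_right weyl_uminus[OF u])
      ultimately show ?thesis unfolding aff_pos_def aff_roots_def by simp
    next
      case (Some i)
      then have "aff_act (0, u) (aff_simple j) = (u (simple_root D i), 0)"
        by (simp add: aff_act_def pairing_zero_right)
      then show ?thesis using pos[of i] unfolding aff_pos_def aff_roots_def pos_roots_def by simp
    qed
  qed
  then show False using ne by (simp add: one_Waf)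
qed

text \<open>
  If \<open>y = x u\<close> with \<open>u \<noteq> 1\<close> in the finite Weyl group, then \<open>u\<close> makes some simple root negative, and \<open>x\<close> keeps
  finite roots on their side.
\<close>

lemma right_ascent_unique:
  assumes x: "x \<in> \<W>" and asc: "\<And>i. aff_pos (aff_act x (simple_root D i, 0))"
    and y: "y \<in> \<W>" "fst y = fst x" "y \<noteq> x"
  obtains i where "\<not> aff_pos (aff_act y (simple_root D i, 0))"
proof -
  define u where "u = winv (snd x) \<circ> snd y"
  have w: "snd x \<in> weyl D" "snd y \<in> weyl D" using x y by (simp_all add: carrier_Waf)
  have u: "u \<in> weyl D" unfolding u_def by (intro weyl_comp weyl_inv w)
  have yu: "y = x \<cdot> (0, u)"
    using w y(2) by (cases x; cases y) (simp add: u_def mult_Waf coweight_act_zero weyl_inv flip: comp_assoc)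
  have "u \<noteq> id" using y(3) x yu W.r_one[OF x] by (auto simp: one_Waf)
  then obtain i where i: "- u (simple_root D i) \<in> pos_roots" using u weyl_nontrivial_descent by blast
  have u0: "(0, u) \<in> \<W>" using u by (simp add: carrier_Waf)
  have "aff_uminus (aff_act y (simple_root D i, 0)) = aff_act x (- u (simple_root D i), 0)"
    unfolding yu aff_act_mult[OF x u0] aff_act_uminus[OF x, symmetric]
    by (simp add: aff_act_def aff_uminus_def pairing_zero_right)
  then have "aff_pos (aff_uminus (aff_act y (simple_root D i, 0)))"
    using right_ascent_pos_root[OF x asc i] by simp
  then show thesis using that[of i] aff_not_pos_and_neg by blast
qed

lemma Waf_min_unique:
  assumes "x \<in> Waf_min D" "y \<in> Waf_min D" "fst y = fst x"
  shows "y = x"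
proof (rule ccontr)
  assume "y \<noteq> x"
  then show False
    using right_ascent_unique[OF Waf_minD[OF assms(1)] Waf_min_right_ascent[OF assms(1)] Waf_minD[OF assms(2)] assms(3)]
      Waf_min_right_ascent[OF assms(2)] by metis
qed

definition min_rep :: "'i coweight \<Rightarrow> 'i waf" where
  "min_rep m = (ARG_MIN \<l> x. x \<in> {m} \<times> weyl D)"

lemma min_rep: "min_rep m \<in> Waf_min D" "fst (min_rep m) = m"
proof -
  have ex: "(m, id) \<in> {m} \<times> weyl D" by (simp add: weyl.id)
  have 1: "min_rep m \<in> {m} \<times> weyl D" and 2: "\<And>y. y \<in> {m} \<times> weyl D \<Longrightarrow> \<l> (min_rep m) \<le> \<l> y"
    using arg_min_nat_lemma[of "\<lambda>x. x \<in> {m} \<times> weyl D", OF ex, of \<l>] unfolding min_rep_def by blast+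
  show f: "fst (min_rep m) = m" using 1 by auto
  have W: "min_rep m \<in> \<W>" using 1 by (auto simp: carrier_Waf)
  show "min_rep m \<in> Waf_min D" unfolding Waf_min_def coset_eq[OF W] f using 2 W coset_eq[OF W] f by simp
qed

lemma min_rep_eq: "x \<in> Waf_min D \<Longrightarrow> min_rep (fst x) = x"
  using Waf_min_unique[of x "min_rep (fst x)"] min_rep by blast

lemma Waf_min_less:
  assumes x: "x \<in> Waf_min D" and y: "y \<in> \<W>" "fst y = fst x" "y \<noteq> x"
  shows "\<l> x < \<l> y"
proof (rule ccontr)
  assume "\<not> ?thesis"
  then have eq: "\<l> y = \<l> x" using Waf_min_le[OF x y(1,2)] by simp
  have "y \<in> Waf_min D"
    unfolding Waf_min_def using coset_eq[OF y(1)] coset_eq[OF Waf_minD[OF x]] x y(1,2) eq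
    by (simp add: Waf_min_def)
  then show False using Waf_min_unique[OF x] y by blast
qed

lemma not_min_right_descent:
  assumes x: "x \<in> \<W>" and nm: "x \<notin> Waf_min D"
  obtains i where "\<not> aff_pos (aff_act x (aff_simple (Some i)))"
proof -
  let ?z = "min_rep (fst x)"
  obtain i where "\<not> aff_pos (aff_act x (simple_root D i, 0))"
    using right_ascent_unique[OF Waf_minD[OF min_rep(1)] Waf_min_right_ascent[OF min_rep(1)] x, of "fst x"]
      nm min_rep by metis
  then show thesis using that by simp
qed

lemma right_descent_word:
  assumes x: "x \<in> \<W>" and d: "\<not> aff_pos (aff_act x (aff_simple j))"
  obtains js where "reduced_word D x (js @ [j])" "reduced_word D (x \<cdot> \<s> j) js"
proof -
  have xs: "x \<cdot> \<s> j \<in> \<W>" using x by simp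
  obtain js where js: "reduced_word D (x \<cdot> \<s> j) js" using xs by (rule reduced_word_ex)
  have "wp (js @ [j]) = x" using js x by (simp add: wp_append wp_single reduced_word_def W.m_assoc)
  moreover have "\<l> x = Suc (\<l> (x \<cdot> \<s> j))"
    using len_mult_simple[OF x, of j] d by simp
  ultimately have "reduced_word D x (js @ [j])" using js by (simp add: reduced_word_def)
  then show thesis using that js by blast
qed

end

section \<open>The twisted group algebra\<close>

lemma RT_to_QT_add: "RT_to_QT (p + q) = RT_to_QT p + RT_to_QT q"
  by (simp add: RT_to_QT_def)

lemma RT_to_QT_mult: "RT_to_QT (p * q) = RT_to_QT p * RT_to_QT q"
  by (simp add: RT_to_QT_def)

lemma RT_to_QT_uminus: "RT_to_QT (- p) = - RT_to_QT p"
  by (simp add: RT_to_QT_def)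

lemma RT_to_QT_diff: "RT_to_QT (p - q) = RT_to_QT p - RT_to_QT q"
  by (simp add: RT_to_QT_def)

lemma RT_to_QT_zero: "RT_to_QT 0 = 0"
  by (simp add: RT_to_QT_def Zero_fract_def)

lemma RT_to_QT_one: "RT_to_QT 1 = 1"
  by (simp add: RT_to_QT_def One_fract_def)

lemma RT_to_QT_eq_iff: "RT_to_QT p = RT_to_QT q \<longleftrightarrow> p = q"
  by (simp add: RT_to_QT_def eq_fract)

definition char_elt :: "'i::{finite,linorder} weight \<Rightarrow> 'i QT" where
  "char_elt l = RT_to_QT (frag_of l)"

lemma char_elt_add: "char_elt (l + m) = char_elt l * char_elt m"
  by (simp add: char_elt_def mult_single flip: RT_to_QT_mult)

lemma char_elt_zero: "char_elt 0 = 1"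
  by (simp add: char_elt_def RT_to_QT_one flip: RT_to_QT_one)

lemma char_elt_eq_iff: "char_elt l = char_elt m \<longleftrightarrow> l = m"
  by (simp add: char_elt_def RT_to_QT_eq_iff frag_of_eq)

lemma char_elt_nonzero: "char_elt l \<noteq> 0"
  by (simp add: char_elt_def RT_to_QT_eq_iff flip: RT_to_QT_zero)

lemma char_elt_uminus: "char_elt (- l) = inverse (char_elt l)"
  using char_elt_add[of l "- l"] by (simp add: char_elt_zero inverse_unique)

lemma char_elt_cmul_nat: "char_elt (frag_cmul (int n) l) = char_elt l ^ n"
  by (induction n) (simp_all add: char_elt_zero char_elt_add frag_cmul_distrib)

lemma char_elt_regular: "l \<noteq> 0 \<Longrightarrow> 1 - char_elt l \<noteq> 0"
  using char_elt_eq_iff[of 0 l] by (simp add: char_elt_zero)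

lemma RT_act_mult:
  assumes "\<And>l m. w (l + m) = w l + w m"
  shows "RT_act w (p * q) = RT_act w p * RT_act w q"
proof -
  have "keys p \<subseteq> UNIV" by simp
  then show ?thesis
  proof (induction p rule: frag_induction)
    case (one l)
    have "keys q \<subseteq> UNIV" by simp
    then show ?case
      by (induction q rule: frag_induction)
        (simp_all add: RT_act_def assms mult_single frag_extend_diff right_diff_distrib)
  qed (simp_all add: RT_act_def frag_extend_diff left_diff_distrib)
qed

lemma RT_act_add: "RT_act w (p + q) = RT_act w p + RT_act w q"
  by (simp add: RT_act_def frag_extend_add)

lemma RT_act_frag_of: "RT_act w (frag_of l) = frag_of (w l)"
  by (simp add: RT_act_def)

lemma RT_act_zero: "RT_act w 0 = 0"
  by (simp add: RT_act_def)

lemma RT_act_comp: "RT_act v (RT_act w p) = RT_act (v \<circ> w) p"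
  using frag_extend_compose[of "\<lambda>l. frag_of (v l)" w p] by (simp add: RT_act_def comp_def)

lemma RT_act_id: "RT_act id p = p"
  by (simp add: RT_act_def flip: frag_expansion)

lemma lookup_scale: "lookup (scale p a) v = p * lookup a v"
  by (simp add: scale_def Poly_Mapping.map.rep_eq when_def)

interpretation scale: vector_space "scale :: 'i::{finite,linorder} QT \<Rightarrow> 'i twisted \<Rightarrow> 'i twisted"
  by unfold_locales (rule poly_mapping_eqI; simp add: lookup_scale lookup_add algebra_simps)+

lemma keys_scale: "keys (scale p a) \<subseteq> keys a"
  by (auto simp: in_keys_iff lookup_scale)

lemma scale_single: "scale p (Poly_Mapping.single v f) = Poly_Mapping.single v (p * f)"
  by (rule poly_mapping_eqI) (simp add: lookup_scale lookup_single when_def)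

lemma sum_single: "(\<Sum>v\<in>keys a. Poly_Mapping.single v (lookup a v)) = a"
proof (rule poly_mapping_eqI)
  fix k
  show "lookup (\<Sum>v\<in>keys a. Poly_Mapping.single v (lookup a v)) k = lookup a k"
    by (simp add: lookup_sum lookup_single when_def in_keys_iff)
qed

lemma additive_eqI:
  fixes f g :: "('a \<Rightarrow>\<^sub>0 'c::comm_monoid_add) \<Rightarrow> 'b :: comm_monoid_add"
  assumes "f 0 = g 0" "\<And>a b. f (a + b) = f a + f b" "\<And>a b. g (a + b) = g a + g b"
    and "\<And>v x. f (Poly_Mapping.single v x) = g (Poly_Mapping.single v x)"
  shows "f a = g a"
proof -
  have sums: "f (sum h A) = g (sum h A)" if "\<And>x. f (h x) = g (h x)" for h and A :: "'d set"
    using that by (induction A rule: infinite_finite_induct) (simp_all add: assms)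
  have "f (\<Sum>v\<in>keys a. Poly_Mapping.single v (lookup a v))
      = g (\<Sum>v\<in>keys a. Poly_Mapping.single v (lookup a v))"
    by (rule sums) (rule assms(4))
  then show ?thesis by (simp add: sum_single)
qed

locale ordered_root_datum = simple_sc_root_datum D
  for D :: "'i::{finite,linorder} root_datum"
begin

lemma RT_act_one: "w \<in> weyl D \<Longrightarrow> RT_act w 1 = 1"
  using RT_act_frag_of[of w 0] by (simp add: weyl_zero)

lemma RT_act_weyl_mult: "w \<in> weyl D \<Longrightarrow> RT_act w (p * q) = RT_act w p * RT_act w q"
  by (intro RT_act_mult weyl_add)

lemma RT_act_eq_0: "w \<in> weyl D \<Longrightarrow> RT_act w p = 0 \<longleftrightarrow> p = 0"
  using RT_act_comp[of "winv w" w p] by (auto simp: weyl_inv RT_act_id RT_act_zero)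

lemma QT_act_Fract:
  assumes w: "w \<in> weyl D" and q: "q \<noteq> 0"
  shows "QT_act w (Fract p q) = Fract (RT_act w p) (RT_act w q)"
  unfolding QT_act_def
proof (rule the_equality)
  fix g assume "\<exists>p' q'. q' \<noteq> 0 \<and> Fract p q = Fract p' q' \<and> g = Fract (RT_act w p') (RT_act w q')"
  then obtain p' q' where g: "q' \<noteq> 0" "Fract p q = Fract p' q'" "g = Fract (RT_act w p') (RT_act w q')"
    by blast
  then have "p * q' = p' * q" using q by (simp add: eq_fract)
  then have "RT_act w p * RT_act w q' = RT_act w p' * RT_act w q"
    by (simp flip: RT_act_weyl_mult[OF w])
  then show "g = Fract (RT_act w p) (RT_act w q)"
    using g q by (simp add: eq_fract RT_act_eq_0[OF w])
qed (use q in blast)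

lemma QT_act_add:
  assumes w: "w \<in> weyl D"
  shows "QT_act w (f + g) = QT_act w f + QT_act w g"
proof -
  obtain p q where f: "f = Fract p q" "q \<noteq> 0" by (cases f)
  obtain p' q' where g: "g = Fract p' q'" "q' \<noteq> 0" by (cases g)
  show ?thesis
    using f g by (simp add: QT_act_Fract[OF w] RT_act_weyl_mult[OF w] RT_act_add RT_act_eq_0[OF w])
qed

lemma QT_act_mult:
  assumes w: "w \<in> weyl D"
  shows "QT_act w (f * g) = QT_act w f * QT_act w g"
proof -
  obtain p q where f: "f = Fract p q" "q \<noteq> 0" by (cases f)
  obtain p' q' where g: "g = Fract p' q'" "q' \<noteq> 0" by (cases g)
  show ?thesis
    using f g by (simp add: QT_act_Fract[OF w] RT_act_weyl_mult[OF w])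
qed

lemma QT_act_RT: "w \<in> weyl D \<Longrightarrow> QT_act w (RT_to_QT p) = RT_to_QT (RT_act w p)"
  by (simp add: RT_to_QT_def QT_act_Fract RT_act_one)

lemma QT_act_one: "w \<in> weyl D \<Longrightarrow> QT_act w 1 = 1"
  using QT_act_RT[of w 1] by (simp add: RT_to_QT_one RT_act_one)

lemma QT_act_zero: "w \<in> weyl D \<Longrightarrow> QT_act w 0 = 0"
  using QT_act_RT[of w 0] by (simp add: RT_to_QT_zero RT_act_zero)

lemma QT_act_char: "w \<in> weyl D \<Longrightarrow> QT_act w (char_elt l) = char_elt (w l)"
  by (simp add: char_elt_def QT_act_RT RT_act_frag_of)

lemma QT_act_comp:
  assumes v: "v \<in> weyl D" and w: "w \<in> weyl D"
  shows "QT_act (v \<circ> w) f = QT_act v (QT_act w f)"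
proof -
  obtain p q where f: "f = Fract p q" "q \<noteq> 0" by (cases f)
  then show ?thesis
    using v w by (simp add: QT_act_Fract weyl_comp RT_act_comp RT_act_eq_0)
qed

lemma QT_act_id: "QT_act id f = (f :: 'i QT)"
proof -
  obtain p q where f: "f = Fract p q" "q \<noteq> 0" by (cases f)
  then show ?thesis by (simp add: QT_act_Fract[OF weyl.id] RT_act_id)
qed

lemma QT_act_uminus: "w \<in> weyl D \<Longrightarrow> QT_act w (- f) = - QT_act w f"
  using QT_act_add[of w f "- f"] by (simp add: QT_act_zero eq_neg_iff_add_eq_0 add.commute)

lemma QT_act_diff: "w \<in> weyl D \<Longrightarrow> QT_act w (f - g) = QT_act w f - QT_act w g"
  using QT_act_add[of w f "- g"] by (simp add: QT_act_uminus)

lemma QT_act_inverse: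
  assumes w: "w \<in> weyl D"
  shows "QT_act w (inverse f) = inverse (QT_act w f)"
proof (cases "f = 0")
  case False
  then have "QT_act w f * QT_act w (inverse f) = 1" by (simp add: QT_act_one[OF w] flip: QT_act_mult[OF w])
  then show ?thesis by (simp add: inverse_unique)
qed (simp add: QT_act_zero w)

subsection \<open>The product\<close>

abbreviation kq_mult (infixl "\<star>" 70) where "a \<star> b \<equiv> a \<otimes>\<^bsub>KQ D\<^esub> b"

abbreviation "\<K> \<equiv> carrier (KQ D)"

abbreviation sgl :: "'i waf \<Rightarrow> 'i QT \<Rightarrow> 'i twisted" where "sgl \<equiv> Poly_Mapping.single"

lemma carrier_KQ: "a \<in> \<K> \<longleftrightarrow> keys a \<subseteq> \<W>"
  by (simp add: KQ_def)

lemma KQ_zero [simp]: "0 \<in> \<K>" and KQ_uminus: "a \<in> \<K> \<Longrightarrow> - a \<in> \<K>"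
  by (simp_all add: carrier_KQ)

lemma KQ_add: "a \<in> \<K> \<Longrightarrow> b \<in> \<K> \<Longrightarrow> a + b \<in> \<K>"
  using keys_add[of a b] by (auto simp: carrier_KQ)

lemma KQ_diff: "a \<in> \<K> \<Longrightarrow> b \<in> \<K> \<Longrightarrow> a - b \<in> \<K>"
  using KQ_add[of a "- b"] KQ_uminus[of b] by simp

lemma KQ_scale: "a \<in> \<K> \<Longrightarrow> scale p a \<in> \<K>"
  using keys_scale[of p a] by (auto simp: carrier_KQ)

lemma KQ_single [simp]: "v \<in> \<W> \<Longrightarrow> sgl v f \<in> \<K>"
  by (simp add: carrier_KQ)

lemma KQ_sum: "(\<And>i. i \<in> A \<Longrightarrow> f i \<in> \<K>) \<Longrightarrow> sum f A \<in> \<K>"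
  by (induction A rule: infinite_finite_induct) (auto intro: KQ_add)

definition term_mult :: "'i waf \<Rightarrow> 'i waf \<Rightarrow> 'i QT \<Rightarrow> 'i QT \<Rightarrow> 'i twisted" where
  "term_mult v w f g = sgl (v \<cdot> w) (f * QT_act (snd v) g)"

lemma kq_mult_sup:
  assumes a: "a \<in> \<K>" and A: "finite A" "keys a \<subseteq> A" and B: "finite B" "keys b \<subseteq> B"
  shows "a \<star> b = (\<Sum>v\<in>A. \<Sum>w\<in>B. term_mult v w (lookup a v) (lookup b w))"
proof -
  have z: "QT_act (snd v) 0 = 0" if "v \<in> keys a" for v
    using that a by (intro QT_act_zero) (auto simp: carrier_KQ carrier_Waf)
  have "a \<star> b = (\<Sum>v\<in>keys a. \<Sum>w\<in>keys b. term_mult v w (lookup a v) (lookup b w))"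
    by (simp add: KQ_def term_mult_def)
  also have "\<dots> = (\<Sum>v\<in>keys a. \<Sum>w\<in>B. term_mult v w (lookup a v) (lookup b w))"
    using B z by (intro sum.cong refl sum.mono_neutral_left) (auto simp: term_mult_def in_keys_iff)
  also have "\<dots> = (\<Sum>v\<in>A. \<Sum>w\<in>B. term_mult v w (lookup a v) (lookup b w))"
    using A by (intro sum.mono_neutral_left) (auto simp: term_mult_def in_keys_iff)
  finally show ?thesis .
qed

lemma kq_add_left:
  assumes "a \<in> \<K>" "b \<in> \<K>"
  shows "(a + b) \<star> c = a \<star> c + b \<star> c"
proof -
  let ?A = "keys a \<union> keys b"
  have "a \<star> c + b \<star> c = (\<Sum>v\<in>?A. \<Sum>w\<in>keys c. term_mult v w (lookup (a + b) v) (lookup c w))"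
    using kq_mult_sup[OF assms(1), of ?A "keys c" c] kq_mult_sup[OF assms(2), of ?A "keys c" c]
    by (simp add: term_mult_def lookup_add single_add distrib_right flip: sum.distrib)
  also have "\<dots> = (a + b) \<star> c"
    using keys_add[of a b] by (intro kq_mult_sup[symmetric] KQ_add assms) auto
  finally show ?thesis by simp
qed

lemma kq_add_right:
  assumes "a \<in> \<K>"
  shows "a \<star> (b + c) = a \<star> b + a \<star> c"
proof -
  let ?B = "keys b \<union> keys c" and ?A = "keys a"
  have w: "snd v \<in> weyl D" if "v \<in> ?A" for v using that assms by (auto simp: carrier_KQ carrier_Waf)
  have "a \<star> b + a \<star> c = (\<Sum>v\<in>?A. \<Sum>w\<in>?B. term_mult v w (lookup a v) (lookup (b + c) w))"
    using kq_mult_sup[OF assms, of ?A ?B b] kq_mult_sup[OF assms, of ?A ?B c]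
    by (simp add: term_mult_def lookup_add QT_act_add[OF w] single_add distrib_left flip: sum.distrib)
  also have "\<dots> = a \<star> (b + c)"
    using keys_add[of b c] by (intro kq_mult_sup[symmetric] assms) auto
  finally show ?thesis by simp
qed

lemma kq_single:
  assumes v: "v \<in> \<W>"
  shows "sgl v f \<star> sgl w g = sgl (v \<cdot> w) (f * QT_act (snd v) g)"
  using kq_mult_sup[of "sgl v f" "{v}" "{w}" "sgl w g"] v by (simp add: term_mult_def)

lemma kq_zero_left [simp]: "0 \<star> b = 0"
  using kq_add_left[of 0 0 b] by simp

lemma kq_zero_right [simp]: "a \<in> \<K> \<Longrightarrow> a \<star> 0 = 0"
  using kq_add_right[of a 0 0] by simp

lemma kq_uminus_left: "a \<in> \<K> \<Longrightarrow> (- a) \<star> b = - (a \<star> b)"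
  using kq_add_left[of a "- a" b] KQ_uminus[of a] by (simp add: eq_neg_iff_add_eq_0 add.commute)

lemma kq_uminus_right: "a \<in> \<K> \<Longrightarrow> a \<star> (- b) = - (a \<star> b)"
  using kq_add_right[of a b "- b"] by (simp add: eq_neg_iff_add_eq_0 add.commute)

lemma kq_diff_left: "a \<in> \<K> \<Longrightarrow> b \<in> \<K> \<Longrightarrow> (a - b) \<star> c = a \<star> c - b \<star> c"
  using kq_add_left[of a "- b" c] by (simp add: KQ_uminus kq_uminus_left)

lemma kq_diff_right: "a \<in> \<K> \<Longrightarrow> a \<star> (b - c) = a \<star> b - a \<star> c"
  using kq_add_right[of a b "- c"] by (simp add: kq_uminus_right)

lemma kq_sum_left: "(\<And>i. i \<in> A \<Longrightarrow> f i \<in> \<K>) \<Longrightarrow> sum f A \<star> b = (\<Sum>i\<in>A. f i \<star> b)"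
  by (induction A rule: infinite_finite_induct) (simp_all add: kq_add_left KQ_sum)

lemma kq_sum_right: "a \<in> \<K> \<Longrightarrow> a \<star> sum f A = (\<Sum>i\<in>A. a \<star> f i)"
  by (induction A rule: infinite_finite_induct) (simp_all add: kq_add_right)

lemma KQ_sum_single: "a \<in> \<K> \<Longrightarrow> v \<in> keys a \<Longrightarrow> sgl v f \<in> \<K>"
  by (auto simp: carrier_KQ)

lemma KQ_induct [consumes 1, case_names single add]:
  assumes a: "a \<in> \<K>" and single: "\<And>v f. v \<in> \<W> \<Longrightarrow> P (sgl v f)"
    and add: "\<And>a b. a \<in> \<K> \<Longrightarrow> b \<in> \<K> \<Longrightarrow> P a \<Longrightarrow> P b \<Longrightarrow> P (a + b)"
  shows "P a"
proof -
  have P0: "P 0" using single[of \<e> 0] by simp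
  have "P (\<Sum>v\<in>A. sgl v (lookup a v))" if "finite A" "A \<subseteq> \<W>" for A
    using that
  proof (induction A rule: finite_induct)
    case (insert v A)
    have v: "v \<in> \<W>" and A: "A \<subseteq> \<W>" using insert.prems by blast+
    show ?case
      unfolding sum.insert[OF insert.hyps(1,2)]
      by (intro add KQ_sum KQ_single single v insert.IH A) (use A in blast)
  qed (simp add: P0)
  from this[of "keys a"] show ?thesis using a by (simp add: sum_single carrier_KQ)
qed

lemma KQ_mult: "a \<in> \<K> \<Longrightarrow> b \<in> \<K> \<Longrightarrow> a \<star> b \<in> \<K>"
proof (induction a rule: KQ_induct)
  case (single v f)
  from single(2,1) show ?case by (induction b rule: KQ_induct) (simp_all add: kq_single kq_add_right KQ_add)
qed (simp add: kq_add_left KQ_add)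

text \<open>
  With an arbitrary third factor, left multiplication becomes an action on the whole type of twisted
  elements; the rank two computation is applied to this action.
\<close>

lemma waf_assoc:
  assumes "v \<in> \<W>" "w \<in> \<W>"
  shows "v \<cdot> w \<cdot> u = v \<cdot> (w \<cdot> u)"
  using assms by (cases v; cases w; cases u)
    (simp add: carrier_Waf mult_Waf coweight_act_add coweight_act_comp comp_assoc add.assoc)

lemma snd_mult: "snd (v \<cdot> w) = snd v \<circ> snd w"
  by (cases v; cases w) (simp add: mult_Waf)

lemma kq_assoc:
  assumes "a \<in> \<K>" "b \<in> \<K>"
  shows "a \<star> b \<star> c = a \<star> (b \<star> c)"
  using assms
proof (induction a rule: KQ_induct)
  case (single v f)
  from single(2,1) show ?case
  proof (induction b rule: KQ_induct)
    case (single w g)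
    note vw = \<open>v \<in> \<W>\<close> \<open>w \<in> \<W>\<close>
    have sw: "snd v \<in> weyl D" "snd w \<in> weyl D" using vw by (simp_all add: carrier_Waf)
    show ?case
      by (rule additive_eqI[of "\<lambda>c. sgl v f \<star> sgl w g \<star> c" "\<lambda>c. sgl v f \<star> (sgl w g \<star> c)"])
        (use vw sw in \<open>simp_all add: kq_single kq_add_right KQ_mult waf_assoc snd_mult QT_act_comp QT_act_mult mult.assoc\<close>)
  qed (simp add: kq_add_left kq_add_right KQ_mult)
qed (simp add: kq_add_left KQ_mult)

abbreviation kq_one ("\<o>") where "\<o> \<equiv> \<one>\<^bsub>KQ D\<^esub>"

lemma kq_one: "\<o> = of_Waf \<e>"
  by (simp add: KQ_def of_Waf_def)

lemma of_Waf_carrier [simp]: "v \<in> \<W> \<Longrightarrow> of_Waf v \<in> \<K>"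
  by (simp add: of_Waf_def)

lemma kq_one_carrier [simp]: "\<o> \<in> \<K>"
  by (simp add: kq_one)

lemma kq_one_left: "\<o> \<star> (a :: 'i twisted) = a"
proof (rule additive_eqI[of "\<lambda>a. \<o> \<star> a" "\<lambda>a. a"])
  fix v and f :: "'i QT"
  have "\<e> \<cdot> v = v" by (cases v) (simp add: one_Waf mult_Waf coweight_act_id)
  then show "\<o> \<star> sgl v f = sgl v f"
    by (simp add: kq_one of_Waf_def kq_single) (simp add: one_Waf QT_act_id)
qed (simp_all add: kq_add_right)

lemma kq_one_right: "a \<in> \<K> \<Longrightarrow> a \<star> \<o> = a"
proof (induction a rule: KQ_induct)
  case (single v f)
  then show ?case by (simp add: kq_one of_Waf_def kq_single carrier_Waf QT_act_one)
qed (simp add: kq_add_left)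

lemma kq_scale_left: "a \<in> \<K> \<Longrightarrow> scale p a \<star> b = scale p (a \<star> b)"
proof (induction a rule: KQ_induct)
  case (single v f)
  show ?case
    by (rule additive_eqI[of "\<lambda>b. scale p (sgl v f) \<star> b" "\<lambda>b. scale p (sgl v f \<star> b)"])
      (use single in \<open>simp_all add: kq_single kq_add_right scale_single scale.scale_right_distrib mult.assoc\<close>)
qed (simp add: kq_add_left scale.scale_right_distrib KQ_scale)

lemma of_Waf_scale:
  assumes "v \<in> \<W>"
  shows "of_Waf v \<star> scale p b = scale (QT_act (snd v) p) (of_Waf v \<star> b)"
proof (rule additive_eqI[of "\<lambda>b. of_Waf v \<star> scale p b" "\<lambda>b. scale (QT_act (snd v) p) (of_Waf v \<star> b)"])
  show "of_Waf v \<star> scale p (sgl w x) = scale (QT_act (snd v) p) (of_Waf v \<star> sgl w x)" for w x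
    using assms by (simp add: of_Waf_def kq_single scale_single QT_act_mult carrier_Waf)
qed (use assms in \<open>simp_all add: kq_add_right scale.scale_right_distrib\<close>)

lemma of_Waf_mult: "v \<in> \<W> \<Longrightarrow> of_Waf v \<star> of_Waf w = of_Waf (v \<cdot> w)"
  by (simp add: of_Waf_def kq_single QT_act_one carrier_Waf)

lemma of_Waf_cancel:
  "v \<in> \<W> \<Longrightarrow> w \<in> \<W> \<Longrightarrow> of_Waf v \<star> (of_Waf w \<star> a) = of_Waf (v \<cdot> w) \<star> a"
  by (simp add: of_Waf_mult flip: kq_assoc)

lemma sgl_eq: "sgl v f = scale f (of_Waf v)"
  by (simp add: of_Waf_def scale_single)

lemma kq_uminus: "a \<in> \<K> \<Longrightarrow> \<ominus>\<^bsub>KQ D\<^esub> a = - a"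
  unfolding a_inv_def m_inv_def
  by (rule the_equality) (auto simp: KQ_def eq_neg_iff_add_eq_0 intro: minus_unique[symmetric])

lemma kq_add: "a \<oplus>\<^bsub>KQ D\<^esub> b = a + b"
  by (simp add: KQ_def)

section \<open>Demazure operators\<close>

abbreviation "\<tau> \<equiv> T_gen D"

definition affine_char :: "'i option \<Rightarrow> 'i QT" where
  "affine_char j = char_elt (affine_simple_root D j)"

lemma snd_simple_weyl: "snd (\<s> j) \<in> weyl D"
  by (simp add: snd_simple_reflection weyl_reflection affine_simple_root_root)

lemma T_gen_eq: "\<tau> j = scale (inverse (1 - affine_char j)) (of_Waf (\<s> j) - \<o>)"
  by (simp add: T_gen_def affine_char_def char_elt_def)

lemma T_gen_carrier [simp]: "\<tau> j \<in> \<K>"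
  by (simp add: T_gen_eq KQ_scale KQ_diff)

lemma T_gen_mult: "\<tau> j \<star> a = scale (inverse (1 - affine_char j)) (of_Waf (\<s> j) \<star> a - a)"
  by (simp add: T_gen_eq kq_scale_left KQ_diff kq_diff_left kq_one_left)

lemma y_gen_mult: "y_gen D j \<star> a = a + \<tau> j \<star> a"
  by (simp add: y_gen_def kq_add_left kq_one_left)

lemma affine_char_regular: "1 - affine_char j \<noteq> 0"
  unfolding affine_char_def by (intro char_elt_regular root_nonzero affine_simple_root_root)

lemma QT_act_simple_char:
  "QT_act (snd (\<s> j)) (char_elt l) = char_elt (reflection D (affine_simple_root D j) l)"
  using QT_act_char[OF snd_simple_weyl[of j], of l] unfolding snd_simple_reflection .

lemma QT_act_affine_char:
  "QT_act (snd (\<s> i)) (affine_char j) = affine_char j * affine_char i ^ nat (- cartan j i)" if "i \<noteq> j"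
proof -
  have "reflection D (affine_simple_root D i) (affine_simple_root D j)
      = affine_simple_root D j + frag_cmul (int (nat (- cartan j i))) (affine_simple_root D i)"
    using cartan_nonpos[of j i] that by (simp add: reflection_def flip: cartan_def)
  then show ?thesis
    by (simp only: affine_char_def QT_act_simple_char char_elt_add char_elt_cmul_nat)
qed

lemma demazure_locale: "semilinear_involution scale (QT_act (snd (\<s> j))) (\<lambda>a. of_Waf (\<s> j) \<star> a) (affine_char j)"
proof
  fix f g :: "'i QT" and u v :: "'i twisted"
  note w = snd_simple_weyl[of j]
  show "QT_act (snd (\<s> j)) (f + g) = QT_act (snd (\<s> j)) f + QT_act (snd (\<s> j)) g" by (rule QT_act_add[OF w])
  show "QT_act (snd (\<s> j)) (f * g) = QT_act (snd (\<s> j)) f * QT_act (snd (\<s> j)) g" by (rule QT_act_mult[OF w])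
  show "QT_act (snd (\<s> j)) 1 = 1" by (rule QT_act_one[OF w])
  show "of_Waf (\<s> j) \<star> (u + v) = of_Waf (\<s> j) \<star> u + of_Waf (\<s> j) \<star> v" by (simp add: kq_add_right)
  show "of_Waf (\<s> j) \<star> scale f v = scale (QT_act (snd (\<s> j)) f) (of_Waf (\<s> j) \<star> v)" by (simp add: of_Waf_scale)
  show "of_Waf (\<s> j) \<star> (of_Waf (\<s> j) \<star> v) = v" by (simp add: of_Waf_cancel kq_one_left flip: kq_one)
  show "QT_act (snd (\<s> j)) (affine_char j) = inverse (affine_char j)"
    by (simp add: affine_char_def QT_act_simple_char reflection_self affine_simple_root_root char_elt_uminus)
  show "affine_char j \<noteq> 0" by (simp add: affine_char_def char_elt_nonzero)
  show "1 - affine_char j \<noteq> 0" by (rule affine_char_regular)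
qed

lemma demazure_eq: "semilinear_involution.demazure scale (\<lambda>a. of_Waf (\<s> j) \<star> a) (affine_char j) a = \<tau> j \<star> a"
  by (simp add: semilinear_involution.demazure_def[OF demazure_locale] T_gen_mult)

lemma T_gen_square: "\<tau> j \<star> (\<tau> j \<star> a) = - (\<tau> j \<star> a)"
  using semilinear_involution.demazure_demazure[OF demazure_locale, of j a] by (simp add: demazure_eq)

lemma affine_char_comb_regular:
  assumes "2 * int c + int d * cartan j i \<noteq> 0 \<or> int c * cartan i j + 2 * int d \<noteq> 0"
  shows "1 - affine_char i ^ c * affine_char j ^ d \<noteq> 0"
proof -
  let ?l = "frag_cmul (int c) (affine_simple_root D i) + frag_cmul (int d) (affine_simple_root D j)"
  have "pairing ?l (coroot D (affine_simple_root D i)) = 2 * int c + int d * cartan j i"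
    "pairing ?l (coroot D (affine_simple_root D j)) = int c * cartan i j + 2 * int d"
    by (simp_all add: pairing_simps cartan_def pairing_coroot affine_simple_root_root)
  then have "?l \<noteq> 0" using assms by (metis pairing_zero_left)
  then show ?thesis
    using char_elt_regular[of ?l] by (simp add: affine_char_def char_elt_add char_elt_cmul_nat)
qed

lemma of_Waf_foldr: "foldr (\<lambda>j a. of_Waf (\<s> j) \<star> a) js v = of_Waf (wp js) \<star> v"
  by (induction js) (simp_all add: wp_Nil wp_Cons of_Waf_cancel kq_one_left flip: kq_one)

abbreviation "T_word \<equiv> foldr (\<lambda>j a. \<tau> j \<star> a)"

text \<open>
  The assumption on the Cartan integers puts the shorter root first, which leaves one case for each of the
  types \<open>A\<^sub>1 \<times> A\<^sub>1\<close>, \<open>A\<^sub>2\<close>, \<open>B\<^sub>2\<close> and \<open>G\<^sub>2\<close>.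
\<close>

lemma T_braid_oriented:
  assumes m: "braid_length i j m" and or: "cartan j i \<le> cartan i j"
  shows "T_word (alt m i j) v = T_word (alt m j i) v"
proof -
  let ?S = "\<lambda>k a. of_Waf (\<s> k) \<star> a"
  have ne: "i \<noteq> j" using m by (simp add: braid_length_def)
  note sy = QT_act_affine_char[OF ne] and tx = QT_act_affine_char[OF ne[symmetric]]
  interpret rank_two scale "QT_act (snd (\<s> i))" "?S i" "affine_char i" "QT_act (snd (\<s> j))" "?S j" "affine_char j"
    by (intro rank_two.intro demazure_locale)
  have braid: "foldr ?S (alt m i j) v = foldr ?S (alt m j i) v" for v
    unfolding of_Waf_foldr wp_braid[OF m] ..
  consider "m = 2" "cartan i j = 0" "cartan j i = 0" | "m = 3" "cartan i j = -1" "cartan j i = -1"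
    | "m = 4" "cartan i j = -1" "cartan j i = -2" | "m = 6" "cartan i j = -1" "cartan j i = -3"
    using m or braid_cartan[OF m] by auto
  then show ?thesis
  proof cases
    case 1
    then show ?thesis
      using braid_2[of v] braid sy tx by (simp add: demazure_eq numeral_eq_Suc)
  next
    case 2
    have "A2 scale (QT_act (snd (\<s> i))) (?S i) (affine_char i) (QT_act (snd (\<s> j))) (?S j) (affine_char j)"
      by unfold_locales (use 2 sy tx affine_char_comb_regular[of 1 1 j i] in \<open>simp_all add: roots mult.commute\<close>)
    from A2.braid_3[OF this, of v] show ?thesis
      using braid 2 by (simp add: demazure_eq numeral_eq_Suc)
  next
    case 3
    have "B2 scale (QT_act (snd (\<s> i))) (?S i) (affine_char i) (QT_act (snd (\<s> j))) (?S j) (affine_char j)"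
      by unfold_locales (use 3 sy tx affine_char_comb_regular[of 1 1 j i] affine_char_comb_regular[of 2 1 j i]
          in \<open>simp_all add: roots mult.commute\<close>)
    from B2.braid_4[OF this, of v] show ?thesis
      using braid 3 by (simp add: demazure_eq numeral_eq_Suc)
  next
    case 4
    have "G2 scale (QT_act (snd (\<s> i))) (?S i) (affine_char i) (QT_act (snd (\<s> j))) (?S j) (affine_char j)"
      by unfold_locales (use 4 sy tx affine_char_comb_regular[of 1 1 j i] affine_char_comb_regular[of 2 1 j i]
          affine_char_comb_regular[of 3 1 j i] affine_char_comb_regular[of 3 2 j i]
          in \<open>simp_all add: roots mult.commute\<close>)
    from G2.braid_6[OF this, of v] show ?thesis
      using braid 4 by (simp add: demazure_eq numeral_eq_Suc)
  qed
qed

lemma braid_length_commute: "braid_length i j m \<Longrightarrow> braid_length j i m"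
  by (auto simp: braid_length_def mult.commute)

lemma T_braid: "braid_length i j m \<Longrightarrow> T_word (alt m i j) v = T_word (alt m j i) v"
  using T_braid_oriented[of i j m v] T_braid_oriented[of j i m v] braid_length_commute[of i j m]
  by (cases "cartan j i \<le> cartan i j") auto

lemma T_elt_word: "reduced_word D x js \<Longrightarrow> T_elt D x = T_word js \<o>"
  unfolding T_elt_def
  by (rule foldr_reduced_word_unique[OF T_braid, of x]) (auto intro: someI)

lemma T_word_carrier: "a \<in> \<K> \<Longrightarrow> T_word js a \<in> \<K>"
  by (induction js) (simp_all add: KQ_mult)

lemma T_elt_carrier: "x \<in> \<W> \<Longrightarrow> T_elt D x \<in> \<K>"
  by (erule reduced_word_ex) (simp add: T_elt_word T_word_carrier)

lemma T_elt_one: "T_elt D \<e> = \<o>"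
proof -
  have "\<l> \<e> = 0" using len_le[of "[]"] by (simp add: wp_Nil)
  then have "reduced_word D \<e> []" by (simp add: reduced_word_def wp_Nil)
  then show ?thesis by (simp add: T_elt_word)
qed

lemma T_elt_ascent:
  assumes x: "x \<in> \<W>" and nd: "\<not> left_descent j x"
  shows "\<tau> j \<star> T_elt D x = T_elt D (\<s> j \<cdot> x)"
proof -
  obtain js where js: "reduced_word D x js" using x by (rule reduced_word_ex)
  show ?thesis using T_elt_word[OF js] T_elt_word[OF reduced_word_ConsI[OF x nd js]] by simp
qed

lemma T_elt_descent:
  assumes x: "x \<in> \<W>" and d: "left_descent j x"
  shows "\<tau> j \<star> T_elt D x = - T_elt D x"
proof -
  have "\<tau> j \<star> T_elt D (\<s> j \<cdot> x) = T_elt D x"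
    using T_elt_ascent[of "\<s> j \<cdot> x" j] left_descent_simple_mult[OF x] x d by simp
  then show ?thesis using T_gen_square[of j "T_elt D (\<s> j \<cdot> x)"] by simp
qed

abbreviation "y_word \<equiv> foldr (\<lambda>j a. y_gen D j \<star> a)"

text \<open>Expanding \<open>y\<^sub>j = 1 + T\<^sub>j\<close> along a reduced word sweeps out the Bruhat interval.\<close>

lemma y_word_eq_sum:
  "reduced_word D x js \<Longrightarrow> y_word js \<o> = (\<Sum>v | bruhat_le D v x. T_elt D v)"
proof (induction js arbitrary: x)
  case Nil
  then have x: "x = \<e>" "\<l> x = 0" by (simp_all add: reduced_word_def wp_Nil)
  have "bruhat_le D v x \<longleftrightarrow> v = x" for v
    using bruhat_len[of v x] x(2) bruhat_refl[of x] by fastforce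
  then show ?case by (simp add: T_elt_one x)
next
  case (Cons j js)
  note c = reduced_word_Cons[OF Cons.prems]
  define x' where "x' = \<s> j \<cdot> x"
  have x': "x' \<in> \<W>" "\<not> left_descent j x'" "x = \<s> j \<cdot> x'"
    using c left_descent_simple_mult[OF c(3), of j] by (simp_all add: x'_def)
  let ?I = "{v. bruhat_le D v x'}"
  let ?A = "{v. bruhat_le D v x' \<and> \<not> left_descent j v}"
  note step = bruhat_interval_step[OF x'(1,2)]
  have fin: "finite ?I" by (rule finite_bruhat_interval[OF x'(1)])
  then have finA: "finite ?A" by (rule rev_finite_subset) blast
  have IW: "v \<in> \<W>" if "v \<in> ?I" for v using that bruhat_carrier x'(1) by blast
  have "y_word (j # js) \<o> = (\<Sum>v\<in>?I. T_elt D v + \<tau> j \<star> T_elt D v)"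
    using Cons.IH[OF c(1), folded x'_def] by (simp add: y_gen_mult kq_sum_right sum.distrib)
  also have "\<dots> = (\<Sum>v\<in>?A. T_elt D v + \<tau> j \<star> T_elt D v)"
    using fin IW T_elt_descent by (intro sum.mono_neutral_right) auto
  also have "\<dots> = (\<Sum>v\<in>?A. T_elt D v) + (\<Sum>v\<in>?A. T_elt D (\<s> j \<cdot> v))"
    unfolding sum.distrib using IW T_elt_ascent by (intro arg_cong2[of _ _ _ _ "(+)"] sum.cong) auto
  also have "(\<Sum>v\<in>?A. T_elt D (\<s> j \<cdot> v)) = (\<Sum>v\<in>(\<lambda>v. \<s> j \<cdot> v) ` ?A. T_elt D v)"
    by (simp add: sum.reindex[OF step(3)])
  also have "(\<Sum>v\<in>?A. T_elt D v) + \<dots> = (\<Sum>v | bruhat_le D v x. T_elt D v)"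
    unfolding x'(3) step(1) using finA step(2) by (intro sum.union_disjoint[symmetric]) auto
  finally show ?case .
qed

lemma y_elt_word: "reduced_word D x js \<Longrightarrow> y_elt D x = y_word js \<o>"
proof -
  assume js: "reduced_word D x js"
  then have "reduced_word D x (SOME js. reduced_word D x js)" by (rule someI)
  then show ?thesis unfolding y_elt_def using js by (simp add: y_word_eq_sum)
qed

lemma y_elt_eq_sum: "x \<in> \<W> \<Longrightarrow> y_elt D x = (\<Sum>v | bruhat_le D v x. T_elt D v)"
  by (erule reduced_word_ex) (simp add: y_elt_word y_word_eq_sum)

lemma y_gen_carrier [simp]: "y_gen D j \<in> \<K>"
  by (simp add: y_gen_def KQ_add)

lemma y_elt_carrier: "x \<in> \<W> \<Longrightarrow> y_elt D x \<in> \<K>"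
  unfolding y_elt_eq_sum by (intro KQ_sum T_elt_carrier) (use bruhat_carrier in blast)

lemma y_elt_one: "y_elt D \<e> = \<o>"
proof -
  have "\<l> \<e> = 0" using len_le[of "[]"] by (simp add: wp_Nil)
  then have "reduced_word D \<e> []" by (simp add: reduced_word_def wp_Nil)
  then show ?thesis by (simp add: y_elt_word)
qed

lemma y_elt_ascent:
  assumes x: "x \<in> \<W>" and nd: "\<not> left_descent j x"
  shows "y_gen D j \<star> y_elt D x = y_elt D (\<s> j \<cdot> x)"
proof -
  obtain js where js: "reduced_word D x js" using x by (rule reduced_word_ex)
  show ?thesis using y_elt_word[OF js] y_elt_word[OF reduced_word_ConsI[OF x nd js]] by simp
qed

lemma y_gen_square: "y_gen D j \<star> (y_gen D j \<star> a) = y_gen D j \<star> a"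
  by (simp add: y_gen_mult kq_add_right T_gen_square)

lemma y_elt_descent:
  assumes x: "x \<in> \<W>" and d: "left_descent j x"
  shows "y_gen D j \<star> y_elt D x = y_elt D x"
proof -
  have "y_gen D j \<star> y_elt D (\<s> j \<cdot> x) = y_elt D x"
    using y_elt_ascent[of "\<s> j \<cdot> x" j] left_descent_simple_mult[OF x] x d by simp
  then show ?thesis using y_gen_square[of j "y_elt D (\<s> j \<cdot> x)"] by simp
qed

lemma T_elt_right:
  assumes "reduced_word D x (js @ [j])" "reduced_word D x' js"
  shows "T_elt D x = T_elt D x' \<star> \<tau> j"
proof -
  have "T_word js (\<tau> j) = T_word js \<o> \<star> \<tau> j"
    by (induction js) (simp_all add: kq_one_left kq_assoc T_word_carrier)
  then show ?thesis using assms by (simp add: T_elt_word kq_one_right)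
qed

lemma y_elt_right:
  assumes "reduced_word D x (js @ [j])" "reduced_word D x' js"
  shows "y_elt D x = y_elt D x' \<star> y_gen D j"
proof -
  have car: "y_word js \<o> \<in> \<K>" for js by (induction js) (simp_all add: KQ_mult)
  have "y_word js (y_gen D j) = y_word js \<o> \<star> y_gen D j"
    by (induction js) (simp_all add: kq_one_left kq_assoc car)
  then show ?thesis using assms by (simp add: y_elt_word kq_one_right)
qed

subsection \<open>Triangularity\<close>

text \<open>
  Both families have the shape \<open>c x + (terms of smaller length)\<close> with \<open>c \<noteq> 0\<close>. This alone makes them
  bases of the twisted group algebra.
\<close>

definition triangular :: "('i waf \<Rightarrow> 'i twisted) \<Rightarrow> bool" where
  "triangular B \<longleftrightarrow> (\<forall>x\<in>\<W>. keys (B x) \<subseteq> {u \<in> \<W>. u = x \<or> \<l> u < \<l> x} \<and> lookup (B x) x \<noteq> 0)"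

lemma triangular_step:
  assumes a: "keys a \<subseteq> {u \<in> \<W>. u = x \<or> \<l> u < \<l> x}" "lookup a x \<noteq> 0"
    and x: "x \<in> \<W>" and nd: "\<not> left_descent j x"
    and b: "b = scale f (of_Waf (\<s> j) \<star> a) + scale g a" "f \<noteq> 0"
  shows "keys b \<subseteq> {u \<in> \<W>. u = \<s> j \<cdot> x \<or> \<l> u < \<l> (\<s> j \<cdot> x)} \<and> lookup b (\<s> j \<cdot> x) \<noteq> 0"
proof -
  have aK: "a \<in> \<K>" using a(1) by (auto simp: carrier_KQ)
  have lk: "lookup (of_Waf (\<s> j) \<star> a) u = QT_act (snd (\<s> j)) (lookup a (\<s> j \<cdot> u))"
    if u: "u \<in> \<W>" for u
    using aK
  proof (induction a rule: KQ_induct)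
    case (single v f)
    have "\<s> j \<cdot> v = u \<longleftrightarrow> v = \<s> j \<cdot> u" using single u by auto
    then show ?case
      using single u by (simp add: of_Waf_def kq_single lookup_single when_def QT_act_zero[OF snd_simple_weyl])
  next
    case (add a b)
    then show ?case by (simp add: kq_add_right lookup_add QT_act_add[OF snd_simple_weyl])
  qed
  have bK: "b \<in> \<K>" unfolding b using aK by (simp add: KQ_add KQ_scale KQ_mult)
  have lb: "lookup b u = f * QT_act (snd (\<s> j)) (lookup a (\<s> j \<cdot> u)) + g * lookup a u"
    if "u \<in> \<W>" for u
    unfolding b by (simp add: lookup_add lookup_scale lk[OF that])
  have lsx: "\<l> (\<s> j \<cdot> x) = \<l> x + 1" using len_simple_mult[OF x, of j] nd by simp
  have sup: "u = \<s> j \<cdot> x \<or> \<l> u < \<l> (\<s> j \<cdot> x)" if uk: "u \<in> keys b" for u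
  proof -
    have u: "u \<in> \<W>" using uk bK by (auto simp: carrier_KQ)
    have "lookup a (\<s> j \<cdot> u) \<noteq> 0 \<or> lookup a u \<noteq> 0"
      using uk lb[OF u] by (auto simp: in_keys_iff QT_act_zero[OF snd_simple_weyl])
    then consider "\<s> j \<cdot> u = x" | "\<l> (\<s> j \<cdot> u) < \<l> x" | "u = x" | "\<l> u < \<l> x"
      using a(1) by (auto simp: in_keys_iff)
    then show ?thesis
    proof cases
      case 1
      then have "u = \<s> j \<cdot> x" using u by (metis simple_cancel)
      then show ?thesis ..
    next
      case 2
      then show ?thesis using len_simple_mult(1)[of "\<s> j \<cdot> u" j] u lsx by (auto split: if_splits)
    qed (use lsx in auto)
  qed
  have "\<s> j \<cdot> x \<noteq> x" using lsx by (metis add_cancel_right_right zero_neq_one)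
  moreover have "\<not> \<l> (\<s> j \<cdot> x) < \<l> x" using lsx by simp
  ultimately have "lookup a (\<s> j \<cdot> x) = 0" using a(1) by (auto simp: in_keys_iff)
  then have "lookup b (\<s> j \<cdot> x) = f * QT_act (snd (\<s> j)) (lookup a x)"
    using x by (simp add: lb)
  moreover have "QT_act (snd (\<s> j)) (lookup a x) \<noteq> 0"
  proof
    assume "QT_act (snd (\<s> j)) (lookup a x) = 0"
    then have "QT_act (snd (\<s> j)) (lookup a x * inverse (lookup a x)) = 0"
      by (simp add: QT_act_mult[OF snd_simple_weyl])
    then show False using a(2) by (simp add: QT_act_one[OF snd_simple_weyl])
  qed
  ultimately show ?thesis using sup bK b(2) by (auto simp: carrier_KQ)
qed

lemma triangular_T_elt: "triangular (T_elt D)"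
  unfolding triangular_def
proof
  fix x assume "x \<in> \<W>"
  then show "keys (T_elt D x) \<subseteq> {u \<in> \<W>. u = x \<or> \<l> u < \<l> x} \<and> lookup (T_elt D x) x \<noteq> 0"
  proof (induction x rule: left_descent_induct)
    case one
    then show ?case by (simp add: T_elt_one kq_one of_Waf_def)
  next
    case (step j x)
    have "T_elt D (\<s> j \<cdot> x) = scale (inverse (1 - affine_char j)) (of_Waf (\<s> j) \<star> T_elt D x)
        + scale (- inverse (1 - affine_char j)) (T_elt D x)"
      unfolding T_elt_ascent[OF step(1,2), symmetric] T_gen_mult by (simp add: scale.scale_right_diff_distrib)
    then show ?case
      using step affine_char_regular[of j]
      by (intro triangular_step[of "T_elt D x" x j _ "inverse (1 - affine_char j)" "- inverse (1 - affine_char j)"]) auto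
  qed
qed

lemma triangular_y_elt: "triangular (y_elt D)"
  unfolding triangular_def
proof
  fix x assume "x \<in> \<W>"
  then show "keys (y_elt D x) \<subseteq> {u \<in> \<W>. u = x \<or> \<l> u < \<l> x} \<and> lookup (y_elt D x) x \<noteq> 0"
  proof (induction x rule: left_descent_induct)
    case one
    then show ?case by (simp add: y_elt_one kq_one of_Waf_def)
  next
    case (step j x)
    have "y_elt D (\<s> j \<cdot> x) = scale (inverse (1 - affine_char j)) (of_Waf (\<s> j) \<star> y_elt D x)
        + scale (1 - inverse (1 - affine_char j)) (y_elt D x)"
      unfolding y_elt_ascent[OF step(1,2), symmetric] y_gen_mult T_gen_mult
      by (simp add: scale.scale_right_diff_distrib scale.scale_left_diff_distrib)
    then show ?case
      using step affine_char_regular[of j]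
      by (intro triangular_step[of "y_elt D x" x j _ "inverse (1 - affine_char j)" "1 - inverse (1 - affine_char j)"]) auto
  qed
qed

subsection \<open>Linear combinations\<close>

definition lincomb :: "('x \<Rightarrow> 'i twisted) \<Rightarrow> ('x \<Rightarrow>\<^sub>0 'i QT) \<Rightarrow> 'i twisted" where
  "lincomb B c = (\<Sum>x\<in>keys c. scale (lookup c x) (B x))"

lemma lincomb_sup: "finite A \<Longrightarrow> keys c \<subseteq> A \<Longrightarrow> lincomb B c = (\<Sum>x\<in>A. scale (lookup c x) (B x))"
  unfolding lincomb_def by (intro sum.mono_neutral_left) (auto simp: in_keys_iff)

lemma lincomb_add: "lincomb B (c + d) = lincomb B c + lincomb B d"
proof -
  let ?A = "keys c \<union> keys d"
  have "lincomb B (c + d) = (\<Sum>x\<in>?A. scale (lookup (c + d) x) (B x))"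
    using keys_add[of c d] by (intro lincomb_sup) auto
  then show ?thesis
    by (simp add: lookup_add scale.scale_left_distrib sum.distrib
        lincomb_sup[of ?A c] lincomb_sup[of ?A d])
qed

lemma lincomb_single: "lincomb B (Poly_Mapping.single x f) = scale f (B x)"
  by (subst lincomb_sup[of "{x}"]) auto

lemma lincomb_zero: "lincomb B 0 = 0"
  by (simp add: lincomb_def)

lemma lincomb_sum: "lincomb B (sum f A) = (\<Sum>i\<in>A. lincomb B (f i))"
  by (induction A rule: infinite_finite_induct) (simp_all add: lincomb_zero lincomb_add)

lemma lincomb_uminus: "lincomb B (- c) = - lincomb B c"
  using lincomb_add[of B c "- c"] by (simp add: lincomb_zero eq_neg_iff_add_eq_0 add.commute)

lemma lincomb_diff: "lincomb B (c - d) = lincomb B c - lincomb B d"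
  using lincomb_add[of B c "- d"] by (simp add: lincomb_uminus)

lemma lincomb_scale: "lincomb B (scale p c) = scale p (lincomb B c)"
  by (subst lincomb_sup[OF finite_keys keys_scale])
    (simp add: lincomb_def lookup_scale scale.scale_sum_right)

text \<open>
  Evaluate the combination at the position of an index with maximal \<open>h\<close> among those that occur: a single
  term survives.
\<close>

lemma triangular_independent:
  fixes h :: "'x \<Rightarrow> nat"
  assumes sum: "lincomb B c = 0"
    and outside: "\<And>x. x \<in> keys c \<Longrightarrow> x \<notin> I \<Longrightarrow> B x = 0"
    and diag: "\<And>x. x \<in> I \<Longrightarrow> lookup (B x) (k x) \<noteq> 0"
    and tri: "\<And>x y. x \<in> I \<Longrightarrow> y \<in> I \<Longrightarrow> lookup (B x) (k y) \<noteq> 0 \<Longrightarrow> y = x \<or> h y < h x"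
    and x: "x \<in> I"
  shows "lookup c x = 0"
proof (rule ccontr)
  assume "lookup c x \<noteq> 0"
  then have ne: "keys c \<inter> I \<noteq> {}" using x by (auto simp: in_keys_iff)
  define M where "M = Max (h ` (keys c \<inter> I))"
  have "M \<in> h ` (keys c \<inter> I)" unfolding M_def using ne by (intro Max_in) auto
  then obtain z where z: "z \<in> keys c" "z \<in> I" "h z = M" by blast
  have le: "h y \<le> M" if "y \<in> keys c" "y \<in> I" for y
    unfolding M_def using that by (intro Max_ge) auto
  have "0 = (\<Sum>y\<in>keys c. lookup c y * lookup (B y) (k z))"
    using arg_cong[OF sum, of "\<lambda>a. lookup a (k z)"]
    by (simp add: lincomb_def lookup_sum lookup_scale)
  also have "\<dots> = lookup c z * lookup (B z) (k z)"
  proof (rule sum.remove[OF finite_keys z(1), THEN trans], rule trans[OF arg_cong2[where f = "(+)", OF refl]])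
    show "(\<Sum>y\<in>keys c - {z}. lookup c y * lookup (B y) (k z)) = 0"
    proof (rule sum.neutral, rule ballI)
      fix y assume y: "y \<in> keys c - {z}"
      show "lookup c y * lookup (B y) (k z) = 0"
      proof (cases "y \<in> I")
        case True
        then show ?thesis using tri[OF True z(2)] le[of y] y z(3) by force
      qed (use outside y in simp)
    qed
  qed simp
  finally show False using diag[OF z(2)] z(1) by (simp add: in_keys_iff)
qed

lemma triangularD:
  assumes "triangular B" "x \<in> \<W>"
  shows "lookup (B x) x \<noteq> 0" "lookup (B x) u \<noteq> 0 \<Longrightarrow> u \<in> \<W> \<and> (u = x \<or> \<l> u < \<l> x)"
proof -
  have t: "keys (B x) \<subseteq> {u \<in> \<W>. u = x \<or> \<l> u < \<l> x}" "lookup (B x) x \<noteq> 0"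
    using assms unfolding triangular_def by blast+
  show "lookup (B x) x \<noteq> 0" by (rule t(2))
  assume "lookup (B x) u \<noteq> 0"
  then have "u \<in> keys (B x)" by (simp add: in_keys_iff)
  then show "u \<in> \<W> \<and> (u = x \<or> \<l> u < \<l> x)" using t(1) by blast
qed

lemma triangular_unique:
  assumes B: "triangular B" and "keys c \<subseteq> \<W>" "keys d \<subseteq> \<W>" "lincomb B c = lincomb B d"
  shows "c = d"
proof (rule poly_mapping_eqI)
  fix u
  have k: "keys (c - d) \<subseteq> \<W>" using keys_diff[of c d] assms by blast
  have "lookup (c - d) u = 0"
  proof (cases "u \<in> \<W>")
    case True
    show ?thesis
    proof (rule triangular_independent[where B = B and I = \<W> and k = id and h = \<l>])
      show "lincomb B (c - d) = 0" using assms by (simp add: lincomb_diff)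
      show "x \<in> keys (c - d) \<Longrightarrow> x \<notin> \<W> \<Longrightarrow> B x = 0" for x using k by blast
      show "x \<in> \<W> \<Longrightarrow> lookup (B x) (id x) \<noteq> 0" for x using triangularD(1)[OF B] by simp
      show "x \<in> \<W> \<Longrightarrow> y \<in> \<W> \<Longrightarrow> lookup (B x) (id y) \<noteq> 0 \<Longrightarrow> y = x \<or> \<l> y < \<l> x" for x y
        using triangularD(2)[OF B, of x y] by simp
    qed (rule True)
  qed (use k in \<open>auto simp: in_keys_iff\<close>)
  then show "lookup c u = lookup d u" by (simp add: lookup_minus)
qed

text \<open>
  Solve for the leading term, by induction on the length.
\<close>

lemma triangular_spans:
  assumes B: "triangular B" and w: "w \<in> \<W>"
  shows "\<exists>c. keys c \<subseteq> \<W> \<and> of_Waf w = lincomb B c"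
  using w
proof (induction "\<l> w" arbitrary: w rule: less_induct)
  case less
  note w = less.prems
  let ?b = "lookup (B w)"
  let ?K = "keys (B w) - {w}"
  have "\<exists>c. keys c \<subseteq> \<W> \<and> of_Waf u = lincomb B c" if u: "u \<in> ?K" for u
  proof -
    have "lookup (B w) u \<noteq> 0" "u \<noteq> w" using u by (simp_all add: in_keys_iff)
    then have "u \<in> \<W>" "\<l> u < \<l> w" using triangularD(2)[OF B w, of u] by blast+
    then show ?thesis by (intro less.hyps)
  qed
  then obtain C where C: "\<And>u. u \<in> ?K \<Longrightarrow> keys (C u) \<subseteq> \<W> \<and> of_Waf u = lincomb B (C u)"
    by metis
  have bw: "?b w \<noteq> 0" using triangularD(1)[OF B w] .
  have "B w = (\<Sum>u\<in>keys (B w). scale (?b u) (of_Waf u))"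
    using sum_single[of "B w"] by (simp add: sgl_eq)
  also have "\<dots> = scale (?b w) (of_Waf w) + (\<Sum>u\<in>?K. scale (?b u) (of_Waf u))"
    using bw by (intro sum.remove) (auto simp: in_keys_iff)
  also have "(\<Sum>u\<in>?K. scale (?b u) (of_Waf u)) = lincomb B (\<Sum>u\<in>?K. scale (?b u) (C u))"
    using C by (simp add: lincomb_sum lincomb_scale)
  finally have "scale (?b w) (of_Waf w) = B w - lincomb B (\<Sum>u\<in>?K. scale (?b u) (C u))"
    by (rule eq_diff_eq[THEN iffD2, OF sym])
  also have "\<dots> = lincomb B (sgl w 1 - (\<Sum>u\<in>?K. scale (?b u) (C u)))"
    by (simp add: lincomb_diff lincomb_single)
  finally have e: "scale (?b w) (of_Waf w) = lincomb B (sgl w 1 - (\<Sum>u\<in>?K. scale (?b u) (C u)))" .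
  have "of_Waf w = lincomb B (scale (inverse (?b w)) (sgl w 1 - (\<Sum>u\<in>?K. scale (?b u) (C u))))"
    unfolding lincomb_scale e[symmetric] using bw by simp
  moreover have "scale (inverse (?b w)) (sgl w 1 - (\<Sum>u\<in>?K. scale (?b u) (C u))) \<in> \<K>"
    using C w by (intro KQ_scale KQ_diff KQ_sum KQ_single) (simp_all add: carrier_KQ)
  ultimately show ?case unfolding carrier_KQ by blast
qed

lemma e_coeffs:
  assumes w: "w \<in> \<W>"
  shows "keys (e_coeffs D w) \<subseteq> \<W>" "of_Waf w = lincomb (y_elt D) (e_coeffs D w)"
proof -
  obtain c where c: "keys c \<subseteq> \<W>" "of_Waf w = lincomb (y_elt D) c"
    using triangular_spans[OF triangular_y_elt w] by blast
  have "e_coeffs D w = c"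
    unfolding e_coeffs_def
  proof (rule the_equality)
    fix e assume e: "keys e \<subseteq> \<W> \<and>
      of_Waf w = (\<Sum>u\<in>keys e. scale (lookup e u) (y_elt D u))"
    then have k: "keys e \<subseteq> \<W>" and "of_Waf w = lincomb (y_elt D) e"
      unfolding lincomb_def by blast+
    then have "lincomb (y_elt D) e = lincomb (y_elt D) c" by (simp only: c(2)[symmetric])
    then show "e = c" by (rule triangular_unique[OF triangular_y_elt k c(1)])
  next
    show "keys c \<subseteq> \<W> \<and> of_Waf w = (\<Sum>u\<in>keys c. scale (lookup c u) (y_elt D u))"
      using c unfolding lincomb_def by blast
  qed
  then show "keys (e_coeffs D w) \<subseteq> \<W>" "of_Waf w = lincomb (y_elt D) (e_coeffs D w)"
    using c by simp_all
qed

subsection \<open>Integrality in the nil-Hecke ring\<close>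

definition qt_coeffs :: "('x \<Rightarrow>\<^sub>0 'i RT) \<Rightarrow> ('x \<Rightarrow>\<^sub>0 'i QT)" where
  "qt_coeffs c = Poly_Mapping.map RT_to_QT c"

lemma lookup_qt_coeffs: "lookup (qt_coeffs c) x = RT_to_QT (lookup c x)"
  by (simp add: qt_coeffs_def Poly_Mapping.map.rep_eq when_def RT_to_QT_zero)

lemma keys_qt_coeffs: "keys (qt_coeffs c) = keys c"
proof (rule Set.set_eqI)
  fix x
  have "RT_to_QT (lookup c x) = 0 \<longleftrightarrow> lookup c x = 0"
    unfolding RT_to_QT_zero[symmetric] by (rule RT_to_QT_eq_iff)
  then show "x \<in> keys (qt_coeffs c) \<longleftrightarrow> x \<in> keys c"
    by (simp only: in_keys_iff lookup_qt_coeffs)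
qed

lemma qt_coeffs_add: "qt_coeffs (c + d) = qt_coeffs c + qt_coeffs d"
  by (rule poly_mapping_eqI) (simp add: lookup_qt_coeffs lookup_add RT_to_QT_add)

lemma qt_coeffs_diff: "qt_coeffs (c - d) = qt_coeffs c - qt_coeffs d"
  by (rule poly_mapping_eqI) (simp add: lookup_qt_coeffs lookup_minus RT_to_QT_diff)

lemma qt_coeffs_zero: "qt_coeffs 0 = 0"
  by (rule poly_mapping_eqI) (simp add: lookup_qt_coeffs RT_to_QT_zero)

lemma qt_coeffs_sum: "qt_coeffs (sum f A) = (\<Sum>i\<in>A. qt_coeffs (f i))"
  by (induction A rule: infinite_finite_induct) (simp_all add: qt_coeffs_zero qt_coeffs_add)

lemma qt_coeffs_single: "qt_coeffs (Poly_Mapping.single x p) = Poly_Mapping.single x (RT_to_QT p)"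
  by (rule poly_mapping_eqI) (simp add: lookup_qt_coeffs lookup_single when_def RT_to_QT_zero)

lemma lincomb_qt_coeffs:
  "lincomb B (qt_coeffs c) = (\<Sum>x\<in>keys c. scale (RT_to_QT (lookup c x)) (B x))"
  by (simp add: lincomb_def keys_qt_coeffs lookup_qt_coeffs)

definition integral_span :: "('i waf \<Rightarrow> 'i twisted) \<Rightarrow> 'i twisted set" where
  "integral_span B = {lincomb B (qt_coeffs c) | c. keys c \<subseteq> \<W>}"

lemma integral_span_add:
  assumes "a \<in> integral_span B" "b \<in> integral_span B"
  shows "a + b \<in> integral_span B"
proof -
  obtain c d where "a = lincomb B (qt_coeffs c)" "b = lincomb B (qt_coeffs d)"
    and k: "keys c \<subseteq> \<W>" "keys d \<subseteq> \<W>"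
    using assms unfolding integral_span_def by blast
  then have "a + b = lincomb B (qt_coeffs (c + d))" by (simp add: qt_coeffs_add lincomb_add)
  moreover have "keys (c + d) \<subseteq> \<W>" using keys_add[of c d] k by blast
  ultimately show ?thesis unfolding integral_span_def by blast
qed

lemma integral_span_zero: "0 \<in> integral_span B"
  unfolding integral_span_def by (intro CollectI exI[of _ 0]) (simp add: qt_coeffs_zero lincomb_zero)

lemma integral_span_sum: "(\<And>i. i \<in> A \<Longrightarrow> f i \<in> integral_span B) \<Longrightarrow> sum f A \<in> integral_span B"
  by (induction A rule: infinite_finite_induct) (auto intro: integral_span_add integral_span_zero)

lemma integral_span_term: "x \<in> \<W> \<Longrightarrow> scale (RT_to_QT p) (B x) \<in> integral_span B"
  unfolding integral_span_def
  by (intro CollectI exI[of _ "Poly_Mapping.single x p"]) (simp add: qt_coeffs_single lincomb_single)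

lemma integral_span_scale:
  assumes "a \<in> integral_span B"
  shows "scale (RT_to_QT p) a \<in> integral_span B"
proof -
  obtain c where a: "a = lincomb B (qt_coeffs c)" "keys c \<subseteq> \<W>"
    using assms unfolding integral_span_def by blast
  show ?thesis
    unfolding a(1) lincomb_qt_coeffs scale.scale_sum_right scale.scale_scale RT_to_QT_mult[symmetric]
    using a(2) by (intro integral_span_sum integral_span_term) blast
qed

lemma integral_span_uminus: "a \<in> integral_span B \<Longrightarrow> - a \<in> integral_span B"
  using integral_span_scale[of a B "- 1"] by (simp add: RT_to_QT_uminus RT_to_QT_one)

text \<open>
  For \<open>p = e\<^sup>l\<close> the quotient is a geometric sum in \<open>e\<^sup>\<alpha>\<close>. Because of this, moving a scalar of \<open>R(T)\<close> past a
  \<open>T\<^sub>j\<close> creates no denominators.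
\<close>

lemma RT_act_divisible: "1 - frag_of a dvd RT_act (reflection D a) p - p"
proof -
  have pow: "frag_of (frag_cmul (int n) a) = frag_of a ^ n" for n
  proof (induction n)
    case (Suc n)
    have "frag_of (a + frag_cmul (int n) a) = frag_of a * frag_of (frag_cmul (int n) a)" by (simp add: mult_single)
    then show ?case using Suc by (simp add: frag_cmul_distrib)
  qed simp
  have one: "1 - frag_of a dvd frag_of (frag_cmul (int n) a) - 1" for n
  proof -
    have "1 - frag_of a dvd 1 - frag_of a ^ n" unfolding one_diff_power_eq by simp
    moreover have "frag_of a ^ n - 1 = - (1 - frag_of a ^ n)" by simp
    ultimately show ?thesis unfolding pow by (simp only: dvd_minus_iff)
  qed
  have "keys p \<subseteq> UNIV" by simp
  then show ?thesis
  proof (induction p rule: frag_induction)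
    case (one l)
    let ?n = "pairing l (coroot D a)"
    show ?case
    proof (cases "?n \<le> 0")
      case True
      then have e: "reflection D a l = frag_cmul (int (nat (- ?n))) a + l" by (simp add: reflection_def)
      have "RT_act (reflection D a) (frag_of l) - frag_of l = (frag_of (frag_cmul (int (nat (- ?n))) a) - 1) * frag_of l"
        unfolding RT_act_frag_of e by (simp add: left_diff_distrib mult_single)
      then show ?thesis using \<open>\<And>n. 1 - frag_of a dvd frag_of (frag_cmul (int n) a) - 1\<close> by (metis dvd_mult2)
    next
      case False
      then have e: "l = frag_cmul (int (nat ?n)) a + reflection D a l" by (simp add: reflection_def)
      have "frag_of l - RT_act (reflection D a) (frag_of l)
          = (frag_of (frag_cmul (int (nat ?n)) a) - 1) * frag_of (reflection D a l)"
        unfolding RT_act_frag_of by (subst e) (simp add: left_diff_distrib mult_single)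
      then have "1 - frag_of a dvd frag_of l - RT_act (reflection D a) (frag_of l)"
        using \<open>\<And>n. 1 - frag_of a dvd frag_of (frag_cmul (int n) a) - 1\<close> by (metis dvd_mult2)
      moreover have "RT_act (reflection D a) (frag_of l) - frag_of l
          = - (frag_of l - RT_act (reflection D a) (frag_of l))" by simp
      ultimately show ?thesis by (simp only: dvd_minus_iff)
    qed
  next
    case (diff p q)
    then have "1 - frag_of a dvd (RT_act (reflection D a) p - p) - (RT_act (reflection D a) q - q)" by (rule dvd_diff)
    then show ?case by (simp add: RT_act_def frag_extend_diff algebra_simps)
  qed (simp add: RT_act_zero)
qed

lemma affine_char_RT: "1 - affine_char j = RT_to_QT (1 - frag_of (affine_simple_root D j))"
  by (simp add: affine_char_def char_elt_def RT_to_QT_diff RT_to_QT_one)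

lemma T_gen_scale:
  obtains q where "\<And>a. \<tau> j \<star> scale (RT_to_QT p) a = scale (RT_to_QT (RT_act (snd (\<s> j)) p)) (\<tau> j \<star> a) + scale (RT_to_QT q) a"
proof -
  let ?a = "affine_simple_root D j"
  obtain q where q: "RT_act (reflection D ?a) p - p = (1 - frag_of ?a) * q"
    using RT_act_divisible[of ?a p] by (elim dvdE)
  let ?g = "inverse (1 - affine_char j)" and ?P = "RT_to_QT p" and ?Q = "RT_to_QT (RT_act (reflection D ?a) p)"
  have "?Q - ?P = (1 - affine_char j) * RT_to_QT q"
    unfolding affine_char_RT using q by (simp flip: RT_to_QT_diff RT_to_QT_mult)
  then have g: "?g * (?Q - ?P) = RT_to_QT q" using affine_char_regular[of j] by simp
  have "\<tau> j \<star> scale ?P a = scale ?Q (\<tau> j \<star> a) + scale (RT_to_QT q) a" for a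
  proof -
    have "\<tau> j \<star> scale ?P a = scale ?g (scale ?Q (of_Waf (\<s> j) \<star> a - a) + scale (?Q - ?P) a)"
      using QT_act_RT[OF snd_simple_weyl[of j], of p]
      by (simp add: T_gen_mult of_Waf_scale scale.scale_right_diff_distrib scale.scale_left_diff_distrib
          snd_simple_reflection)
    also have "\<dots> = scale ?Q (\<tau> j \<star> a) + scale (?g * (?Q - ?P)) a"
      by (simp add: T_gen_mult scale.scale_right_distrib mult.commute)
    finally show ?thesis unfolding g .
  qed
  then show thesis by (intro that[of q]) (simp only: snd_simple_reflection)
qed

lemma of_RT_mult: "of_RT D p \<star> a = scale (RT_to_QT p) a"
  by (simp add: of_RT_def kq_scale_left kq_one_left)

lemma of_RT_carrier [simp]: "of_RT D p \<in> \<K>"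
  by (simp add: of_RT_def KQ_scale)

lemma nil_hecke_carrier: "a \<in> nil_hecke D \<Longrightarrow> a \<in> \<K>"
  unfolding nil_hecke_def
proof (induction a rule: generate_ring.induct)
  case (a_inv h)
  then show ?case by (simp add: kq_uminus KQ_uminus)
next
  case (eng_add a b)
  then show ?case by (simp add: kq_add KQ_add)
qed (auto simp: KQ_mult)

lemma nil_hecke_one: "\<o> \<in> nil_hecke D"
  and nil_hecke_T: "\<tau> j \<in> nil_hecke D"
  and nil_hecke_RT: "of_RT D p \<in> nil_hecke D"
  unfolding nil_hecke_def by (auto intro: generate_ring.intros)

lemma nil_hecke_add: "a \<in> nil_hecke D \<Longrightarrow> b \<in> nil_hecke D \<Longrightarrow> a + b \<in> nil_hecke D"
  using generate_ring.eng_add[of a "KQ D" _ b] unfolding nil_hecke_def by (simp add: kq_add)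

lemma nil_hecke_mult: "a \<in> nil_hecke D \<Longrightarrow> b \<in> nil_hecke D \<Longrightarrow> a \<star> b \<in> nil_hecke D"
  unfolding nil_hecke_def by (rule generate_ring.eng_mult)

lemma nil_hecke_scale: "a \<in> nil_hecke D \<Longrightarrow> scale (RT_to_QT p) a \<in> nil_hecke D"
  using nil_hecke_mult[OF nil_hecke_RT, of a p] by (simp add: of_RT_mult)

lemma nil_hecke_zero: "0 \<in> nil_hecke D"
  using nil_hecke_scale[OF nil_hecke_one, of 0] by (simp add: RT_to_QT_zero)

lemma nil_hecke_sum: "(\<And>i. i \<in> A \<Longrightarrow> f i \<in> nil_hecke D) \<Longrightarrow> sum f A \<in> nil_hecke D"
  by (induction A rule: infinite_finite_induct) (auto intro: nil_hecke_add nil_hecke_zero)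

text \<open>
  The \<open>R(T)\<close>-span of \<open>B\<close> contains \<open>1\<close> and is stable under left multiplication by the generators: moving
  a scalar of \<open>R(T)\<close> past \<open>T\<^sub>j\<close> costs only another scalar of \<open>R(T)\<close>. So it is stable under the whole ring.
\<close>

lemma nil_hecke_integral:
  assumes BK: "\<And>x. x \<in> \<W> \<Longrightarrow> B x \<in> \<K>" and one: "B \<e> = \<o>"
    and T: "\<And>j x. x \<in> \<W> \<Longrightarrow> \<tau> j \<star> B x \<in> integral_span B"
    and a: "a \<in> nil_hecke D"
  shows "a \<in> integral_span B"
proof -
  have Tspan: "\<tau> j \<star> b \<in> integral_span B" if b: "b \<in> integral_span B" for j b
  proof -
    obtain c where c: "b = lincomb B (qt_coeffs c)" "keys c \<subseteq> \<W>"
      using b unfolding integral_span_def by blast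
    have "\<tau> j \<star> scale (RT_to_QT p) (B x) \<in> integral_span B" if x: "x \<in> \<W>" for p x
    proof -
      obtain q where q: "\<And>a. \<tau> j \<star> scale (RT_to_QT p) a
          = scale (RT_to_QT (RT_act (snd (\<s> j)) p)) (\<tau> j \<star> a) + scale (RT_to_QT q) a"
        using T_gen_scale[of j p] by blast
      show ?thesis unfolding q by (intro integral_span_add integral_span_scale integral_span_term T x)
    qed
    then show ?thesis
      unfolding c(1) lincomb_qt_coeffs kq_sum_right[OF T_gen_carrier]
      using c(2) by (intro integral_span_sum) blast
  qed
  have gen: "h \<star> b \<in> integral_span B"
    if "h \<in> range (of_RT D) \<union> range \<tau>" "b \<in> integral_span B" for h b
    using that Tspan by (auto simp: of_RT_mult integral_span_scale)
  have "\<forall>b\<in>integral_span B. a \<star> b \<in> integral_span B"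
    using a[unfolded nil_hecke_def]
  proof (induction a rule: generate_ring.induct)
    case one
    then show ?case by (simp add: kq_one_left)
  next
    case (incl h)
    then show ?case using gen by blast
  next
    case (a_inv h)
    then have "h \<in> \<K>" using nil_hecke_carrier unfolding nil_hecke_def by blast
    then show ?case using a_inv by (simp add: kq_uminus kq_uminus_left integral_span_uminus)
  next
    case (eng_add a b)
    then have "a \<in> \<K>" "b \<in> \<K>" using nil_hecke_carrier unfolding nil_hecke_def by blast+
    then show ?case using eng_add by (simp add: kq_add kq_add_left integral_span_add)
  next
    case (eng_mult a b)
    then have "a \<in> \<K>" "b \<in> \<K>" using nil_hecke_carrier unfolding nil_hecke_def by blast+
    then show ?case using eng_mult by (simp add: kq_assoc)
  qed
  moreover have "\<o> \<in> integral_span B"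
    using integral_span_term[of \<e> 1 B] by (simp add: one RT_to_QT_one)
  ultimately have "a \<star> \<o> \<in> integral_span B" by blast
  then show ?thesis using nil_hecke_carrier[OF a] by (simp add: kq_one_right)
qed

lemma integral_span_base: "x \<in> \<W> \<Longrightarrow> B x \<in> integral_span B"
  using integral_span_term[of x 1 B] by (simp add: RT_to_QT_one)

lemma nil_hecke_T_span:
  assumes "a \<in> nil_hecke D"
  shows "a \<in> integral_span (T_elt D)"
proof (rule nil_hecke_integral[where B = "T_elt D", OF T_elt_carrier T_elt_one _ assms])
  fix j x assume x: "x \<in> \<W>"
  show "\<tau> j \<star> T_elt D x \<in> integral_span (T_elt D)"
    using x T_elt_ascent[OF x, of j] T_elt_descent[OF x, of j]
    by (cases "left_descent j x") (simp_all add: integral_span_base integral_span_uminus)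
qed

lemma nil_hecke_y_span:
  assumes "a \<in> nil_hecke D"
  shows "a \<in> integral_span (y_elt D)"
proof (rule nil_hecke_integral[where B = "y_elt D", OF y_elt_carrier y_elt_one _ assms])
  fix j x assume x: "x \<in> \<W>"
  have "\<tau> j \<star> y_elt D x = y_gen D j \<star> y_elt D x + - y_elt D x" by (simp add: y_gen_mult)
  moreover have "y_gen D j \<star> y_elt D x \<in> integral_span (y_elt D)"
    using x y_elt_ascent[OF x, of j] y_elt_descent[OF x, of j]
    by (cases "left_descent j x") (simp_all add: integral_span_base)
  ultimately show "\<tau> j \<star> y_elt D x \<in> integral_span (y_elt D)"
    using x by (simp only: integral_span_add integral_span_base integral_span_uminus)
qed

section \<open>The projection to the centralizer\<close>

definition translation_elts :: "'i waf set" where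
  "translation_elts = UNIV \<times> {id}"

lemma translations_carrier: "translation_elts \<subseteq> \<W>"
  by (auto simp: translation_elts_def carrier_Waf weyl.id)

text \<open>
  Sending each coset of the finite Weyl group to the translation in it identifies the quotient of the
  twisted group algebra by the right action of the finite Weyl group with the centralizer of \<open>R(T)\<close>.
\<close>

definition kappa :: "'i twisted \<Rightarrow> 'i twisted" where
  "kappa a = (\<Sum>v\<in>keys a. sgl (fst v, id) (lookup a v))"

lemma kappa_sup: "finite A \<Longrightarrow> keys a \<subseteq> A \<Longrightarrow> kappa a = (\<Sum>v\<in>A. sgl (fst v, id) (lookup a v))"
  unfolding kappa_def by (intro sum.mono_neutral_left) (auto simp: in_keys_iff)

lemma kappa_add: "kappa (a + b) = kappa a + kappa b"
proof -
  let ?A = "keys a \<union> keys b"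
  have "kappa (a + b) = (\<Sum>v\<in>?A. sgl (fst v, id) (lookup (a + b) v))"
    using keys_add[of a b] by (intro kappa_sup) auto
  then show ?thesis
    by (simp add: lookup_add single_add sum.distrib kappa_sup[of ?A a] kappa_sup[of ?A b])
qed

lemma kappa_sgl: "kappa (sgl v f) = sgl (fst v, id) f"
  by (subst kappa_sup[of "{v}"]) auto

lemma kappa_zero: "kappa 0 = 0"
  by (simp add: kappa_def)

lemma kappa_sum: "kappa (sum f A) = (\<Sum>i\<in>A. kappa (f i))"
  by (induction A rule: infinite_finite_induct) (simp_all add: kappa_zero kappa_add)

lemma kappa_uminus: "kappa (- a) = - kappa a"
  using kappa_add[of a "- a"] by (simp add: kappa_zero eq_neg_iff_add_eq_0 add.commute)

lemma kappa_diff: "kappa (a - b) = kappa a - kappa b"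
  using kappa_add[of a "- b"] by (simp add: kappa_uminus)

lemma kappa_scale: "kappa (scale p a) = scale p (kappa a)"
  by (rule additive_eqI[of "\<lambda>a. kappa (scale p a)" "\<lambda>a. scale p (kappa a)"])
    (simp_all add: kappa_add scale.scale_right_distrib kappa_sgl scale_single kappa_zero)

lemma kappa_lincomb: "kappa (lincomb B c) = lincomb (\<lambda>x. kappa (B x)) c"
  by (simp add: lincomb_def kappa_sum kappa_scale)

lemma keys_kappa: "keys (kappa a) \<subseteq> translation_elts"
proof -
  have "keys (kappa a) \<subseteq> (\<Union>v\<in>keys a. keys (sgl (fst v, id) (lookup a v)))"
    unfolding kappa_def by (rule keys_sum)
  also have "\<dots> \<subseteq> translation_elts" by (auto simp: translation_elts_def split: if_splits)
  finally show ?thesis .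
qed

lemma kappa_carrier [simp]: "kappa a \<in> \<K>"
  using keys_kappa[of a] translations_carrier by (auto simp: carrier_KQ)

lemma kappa_translations:
  assumes "keys a \<subseteq> translation_elts"
  shows "kappa a = a"
proof -
  have "kappa a = (\<Sum>v\<in>keys a. sgl v (lookup a v))"
    unfolding kappa_def using assms by (intro sum.cong) (auto simp: translation_elts_def)
  then show ?thesis by (simp add: sum_single)
qed

lemma kappa_kappa: "kappa (kappa a) = kappa a"
  by (intro kappa_translations keys_kappa)

lemma lookup_kappa:
  assumes "a \<in> \<K>"
  shows "lookup (kappa a) (m, id) = (\<Sum>w\<in>weyl D. lookup a (m, w))"
  using assms
proof (induction a rule: KQ_induct)
  case (single v f)
  obtain n u where v: "v = (n, u)" "u \<in> weyl D" using single by (cases v) (simp add: carrier_Waf)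
  show ?case
  proof (cases "n = m")
    case True
    have "(\<Sum>w\<in>weyl D. lookup (sgl v f) (m, w)) = (\<Sum>w\<in>weyl D. if u = w then f else 0)"
      by (intro sum.cong) (auto simp: v True lookup_single when_def)
    also have "\<dots> = f" using v(2) finite_weyl by simp
    finally show ?thesis by (simp only: v True kappa_sgl fst_conv lookup_single_eq)
  next
    case False
    then show ?thesis by (simp add: v kappa_sgl lookup_single)
  qed
next
  case (add a b)
  then show ?case by (simp add: kappa_add lookup_add sum.distrib)
qed

lemma translations_scale:
  assumes "keys a \<subseteq> translation_elts"
  shows "a \<star> scale p b = scale p (a \<star> b)"
proof -
  have car: "a \<in> \<K>" using assms translations_carrier by (auto simp: carrier_KQ)
  have 1: "sgl v f \<star> scale p b = scale p (sgl v f \<star> b)" if "v \<in> translation_elts" for v f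
  proof -
    have v: "v \<in> \<W>" "snd v = id" using that translations_carrier by (auto simp: translation_elts_def)
    then show ?thesis
      by (simp add: sgl_eq kq_scale_left of_Waf_scale QT_act_id mult.commute)
  qed
  let ?s = "\<lambda>v. sgl v (lookup a v)"
  have sm: "a \<star> c = (\<Sum>v\<in>keys a. ?s v \<star> c)" for c
    using kq_sum_left[of "keys a" ?s c] KQ_sum_single[OF car] by (simp add: sum_single)
  have "(\<Sum>v\<in>keys a. ?s v \<star> scale p b) = (\<Sum>v\<in>keys a. scale p (?s v \<star> b))"
    using assms by (intro sum.cong refl 1) blast
  then show ?thesis unfolding sm scale.scale_sum_right .
qed

lemma translations_mult:
  assumes "keys a \<subseteq> translation_elts" "keys b \<subseteq> translation_elts"
  shows "keys (a \<star> b) \<subseteq> translation_elts"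
proof -
  have car: "a \<in> \<K>" using assms translations_carrier by (auto simp: carrier_KQ)
  have "keys (a \<star> b) \<subseteq> (\<Union>v\<in>keys a. \<Union>w\<in>keys b.
      keys (term_mult v w (lookup a v) (lookup b w)))"
    unfolding kq_mult_sup[OF car finite_keys order_refl finite_keys order_refl]
    using keys_sum by (fastforce dest!: subsetD[OF keys_sum])
  also have "\<dots> \<subseteq> translation_elts"
    using assms by (fastforce simp: translation_elts_def term_mult_def mult_Waf split: if_splits)
  finally show ?thesis .
qed

text \<open>
  Comparing coefficients of \<open>v\<close> in \<open>a e\<^sup>l = e\<^sup>l a\<close> shows that the finite part of \<open>v\<close> fixes every weight
  \<open>l\<close>.
\<close>

lemma centralizer_translations:
  assumes a: "a \<in> \<K>" and comm: "\<And>p. a \<star> of_RT D p = of_RT D p \<star> a"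
  shows "keys a \<subseteq> translation_elts"
proof
  fix v assume v: "v \<in> keys a"
  have vW: "v \<in> \<W>" using v a by (auto simp: carrier_KQ)
  have sv: "snd v \<in> weyl D" using vW by (simp add: carrier_Waf)
  have lk: "lookup (a \<star> of_RT D p) v = lookup a v * QT_act (snd v) (RT_to_QT p)" for p
    using a
  proof (induction a rule: KQ_induct)
    case (single w f)
    then show ?case
      by (simp add: of_RT_def kq_one of_Waf_def scale_single kq_single lookup_single when_def)
  next
    case (add a b)
    then show ?case by (simp add: kq_add_left lookup_add distrib_right)
  qed
  have "snd v l = l" for l
  proof -
    have "lookup a v * QT_act (snd v) (char_elt l) = char_elt l * lookup a v"
      using arg_cong[OF comm[of "frag_of l"], of "\<lambda>a. lookup a v"]
      by (simp add: lk of_RT_mult lookup_scale char_elt_def)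
    then have "char_elt (snd v l) = char_elt l" using v by (simp add: QT_act_char[OF sv] in_keys_iff)
    then show ?thesis by (simp add: char_elt_eq_iff)
  qed
  then have "snd v = id" by auto
  then show "v \<in> translation_elts" by (cases v) (simp add: translation_elts_def)
qed

lemma RT_centralizer_iff: "a \<in> RT_centralizer D \<longleftrightarrow> a \<in> nil_hecke D \<and> keys a \<subseteq> translation_elts"
proof (intro iffI conjI)
  assume "a \<in> RT_centralizer D"
  then show n: "a \<in> nil_hecke D" and "keys a \<subseteq> translation_elts"
    using centralizer_translations nil_hecke_carrier unfolding RT_centralizer_def by blast+
next
  assume a: "a \<in> nil_hecke D \<and> keys a \<subseteq> translation_elts"
  then have "a \<star> of_RT D p = of_RT D p \<star> a" for p
    unfolding of_RT_mult unfolding of_RT_def using nil_hecke_carrier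
    by (simp add: translations_scale kq_one_right)
  then show "a \<in> RT_centralizer D" using a by (simp add: RT_centralizer_def)
qed

subsection \<open>The projection preserves the nil-Hecke ring\<close>

text \<open>
  In the quotient, \<open>x t = (x t x'\<^sup>-\<^sup>1) x'\<close> has the same image as \<open>x t x'\<^sup>-\<^sup>1\<close> for the finite part \<open>x'\<close> of
  \<open>x\<close>, and this is a translation.
\<close>

lemma kappa_of_Waf_mult:
  assumes x: "x \<in> \<W>" and a: "a \<in> \<K>"
  shows "kappa (of_Waf x \<star> a) = of_Waf x \<star> kappa a \<star> of_Waf (0, winv (snd x))"
  using a
proof (induction a rule: KQ_induct)
  case (single v f)
  obtain m w where xw: "x = (m, w)" "w \<in> weyl D" using x by (cases x) (simp add: carrier_Waf)
  obtain n u where v: "v = (n, u)" by (cases v)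
  have c: "(n, id) \<in> \<W>" "(m + coweight_act w n, w) \<in> \<W>" using xw by (simp_all add: carrier_Waf weyl.id)
  show ?case
    using x c xw(2) unfolding xw(1) v
    by (simp add: kappa_sgl of_Waf_def kq_single mult_Waf QT_act_one coweight_act_zero weyl_inv)
next
  case (add a b)
  then show ?case using x by (simp add: kq_add_right kq_add_left kappa_add KQ_mult)
qed

definition finite_part :: "'i option \<Rightarrow> 'i waf" where
  "finite_part j = (0, reflection D (affine_simple_root D j))"

text \<open>
  The element \<open>T\<^sub>j\<close> with the simple reflection replaced by its finite part.
\<close>

definition T_bar :: "'i option \<Rightarrow> 'i twisted" where
  "T_bar j = scale (inverse (1 - affine_char j)) (of_Waf (finite_part j) - \<o>)"

lemma finite_part_carrier [simp]: "finite_part j \<in> \<W>"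
  by (simp add: finite_part_def carrier_Waf weyl_reflection affine_simple_root_root)

lemma of_Waf_simple_nil_hecke: "of_Waf (\<s> j) \<in> nil_hecke D"
proof -
  have "of_Waf (\<s> j) = \<o> + scale (1 - affine_char j) (\<tau> j)"
    using affine_char_regular[of j] by (simp add: T_gen_eq)
  then show ?thesis
    unfolding affine_char_RT by (simp only:) (intro nil_hecke_add nil_hecke_one nil_hecke_scale nil_hecke_T)
qed

lemma of_Waf_nil_hecke:
  assumes "x \<in> \<W>"
  shows "of_Waf x \<in> nil_hecke D"
proof -
  obtain js where js: "reduced_word D x js" using assms by (rule reduced_word_ex)
  have "of_Waf (wp js) \<in> nil_hecke D"
  proof (induction js)
    case (Cons j js)
    then show ?case
      using nil_hecke_mult[OF of_Waf_simple_nil_hecke Cons, of j] by (simp add: wp_Cons of_Waf_mult)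
  qed (use nil_hecke_one in \<open>simp add: wp_Nil kq_one\<close>)
  then show ?thesis using js by (simp add: reduced_word_def)
qed

text \<open>
  At the affine vertex, \<open>-\<theta>\<close> is conjugate to a simple root under the finite Weyl group, so that
  \<open>T_bar\<close> is a conjugate of some \<open>T\<^sub>i\<close>.
\<close>

lemma T_bar_nil_hecke: "T_bar j \<in> nil_hecke D"
proof -
  obtain w i where w: "w \<in> weyl D" "affine_simple_root D j = w (simple_root D i)"
    using root_conj_simple[OF affine_simple_root_root[of j]] by blast
  let ?x = "(0, w)" and ?y = "(0, winv w)"
  have c: "?x \<in> \<W>" "?y \<in> \<W>" using w by (simp_all add: carrier_Waf weyl_inv)
  have "?x \<cdot> \<s> (Some i) \<cdot> ?y = (0, w \<circ> simple_refl i \<circ> winv w)"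
    using w by (simp add: simple_reflection.simps mult_Waf coweight_act_zero weyl_comp weyl_reflection simple_root_root)
  also have "w \<circ> simple_refl i \<circ> winv w = reflection D (affine_simple_root D j)"
    unfolding w(2) reflection_conj[OF w(1) simple_root_root, symmetric] using w(1)
    by (simp add: comp_assoc weyl_inv)
  finally have conj: "?x \<cdot> \<s> (Some i) \<cdot> ?y = finite_part j" by (simp add: finite_part_def)
  have xy: "?x \<cdot> ?y = \<e>" using w by (simp add: mult_Waf coweight_act_zero weyl_inv one_Waf)
  have ch: "QT_act w (inverse (1 - affine_char (Some i))) = inverse (1 - affine_char j)"
    using w by (simp add: affine_char_def QT_act_inverse QT_act_diff QT_act_one QT_act_char)
  have "of_Waf ?x \<star> \<tau> (Some i) \<star> of_Waf ?y
      = scale (inverse (1 - affine_char j)) (of_Waf ?x \<star> (of_Waf (\<s> (Some i)) - \<o>)) \<star> of_Waf ?y"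
    by (simp add: T_gen_eq of_Waf_scale c ch)
  also have "\<dots> = T_bar j"
    using c conj xy
    by (simp add: T_bar_def kq_scale_left kq_diff_right kq_diff_left kq_one_right KQ_mult KQ_diff of_Waf_mult
        flip: kq_one)
  finally show ?thesis
    using nil_hecke_mult[OF nil_hecke_mult[OF of_Waf_nil_hecke[OF c(1)] nil_hecke_T] of_Waf_nil_hecke[OF c(2)], of "Some i"]
    by simp
qed

text \<open>
  This is why the \<open>k\<^sub>w\<close> are integral. The operator that \<open>T\<^sub>j\<close> induces on the centralizer is
  \<open>k \<mapsto> (1 - e\<^sup>\<alpha>)\<^sup>-\<^sup>1 (s k s' - k)\<close>, where \<open>s'\<close> is the finite part of \<open>s\<close>.
  Writing \<open>s = 1 + (1 - e\<^sup>\<alpha>) T\<close> and \<open>s' = 1 + (1 - e\<^sup>\<alpha>) T'\<close>, and using that \<open>k\<close> commutes with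
  scalars, the denominator cancels.
\<close>

lemma kappa_T_gen:
  assumes a: "a \<in> \<K>"
  shows "kappa (\<tau> j \<star> a) = \<tau> j \<star> kappa a + kappa a \<star> T_bar j
      + \<tau> j \<star> scale (1 - affine_char j) (kappa a \<star> T_bar j)"
proof -
  let ?h = "1 - affine_char j" and ?k = "kappa a"
  have h0: "?h \<noteq> 0" by (rule affine_char_regular)
  have s: "of_Waf (\<s> j) = \<o> + scale ?h (\<tau> j)" "of_Waf (finite_part j) = \<o> + scale ?h (T_bar j)"
    using h0 by (simp_all add: T_gen_eq T_bar_def)
  have inv: "(0, winv (snd (\<s> j))) = finite_part j"
    by (simp add: finite_part_def snd_simple_reflection inv_reflection affine_simple_root_root)
  have k: "?k \<star> of_Waf (finite_part j) = ?k + scale ?h (?k \<star> T_bar j)"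
    unfolding s(2) by (simp add: kq_add_right kq_one_right translations_scale keys_kappa)
  have "kappa (of_Waf (\<s> j) \<star> a) = of_Waf (\<s> j) \<star> (?k + scale ?h (?k \<star> T_bar j))"
    unfolding kappa_of_Waf_mult[OF simple_carrier a] inv k[symmetric] by (simp add: kq_assoc)
  also have "\<dots> = ?k + scale ?h (?k \<star> T_bar j) + scale ?h (\<tau> j \<star> ?k + \<tau> j \<star> scale ?h (?k \<star> T_bar j))"
    unfolding s(1)
    by (simp only: kq_add_left[OF kq_one_carrier KQ_scale[OF T_gen_carrier]] kq_one_left
        kq_scale_left[OF T_gen_carrier] kq_add_right[OF T_gen_carrier])
  finally have "kappa (of_Waf (\<s> j) \<star> a) - ?k
      = scale ?h (\<tau> j \<star> ?k + ?k \<star> T_bar j + \<tau> j \<star> scale ?h (?k \<star> T_bar j))"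
    by (simp add: scale.scale_right_distrib)
  then show ?thesis
    using h0 by (simp add: T_gen_mult[of j a] kappa_scale kappa_diff)
qed

lemma kappa_T_elt_nil_hecke: "x \<in> \<W> \<Longrightarrow> kappa (T_elt D x) \<in> nil_hecke D"
proof (induction x rule: left_descent_induct)
  case one
  have "kappa \<o> = \<o>" by (simp add: kq_one of_Waf_def one_Waf kappa_sgl)
  then show ?case using nil_hecke_one by (simp add: T_elt_one)
next
  case (step j x)
  have "kappa (T_elt D (\<s> j \<cdot> x)) = \<tau> j \<star> kappa (T_elt D x) + kappa (T_elt D x) \<star> T_bar j
      + \<tau> j \<star> scale (1 - affine_char j) (kappa (T_elt D x) \<star> T_bar j)"
    using kappa_T_gen[OF T_elt_carrier[OF step(1)], of j] T_elt_ascent[OF step(1,2)] by simp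
  then show ?case
    unfolding affine_char_RT
    by (simp only:) (intro nil_hecke_add nil_hecke_mult nil_hecke_scale nil_hecke_T T_bar_nil_hecke step(3))
qed

subsection \<open>The projection on the two bases\<close>

lemma kappa_mult_T_finite:
  assumes "a \<in> \<K>"
  shows "kappa (a \<star> \<tau> (Some i)) = 0"
  using assms
proof (induction a rule: KQ_induct)
  case (single v f)
  have "kappa (of_Waf v \<star> of_Waf (\<s> (Some i)) - of_Waf v \<star> \<o>) = 0"
    using single by (simp add: of_Waf_mult kq_one_right kappa_diff) (simp add: of_Waf_def kappa_sgl fst_mult_simple)
  then show ?case
    using single by (simp add: T_gen_eq sgl_eq kq_scale_left of_Waf_scale kappa_scale kq_diff_right)
next
  case (add a b)
  then show ?case by (simp add: kq_add_left kappa_add)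
qed

lemma kappa_T_elt_not_min:
  assumes "x \<in> \<W>" "x \<notin> Waf_min D"
  shows "kappa (T_elt D x) = 0"
proof -
  obtain i where i: "\<not> aff_pos (aff_act x (aff_simple (Some i)))"
    using assms by (rule not_min_right_descent)
  obtain js where js: "reduced_word D x (js @ [Some i])" "reduced_word D (x \<cdot> \<s> (Some i)) js"
    using assms(1) i by (rule right_descent_word)
  show ?thesis
    unfolding T_elt_right[OF js] using assms(1) by (intro kappa_mult_T_finite T_elt_carrier) simp
qed

text \<open>
  A right descent at a finite vertex splits off a factor \<open>y\<^sub>i = 1 + T\<^sub>i\<close>, which the projection does not
  see. Removing such factors leads to the shortest element of the coset.
\<close>

lemma kappa_y_elt_min_rep: "x \<in> \<W> \<Longrightarrow> kappa (y_elt D x) = kappa (y_elt D (min_rep (fst x)))"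
proof (induction "\<l> x" arbitrary: x rule: less_induct)
  case less
  note x = less.prems
  show ?case
  proof (cases "x \<in> Waf_min D")
    case True
    then show ?thesis by (simp add: min_rep_eq)
  next
    case False
    obtain i where i: "\<not> aff_pos (aff_act x (aff_simple (Some i)))"
      using x False by (rule not_min_right_descent)
    obtain js where js: "reduced_word D x (js @ [Some i])" "reduced_word D (x \<cdot> \<s> (Some i)) js"
      using x i by (rule right_descent_word)
    have xs: "x \<cdot> \<s> (Some i) \<in> \<W>" using x by simp
    have "kappa (y_elt D x) = kappa (y_elt D (x \<cdot> \<s> (Some i)))"
      unfolding y_elt_right[OF js] using y_elt_carrier[OF xs]
      by (simp add: y_gen_def kq_add_right kq_one_right kappa_add kappa_mult_T_finite)
    also have "\<dots> = kappa (y_elt D (min_rep (fst x)))"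
      using less.hyps[OF _ xs] js x by (simp add: reduced_word_def fst_mult_simple)
    finally show ?thesis .
  qed
qed

text \<open>
  Triangularity survives the projection, with respect to the length of the shortest element of a coset:
  if \<open>x\<close> is the shortest, then no other element of its coset occurs in \<open>B x\<close>.
\<close>

lemma kappa_independent:
  assumes B: "triangular B" and sum: "lincomb (\<lambda>x. kappa (B x)) c = 0"
    and outside: "\<And>x. x \<in> keys c \<Longrightarrow> x \<notin> Waf_min D \<Longrightarrow> kappa (B x) = 0"
    and z: "z \<in> Waf_min D"
  shows "lookup c z = 0"
proof -
  have BK: "B x \<in> \<K>" if "x \<in> \<W>" for x
    using B that unfolding triangular_def carrier_KQ by blast
  have lk: "lookup (kappa (B x)) (m, id) = (\<Sum>w\<in>weyl D. lookup (B x) (m, w))"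
    if "x \<in> Waf_min D" for x m
    by (rule lookup_kappa[OF BK[OF Waf_minD[OF that]]])
  show ?thesis
  proof (rule triangular_independent[where I = "Waf_min D" and h = \<l> and k = "\<lambda>x. (fst x, id)", OF sum outside])
    fix x assume x: "x \<in> Waf_min D"
    note xW = Waf_minD[OF x]
    have "lookup (kappa (B x)) (fst x, id) = (\<Sum>w\<in>weyl D. lookup (B x) (fst x, w))"
      by (rule lk[OF x])
    also have "\<dots> = (\<Sum>w\<in>{snd x}. lookup (B x) (fst x, w))"
    proof (rule sum.mono_neutral_right[OF finite_weyl])
      show "{snd x} \<subseteq> weyl D" using xW by (simp add: carrier_Waf)
      show "\<forall>w\<in>weyl D - {snd x}. lookup (B x) (fst x, w) = 0"
      proof (rule ballI, rule ccontr)
        fix w assume w: "w \<in> weyl D - {snd x}" and ne: "lookup (B x) (fst x, w) \<noteq> 0"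
        have "(fst x, w) \<noteq> x" using w by (metis DiffD2 insertI1 snd_conv)
        moreover have "(fst x, w) \<in> \<W>" using w by (simp add: carrier_Waf)
        ultimately have "\<l> x < \<l> (fst x, w)" using Waf_min_less[OF x] by simp
        then show False using triangularD(2)[OF B xW ne] \<open>(fst x, w) \<noteq> x\<close> by simp
      qed
    qed
    also have "\<dots> = lookup (B x) x" by simp
    finally show "lookup (kappa (B x)) (fst x, id) \<noteq> 0" using triangularD(1)[OF B xW] by simp
  next
    fix x y assume x: "x \<in> Waf_min D" and y: "y \<in> Waf_min D"
      and ne: "lookup (kappa (B x)) (fst y, id) \<noteq> 0"
    obtain w where w: "w \<in> weyl D" "lookup (B x) (fst y, w) \<noteq> 0"
      using ne unfolding lk[OF x] by (meson sum.neutral)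
    have u: "(fst y, w) \<in> \<W>" using w(1) by (simp add: carrier_Waf)
    consider "(fst y, w) = x" | "\<l> (fst y, w) < \<l> x"
      using triangularD(2)[OF B Waf_minD[OF x] w(2)] by blast
    then show "y = x \<or> \<l> y < \<l> x"
    proof cases
      case 1
      then have "fst y = fst x" by auto
      then show ?thesis using Waf_min_unique[OF x y] by blast
    next
      case 2
      then show ?thesis using Waf_min_le[OF y u] by simp
    qed
  qed (use z in auto)
qed

text \<open>
  Expand \<open>kappa T\<^sub>v\<close> in the \<open>T\<^sub>x\<close> with coefficients in \<open>R(T)\<close> and project again: by independence the
  shortest representatives other than \<open>v\<close> have coefficient zero. Conversely an element of the required form
  is in the centralizer, so it is fixed by the projection, which removes all of its terms but \<open>T\<^sub>v\<close>.
\<close>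

lemma k_elt_eq:
  assumes v: "v \<in> Waf_min D"
  shows "k_elt D v = kappa (T_elt D v)"
  unfolding k_elt_def
proof (rule the_equality)
  have vW: "v \<in> \<W>" using v by (rule Waf_minD)
  have NH: "kappa (T_elt D v) \<in> nil_hecke D" by (rule kappa_T_elt_nil_hecke[OF vW])
  obtain c where c: "kappa (T_elt D v) = lincomb (T_elt D) (qt_coeffs c)" "keys c \<subseteq> \<W>"
    using nil_hecke_T_span[OF NH] unfolding integral_span_def by blast
  \<comment> \<open>The projection of \<open>T\<^sub>v + \<Sum> d\<^sub>x T\<^sub>x\<close> is the same element again, so the projections of the \<open>T\<^sub>x\<close> add up to \<open>0\<close>.\<close>
  define d where "d = c - Poly_Mapping.single v 1"
  have e: "qt_coeffs d = qt_coeffs c - sgl v 1"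
    by (simp add: d_def qt_coeffs_diff qt_coeffs_single RT_to_QT_one)
  have kd: "keys d \<subseteq> \<W>"
    using keys_diff[of c "Poly_Mapping.single v 1"] c(2) vW by (auto simp: d_def split: if_splits)
  have eq: "kappa (T_elt D v) = T_elt D v + lincomb (T_elt D) (qt_coeffs d)"
    unfolding e lincomb_diff lincomb_single c(1)[symmetric] by simp
  have "lincomb (\<lambda>x. kappa (T_elt D x)) (qt_coeffs d) = 0"
    using arg_cong[OF eq, of kappa] by (simp add: kappa_add kappa_kappa kappa_lincomb)
  then have "lookup (qt_coeffs d) z = 0" if "z \<in> Waf_min D" for z
    by (rule kappa_independent[OF triangular_T_elt])
      (use that kd kappa_T_elt_not_min in \<open>auto simp: keys_qt_coeffs\<close>)
  then have "z \<notin> keys d" if "z \<in> Waf_min D" for z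
    using that unfolding keys_qt_coeffs[symmetric] by (simp add: in_keys_iff)
  then have "keys d \<subseteq> \<W> - Waf_min D" using kd by blast
  moreover have "kappa (T_elt D v) \<in> RT_centralizer D" using NH keys_kappa by (simp add: RT_centralizer_iff)
  ultimately show "kappa (T_elt D v) \<in> RT_centralizer D \<and> (\<exists>c. keys c \<subseteq> \<W> - Waf_min D \<and>
      kappa (T_elt D v) = T_elt D v + (\<Sum>x\<in>keys c. scale (RT_to_QT (lookup c x)) (T_elt D x)))"
    using eq unfolding lincomb_qt_coeffs by blast
next
  fix a assume "a \<in> RT_centralizer D \<and> (\<exists>c. keys c \<subseteq> \<W> - Waf_min D \<and>
      a = T_elt D v + (\<Sum>x\<in>keys c. scale (RT_to_QT (lookup c x)) (T_elt D x)))"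
  then obtain c where a: "a \<in> RT_centralizer D" and c: "keys c \<subseteq> \<W> - Waf_min D"
    "a = T_elt D v + (\<Sum>x\<in>keys c. scale (RT_to_QT (lookup c x)) (T_elt D x))" by blast
  have "kappa a = a" using a by (intro kappa_translations) (simp add: RT_centralizer_iff)
  moreover have "kappa a = kappa (T_elt D v)
      + (\<Sum>x\<in>keys c. scale (RT_to_QT (lookup c x)) (kappa (T_elt D x)))"
    unfolding c(2) by (simp add: kappa_add kappa_sum kappa_scale)
  moreover have "(\<Sum>x\<in>keys c. scale (RT_to_QT (lookup c x)) (kappa (T_elt D x))) = 0"
  proof (intro sum.neutral ballI)
    fix x assume "x \<in> keys c"
    then have "x \<in> \<W>" "x \<notin> Waf_min D" using c(1) by blast+
    then show "scale (RT_to_QT (lookup c x)) (kappa (T_elt D x)) = 0"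
      by (simp add: kappa_T_elt_not_min)
  qed
  ultimately show "a = kappa (T_elt D v)" by simp
qed

lemma l_elt_eq:
  assumes w: "w \<in> Waf_min D"
  shows "l_elt D w = kappa (y_elt D w)"
proof -
  note wW = Waf_minD[OF w]
  have "kappa (y_elt D w) = (\<Sum>v | bruhat_le D v w. kappa (T_elt D v))"
    by (simp add: y_elt_eq_sum[OF wW] kappa_sum)
  also have "\<dots> = (\<Sum>v\<in>{v \<in> Waf_min D. bruhat_le D v w}. kappa (T_elt D v))"
  proof (rule sum.mono_neutral_right[OF finite_bruhat_interval[OF wW]])
    show "\<forall>v\<in>{v. bruhat_le D v w} - {v \<in> Waf_min D. bruhat_le D v w}. kappa (T_elt D v) = 0"
      using kappa_T_elt_not_min bruhat_carrier wW by blast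
  qed blast
  also have "\<dots> = l_elt D w" unfolding l_elt_def by (intro sum.cong refl) (simp add: k_elt_eq)
  finally show ?thesis by simp
qed

section \<open>The structure constants\<close>

text \<open>
  Adds up the coefficients over each coset and records the sum at the shortest representative.
\<close>

definition collapse :: "('i waf \<Rightarrow>\<^sub>0 'c) \<Rightarrow> ('i waf \<Rightarrow>\<^sub>0 'c::comm_monoid_add)" where
  "collapse c = (\<Sum>u\<in>keys c. Poly_Mapping.single (min_rep (fst u)) (lookup c u))"

lemma keys_collapse: "keys (collapse c) \<subseteq> Waf_min D"
proof -
  have "keys (collapse c) \<subseteq> (\<Union>u\<in>keys c.
      keys (Poly_Mapping.single (min_rep (fst u)) (lookup c u)))"
    unfolding collapse_def by (rule keys_sum)
  also have "\<dots> \<subseteq> Waf_min D"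
  proof (rule UN_least)
    fix u
    show "keys (Poly_Mapping.single (min_rep (fst u)) (lookup c u)) \<subseteq> Waf_min D"
      using min_rep(1)[of "fst u"] by simp
  qed
  finally show ?thesis .
qed

lemma lookup_collapse:
  assumes c: "keys c \<subseteq> \<W>" and z: "z \<in> Waf_min D"
  shows "lookup (collapse c) z = (\<Sum>u\<in>{fst z} \<times> weyl D. lookup c u)"
proof -
  have eq: "min_rep (fst u) = z \<longleftrightarrow> fst u = fst z" for u
    using min_rep(2)[of "fst u"] min_rep_eq[OF z] by metis
  have "lookup (collapse c) z
      = (\<Sum>u\<in>keys c. if fst u = fst z then lookup c u else 0)"
    unfolding collapse_def lookup_sum by (intro sum.cong refl) (simp add: lookup_single when_def eq)
  also have "\<dots> = (\<Sum>u\<in>keys c \<inter> {u. fst u = fst z}. lookup c u)"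
    by (simp add: sum.inter_restrict)
  also have "\<dots> = (\<Sum>u\<in>{fst z} \<times> weyl D. lookup c u)"
  proof (rule sum.mono_neutral_left)
    show "finite ({fst z} \<times> weyl D)" using finite_weyl by simp
    show "keys c \<inter> {u. fst u = fst z} \<subseteq> {fst z} \<times> weyl D"
    proof
      fix u assume u: "u \<in> keys c \<inter> {u. fst u = fst z}"
      then have "u \<in> \<W>" "fst z = fst u" using c by auto
      then show "u \<in> {fst z} \<times> weyl D" by (rule in_coset[rotated])
    qed
    show "\<forall>u\<in>{fst z} \<times> weyl D - keys c \<inter> {u. fst u = fst z}. lookup c u = 0"
      by (auto simp: in_keys_iff)
  qed
  finally show ?thesis .
qed

lemma qt_coeffs_collapse: "qt_coeffs (collapse c) = collapse (qt_coeffs c)"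
  by (simp add: collapse_def qt_coeffs_sum qt_coeffs_single keys_qt_coeffs lookup_qt_coeffs)

abbreviation "ky \<equiv> (\<lambda>x. kappa (y_elt D x))"

lemma lincomb_collapse:
  assumes "keys c \<subseteq> \<W>"
  shows "lincomb ky c = lincomb ky (collapse c)"
  unfolding collapse_def lincomb_sum lincomb_single unfolding lincomb_def
proof (intro sum.cong refl)
  fix u assume "u \<in> keys c"
  then have "u \<in> \<W>" using assms by blast
  then show "scale (lookup c u) (ky u) = scale (lookup c u) (ky (min_rep (fst u)))"
    by (simp only: kappa_y_elt_min_rep[symmetric])
qed

lemma kappa_y_independent:
  assumes "keys c \<subseteq> Waf_min D" "keys d \<subseteq> Waf_min D" "lincomb ky c = lincomb ky d"
  shows "c = d"
proof (rule poly_mapping_eqI)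
  fix z
  have k: "keys (c - d) \<subseteq> Waf_min D" using keys_diff[of c d] assms by blast
  have "lookup (c - d) z = 0"
  proof (cases "z \<in> Waf_min D")
    case True
    then show ?thesis
      by (intro kappa_independent[OF triangular_y_elt]) (use assms k in \<open>auto simp: lincomb_diff\<close>)
  next
    case False
    then have "z \<notin> keys (c - d)" using k by blast
    then show ?thesis by (simp add: in_keys_iff)
  qed
  then show "lookup c z = lookup d z" by (simp add: lookup_minus)
qed

lemma k_map_eq: "f \<in> KGr_carrier D \<Longrightarrow> k_map D f = lincomb ky (qt_coeffs f)"
  unfolding k_map_def lincomb_qt_coeffs KGr_carrier_def by (intro sum.cong refl) (auto simp: l_elt_eq)

lemma k_map_inj: "inj_on (k_map D) (KGr_carrier D)"
proof (rule inj_onI)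
  fix f g assume fg: "f \<in> KGr_carrier D" "g \<in> KGr_carrier D" "k_map D f = k_map D g"
  have e: "qt_coeffs f = qt_coeffs g"
  proof (rule kappa_y_independent)
    show "keys (qt_coeffs f) \<subseteq> Waf_min D" "keys (qt_coeffs g) \<subseteq> Waf_min D"
      using fg(1,2) by (simp_all add: keys_qt_coeffs KGr_carrier_def)
    show "lincomb ky (qt_coeffs f) = lincomb ky (qt_coeffs g)"
      using fg(3) by (simp only: k_map_eq[OF fg(1)] k_map_eq[OF fg(2)])
  qed
  have "RT_to_QT (lookup f u) = RT_to_QT (lookup g u)" for u
    by (simp only: lookup_qt_coeffs[symmetric] e)
  then show "f = g" by (intro poly_mapping_eqI) (simp only: RT_to_QT_eq_iff)
qed

lemma schubert_class_carrier: "x \<in> Waf_min D \<Longrightarrow> schubert_class x \<in> KGr_carrier D"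
  by (simp add: schubert_class_def KGr_carrier_def)

lemma k_map_schubert: "x \<in> Waf_min D \<Longrightarrow> k_map D (schubert_class x) = kappa (y_elt D x)"
  by (simp add: k_map_eq schubert_class_carrier) (simp add: schubert_class_def qt_coeffs_single lincomb_single RT_to_QT_one)

lemma kappa_y_nil_hecke: "x \<in> \<W> \<Longrightarrow> kappa (y_elt D x) \<in> nil_hecke D"
  unfolding y_elt_eq_sum kappa_sum
  by (intro nil_hecke_sum kappa_T_elt_nil_hecke) (use bruhat_carrier in blast)

text \<open>
  The product of two Schubert classes has coefficients in \<open>R(T)\<close>: it is in the nil-Hecke ring, so it
  is an \<open>R(T)\<close>-combination of the \<open>y\<^sub>u\<close>, and it is fixed by the projection.
\<close>

lemma pontryagin_schubert:
  assumes x: "x \<in> Waf_min D" and y: "y \<in> Waf_min D"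
  defines "f \<equiv> pontryagin D (schubert_class x) (schubert_class y)"
  shows "f \<in> KGr_carrier D" "lincomb ky (qt_coeffs f) = ky x \<star> ky y"
proof -
  let ?P = "ky x \<star> ky y"
  have "?P \<in> nil_hecke D" using x y by (intro nil_hecke_mult kappa_y_nil_hecke Waf_minD)
  then obtain c where c: "?P = lincomb (y_elt D) (qt_coeffs c)" "keys c \<subseteq> \<W>"
    using nil_hecke_y_span unfolding integral_span_def by blast
  have "?P = kappa ?P" by (rule kappa_translations[symmetric]) (intro translations_mult keys_kappa)
  also have "\<dots> = lincomb ky (qt_coeffs c)" unfolding c(1) by (rule kappa_lincomb)
  also have "\<dots> = lincomb ky (qt_coeffs (collapse c))"
    unfolding qt_coeffs_collapse using c(2) by (intro lincomb_collapse) (simp add: keys_qt_coeffs)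
  finally have P: "?P = lincomb ky (qt_coeffs (collapse c))" .
  have car: "collapse c \<in> KGr_carrier D" unfolding KGr_carrier_def using keys_collapse by blast
  have "f = collapse c"
    unfolding f_def pontryagin_def
    by (rule the_inv_into_f_eq[OF k_map_inj _ car]) (simp add: k_map_eq[OF car] k_map_schubert x y P)
  then show "f \<in> KGr_carrier D" "lincomb ky (qt_coeffs f) = ?P" using car P by simp_all
qed

lemma translation_carrier: "translation m \<in> \<W>"
  by (simp add: translation_def carrier_Waf weyl.id)

lemma b_coset_eq:
  assumes "x \<in> \<W>"
  shows "b_coset D x (translation m) = lookup (ky x) (translation m)"
  using lookup_kappa[OF y_elt_carrier[OF assms], of m]
  by (simp add: b_coset_def coset_eq translation_carrier b_coeff_def)
    (simp add: translation_def sum.cartesian_product' )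

lemma ky_eq_sum:
  assumes x: "x \<in> \<W>"
  defines "M \<equiv> fst ` keys (ky x)"
  shows "finite M" "ky x = (\<Sum>m\<in>M. scale (b_coset D x (translation m)) (of_Waf (translation m)))"
    "\<And>m. b_coset D x (translation m) \<noteq> 0 \<Longrightarrow> m \<in> M"
proof -
  show "finite M" by (simp add: M_def)
  have inj: "inj_on fst (keys (ky x))"
    by (rule inj_on_subset[OF _ keys_kappa]) (auto intro!: inj_onI simp: translation_elts_def)
  have tr: "translation (fst v) = v" if "v \<in> keys (ky x)" for v
  proof -
    have "v \<in> translation_elts" using that keys_kappa by blast
    then show ?thesis by (auto simp: translation_elts_def translation_def)
  qed
  have "ky x = (\<Sum>v\<in>keys (ky x). sgl v (lookup (ky x) v))" by (simp add: sum_single)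
  also have "\<dots> = (\<Sum>m\<in>M. scale (b_coset D x (translation m)) (of_Waf (translation m)))"
    unfolding M_def sum.reindex[OF inj] by (intro sum.cong refl) (simp add: tr b_coset_eq[OF x] sgl_eq)
  finally show "ky x = (\<Sum>m\<in>M. scale (b_coset D x (translation m)) (of_Waf (translation m)))" .
  show "m \<in> M" if "b_coset D x (translation m) \<noteq> 0" for m
  proof -
    have "translation m \<in> keys (ky x)" using that by (simp add: b_coset_eq[OF x] in_keys_iff)
    then show ?thesis unfolding M_def by (intro image_eqI) (simp_all add: translation_def)
  qed
qed

lemma e_coset_eq:
  assumes w: "w \<in> \<W>" and z: "z \<in> Waf_min D"
  shows "e_coset D w z = lookup (collapse (e_coeffs D w)) z"
  unfolding lookup_collapse[OF e_coeffs(1)[OF w] z]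
  by (simp add: e_coset_def coset_eq Waf_minD z e_coeff_def)

lemma of_Waf_translation_eq:
  "of_Waf (translation m) = lincomb ky (collapse (e_coeffs D (translation m)))"
proof -
  note e = e_coeffs[OF translation_carrier[of m]]
  have "of_Waf (translation m) = kappa (of_Waf (translation m))"
    by (simp only: translation_def of_Waf_def kappa_sgl fst_conv)
  also have "\<dots> = lincomb ky (e_coeffs D (translation m))" unfolding e(2) by (rule kappa_lincomb)
  finally show ?thesis unfolding lincomb_collapse[OF e(1)] .
qed

lemma translation_mult: "translation m \<cdot> translation n = translation (m + n)"
  by (simp add: translation_def mult_Waf coweight_act_id)

text \<open>
  Both sides are coefficients of \<open>l\<^sub>x l\<^sub>y\<close> with respect to the \<open>l\<^sub>z\<close>, which are independent over \<open>Q(T)\<close>.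
\<close>

lemma structure_constant_formula:
  assumes x: "x \<in> Waf_min D" and y: "y \<in> Waf_min D" and z: "z \<in> Waf_min D"
  defines "summand \<equiv> (\<lambda>(m1, m2). b_coset D x (translation m1) * b_coset D y (translation m2) *
           e_coset D (translation m1 \<otimes>\<^bsub>Waf D\<^esub> translation m2) z)"
  shows "finite {p. summand p \<noteq> 0}" "RT_to_QT (structure_constant D x y z) = Sum_any summand"
proof -
  let ?b = "\<lambda>x m. b_coset D x (translation m)"
  define M1 where "M1 = fst ` keys (ky x)"
  define M2 where "M2 = fst ` keys (ky y)"
  note kx = ky_eq_sum[OF Waf_minD[OF x], folded M1_def] and ky = ky_eq_sum[OF Waf_minD[OF y], folded M2_def]
  have sup: "{p. summand p \<noteq> 0} \<subseteq> M1 \<times> M2" using kx(3) ky(3) by (auto simp: summand_def)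
  have fin: "finite (M1 \<times> M2)" using kx(1) ky(1) by simp
  show "finite {p. summand p \<noteq> 0}" using sup fin by (rule finite_subset)
  let ?E = "\<lambda>m1 m2. collapse (e_coeffs D (translation m1 \<cdot> translation m2))"
  have prod_term: "scale f (of_Waf (translation m1)) \<star> scale g (of_Waf (translation m2))
      = lincomb ky (scale (f * g) (?E m1 m2))" for f g m1 m2
  proof -
    have "scale f (of_Waf (translation m1)) \<star> scale g (of_Waf (translation m2))
        = scale (f * g) (of_Waf (translation m1 \<cdot> translation m2))"
      using translation_carrier[of m1]
      by (simp add: kq_scale_left of_Waf_scale of_Waf_mult) (simp add: translation_def QT_act_id)
    then show ?thesis unfolding lincomb_scale translation_mult of_Waf_translation_eq[symmetric] .
  qed
  let ?c = "\<Sum>m1\<in>M1. \<Sum>m2\<in>M2. scale (?b x m1 * ?b y m2) (?E m1 m2)"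
  have car: "scale f (of_Waf (translation m)) \<in> \<K>" for f m by (simp add: KQ_scale translation_carrier)
  have "ky x \<star> ky y = (\<Sum>m1\<in>M1. scale (?b x m1) (of_Waf (translation m1)))
      \<star> (\<Sum>m2\<in>M2. scale (?b y m2) (of_Waf (translation m2)))"
    by (simp only: kx(2)[symmetric] ky(2)[symmetric])
  also have "\<dots> = (\<Sum>m1\<in>M1. \<Sum>m2\<in>M2. lincomb ky (scale (?b x m1 * ?b y m2) (?E m1 m2)))"
    by (simp add: kq_sum_left car kq_sum_right prod_term)
  also have "\<dots> = lincomb ky ?c" by (simp add: lincomb_sum)
  finally have prod: "ky x \<star> ky y = lincomb ky ?c" .
  define f where "f = pontryagin D (schubert_class x) (schubert_class y)"
  note f = pontryagin_schubert[OF x y, folded f_def]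
  have kc: "keys ?c \<subseteq> Waf_min D"
  proof
    fix u assume "u \<in> keys ?c"
    then have "(\<Sum>m1\<in>M1. \<Sum>m2\<in>M2. ?b x m1 * ?b y m2 * lookup (?E m1 m2) u) \<noteq> 0"
      by (simp add: in_keys_iff lookup_sum lookup_scale)
    then obtain m1 m2 where "lookup (?E m1 m2) u \<noteq> 0"
      by (metis (no_types, lifting) mult_zero_right sum.neutral)
    then have "u \<in> keys (?E m1 m2)" by (simp add: in_keys_iff)
    then show "u \<in> Waf_min D" using keys_collapse by blast
  qed
  have "qt_coeffs f = ?c"
  proof (rule kappa_y_independent[OF _ kc])
    show "keys (qt_coeffs f) \<subseteq> Waf_min D"
      using f(1) by (simp add: keys_qt_coeffs KGr_carrier_def)
    show "lincomb ky (qt_coeffs f) = lincomb ky ?c" unfolding f(2) by (rule prod)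
  qed
  then have "RT_to_QT (lookup f z) = lookup ?c z"
    by (simp only: lookup_qt_coeffs[symmetric])
  also have "\<dots> = (\<Sum>m1\<in>M1. \<Sum>m2\<in>M2. summand (m1, m2))"
    by (simp add: lookup_sum lookup_scale summand_def e_coset_eq[OF _ z] translation_carrier)
  also have "\<dots> = (\<Sum>p\<in>M1 \<times> M2. summand p)" by (simp add: sum.cartesian_product)
  also have "\<dots> = Sum_any summand" using Sum_any.expand_superset[OF fin sup] by simp
  finally show "RT_to_QT (structure_constant D x y z) = Sum_any summand"
    by (simp add: structure_constant_def f_def)
qed

end

theorem theorem2:
  fixes D :: "'i::{finite,linorder} root_datum" and x y z :: "'i waf"
  assumes "simple_sc_root_datum D"
    and "x \<in> Waf_min D" and "y \<in> Waf_min D" and "z \<in> Waf_min D"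
  shows
    "let summand = (\<lambda>(m1, m2).
           b_coset D x (translation m1) * b_coset D y (translation m2) *
           e_coset D (translation m1 \<otimes>\<^bsub>Waf D\<^esub> translation m2) z)
     in finite {p. summand p \<noteq> 0} \<and>
        RT_to_QT (structure_constant D x y z) = (\<Sum>p. summand p)"
proof -
  interpret ordered_root_datum D
    using assms(1) by (rule ordered_root_datum.intro)
  show ?thesis
    unfolding Let_def using structure_constant_formula[OF assms(2-4)] by blast
qed

end
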